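(* Let $W$ be a vector space, $\mathcal W\subset\mathrm{LFie}(W)$ a local collection of logarithmic fields, and let $\bar{\mathcal W}\subset\mathrm{LFie}(W)$ be the smallest subspace containing $\mathcal W\cup\{I\}$ ($I$ the identity operator) and closed under $D_\zeta$ and all $n$-th products ($n\in\mathbb Z$); it is a local collection. Then the $n$-th products endow $\bar{\mathcal W}$ with the structure of a vertex algebra with vacuum vector $I$ and translation operator $D_z$.
   Context: All vector spaces are over $\mathbb C$; $D^{(k)}=D^k/k!$ for an operator $D$. $z,z_1,z_2,\dots$ are commuting formal variables, $\zeta,\zeta_1,\zeta_2,\dots$ are further formal variables (thought of as $\zeta=\log z$, $\zeta_i=\log z_i$), and $z_{ij}=z_i-z_j$. Put $D_z=\partial_z+z^{-1}\partial_\zeta$, $D_\zeta=z\partial_z+\partial_\zeta$, and similarly $D_{z_i},D_{\zeta_i}$. For a vector space $W$ and $\alpha\in\mathbb C/\mathbb Z$, $W[\zeta][[z]]z^{-\alpha}$ is the space of formal series $\sum_{i\ge0}w_i(\zeta)z^{i-m}$ with $w_i(\zeta)\in W[\zeta]$, $m\in\alpha$. Let $\mathrm{LFie}_\alpha(W)=\mathrm{Hom}_{\mathbb C}(W,W[\zeta][[z]]z^{-\alpha})$ and $\mathrm{LFie}(W)=\bigoplus_{\alpha\in\mathbb C/\mathbb Z}\mathrm{LFie}_\alpha(W)$; its elements, written $a(z)$ or $a(\zeta,z)$, are called logarithmic fields. Two logarithmic fields $a,b$ are local if $z_{12}^N a(z_1)b(z_2)=z_{12}^N b(z_2)a(z_1)$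 for some integer $N\ge0$. For local $a,b$ and $n\in\mathbb Z$, the $n$-th product is the logarithmic field given by $(a_{(n)}b)(z)v=D_{z_1}^{(N-1-n)}\bigl(z_{12}^N a(z_1)b(z_2)v\bigr)\big|_{z_1=z_2=z,\ \zeta_1=\zeta_2=\zeta}$ ($v\in W$) for $n\le N-1$, and $a_{(n)}b=0$ for $n\ge N$ (independent of the choice of $N$ in the locality condition). A local collection is a set of logarithmic fields in which every pair $a,b$ (including $a=b$) is local. A vertex algebra is a vector space $V$ with a vector $\mathbf 1$ and a linear map $Y\colon V\to\mathrm{Hom}(V,V((x)))$, $Y(a,x)b=\sum_{n\in\mathbb Z}x^{-n-1}a_{(n)}b$, such that $Y(\mathbf 1)$ is the identity, $a_{(-1)}\mathbf 1=a$ and $a_{(n)}\mathbf 1=0$ for $n\ge0$, the translation operator $Ta=a_{(-2)}\mathbf 1$ satisfies $[T,Y(a,x)]=\partial_xY(a,x)$, and all fields $Y(a,x)$, $Y(b,x)$ are mutually local. *)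

theory Defs
  imports Complex_Main "HOL-Library.Function_Algebras"
begin

text \<open>
  Functions carry the pointwise group structure of \<^theory>\<open>HOL-Library.Function_Algebras\<close>;
  the scalar multiplication of a vector space is lifted to functions by \<open>pscale\<close>.
\<close>

definition pscale :: "('k \<Rightarrow> 'v \<Rightarrow> 'v) \<Rightarrow> 'k \<Rightarrow> ('x \<Rightarrow> 'v) \<Rightarrow> 'x \<Rightarrow> 'v" where
  "pscale s c f = (\<lambda>x. s c (f x))"

lemma vector_space_pscale:
  assumes "vector_space s"
  shows "vector_space (pscale s)"
proof -
  interpret vector_space s by fact
  show ?thesis
    by unfold_locales
      (simp_all add: pscale_def fun_eq_iff scale_right_distrib scale_left_distrib)
qed


section \<open>Formal series in \<open>z\<close> and \<open>\<zeta>\<close>\<close>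

text \<open>
  A series is given by its coefficients: \<open>f c k\<close> is the coefficient of \<open>z\<^sup>c \<zeta>\<^sup>k\<close>.
  A series in \<open>z\<^sub>1, \<zeta>\<^sub>1, z\<^sub>2, \<zeta>\<^sub>2\<close> is a series in \<open>z\<^sub>1, \<zeta>\<^sub>1\<close> whose coefficients are series
  in \<open>z\<^sub>2, \<zeta>\<^sub>2\<close>, so that operators in \<open>z\<^sub>1, \<zeta>\<^sub>1\<close> are instances of the one-variable ones.
  The argument \<open>s\<close> is always the scalar multiplication on the space of coefficients.
\<close>

type_synonym 'v lseries = "complex \<Rightarrow> nat \<Rightarrow> 'v"
type_synonym 'v lseries2 = "'v lseries lseries"
type_synonym 'v lfield = "'v \<Rightarrow> 'v lseries"

abbreviation series_scale :: "(complex \<Rightarrow> 'v \<Rightarrow> 'v) \<Rightarrow> complex \<Rightarrow> 'v lseries \<Rightarrow> 'v lseries" where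
  "series_scale s \<equiv> pscale (pscale s)"

abbreviation field_scale :: "(complex \<Rightarrow> 'v \<Rightarrow> 'v) \<Rightarrow> complex \<Rightarrow> 'v lfield \<Rightarrow> 'v lfield" where
  "field_scale s \<equiv> pscale (series_scale s)"

definition zshift :: "complex \<Rightarrow> 'v lseries \<Rightarrow> 'v lseries" \<comment> \<open>multiplication by \<open>z\<^sup>p\<close>\<close> where
  "zshift p f = (\<lambda>c k. f (c - p) k)"

definition partial_z :: "(complex \<Rightarrow> 'v \<Rightarrow> 'v) \<Rightarrow> 'v lseries \<Rightarrow> 'v lseries" where
  "partial_z s f = (\<lambda>c k. s (c + 1) (f (c + 1) k))"

definition partial_zeta :: "(complex \<Rightarrow> 'v \<Rightarrow> 'v) \<Rightarrow> 'v lseries \<Rightarrow> 'v lseries" where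
  "partial_zeta s f = (\<lambda>c k. s (of_nat (k + 1)) (f c (k + 1)))"

definition D_z :: "(complex \<Rightarrow> 'v \<Rightarrow> 'v::ab_group_add) \<Rightarrow> 'v lseries \<Rightarrow> 'v lseries" where
  "D_z s f = partial_z s f + zshift (-1) (partial_zeta s f)"

definition D_zeta :: "(complex \<Rightarrow> 'v \<Rightarrow> 'v::ab_group_add) \<Rightarrow> 'v lseries \<Rightarrow> 'v lseries" where
  "D_zeta s f = zshift 1 (partial_z s f) + partial_zeta s f"

definition mult_z12 :: "'v::ab_group_add lseries2 \<Rightarrow> 'v lseries2"
    \<comment> \<open>multiplication by \<open>z\<^sub>1 - z\<^sub>2\<close>\<close> where
  "mult_z12 f = zshift 1 f - (\<lambda>c1 k1. zshift 1 (f c1 k1))"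

definition divpow :: "(complex \<Rightarrow> 'u \<Rightarrow> 'u) \<Rightarrow> ('u \<Rightarrow> 'u) \<Rightarrow> nat \<Rightarrow> 'u \<Rightarrow> 'u"
    \<comment> \<open>\<open>D\<^sup>k / k!\<close>\<close> where
  "divpow s D k f = s (1 / fact k) ((D ^^ k) f)"

text \<open>
  The restriction to \<open>z\<^sub>1 = z\<^sub>2 = z\<close>, \<open>\<zeta>\<^sub>1 = \<zeta>\<^sub>2 = \<zeta>\<close>.  It makes sense when each coefficient of the
  result is a finite sum, as is the case for \<open>z\<^sub>1\<^sub>2\<^sup>N a(z\<^sub>1) b(z\<^sub>2) v\<close> with local \<open>a\<close>, \<open>b\<close>
  and \<open>N\<close> as in the locality condition, and its derivatives.
\<close>

definition diag :: "'v::ab_group_add lseries2 \<Rightarrow> 'v lseries" where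
  "diag f = (\<lambda>c k. \<Sum>(c1, k1, c2, k2) \<in>
     {(c1, k1, c2, k2). c1 + c2 = c \<and> k1 + k2 = k \<and> f c1 k1 c2 k2 \<noteq> 0}. f c1 k1 c2 k2)"


section \<open>Logarithmic fields\<close>

definition C_mod_Z :: "complex set set" where
  "C_mod_Z = UNIV // {(x, y). x - y \<in> \<int>}"

definition log_series :: "complex set \<Rightarrow> 'v::zero lseries set"
    \<comment> \<open>\<open>W[\<zeta>][[z]]z\<^sup>-\<^sup>\<alpha>\<close>\<close> where
  "log_series \<alpha> = {f. (\<forall>c. finite {k. f c k \<noteq> 0}) \<and>
     (\<exists>m\<in>\<alpha>. \<forall>c k. f c k \<noteq> 0 \<longrightarrow> (\<exists>i::nat. c = of_nat i - m))}"

definition LFie_comp ::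
    "(complex \<Rightarrow> 'v \<Rightarrow> 'v::ab_group_add) \<Rightarrow> complex set \<Rightarrow> 'v lfield set" where
  "LFie_comp s \<alpha> = {a. Vector_Spaces.linear s (series_scale s) a \<and> range a \<subseteq> log_series \<alpha>}"

text \<open>
  All \<open>LFie_comp s \<alpha>\<close> lie in the common space \<^typ>\<open>'v lfield\<close>, where for different cosets \<open>\<alpha>\<close>
  they are independent (the exponents of \<open>z\<close> are in disjoint sets), so their direct sum is
  the space of finite sums.
\<close>

definition LFie :: "(complex \<Rightarrow> 'v \<Rightarrow> 'v::ab_group_add) \<Rightarrow> 'v lfield set" where
  "LFie s = {a. \<exists>A f. finite A \<and> A \<subseteq> C_mod_Z \<and> (\<forall>\<alpha>\<in>A. f \<alpha> \<in> LFie_comp s \<alpha>) \<and>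
     a = (\<Sum>\<alpha>\<in>A. f \<alpha>)}"

definition id_field :: "'v::zero lfield" where
  "id_field v = (\<lambda>c k. if c = 0 \<and> k = 0 then v else 0)"

definition field_D_z :: "(complex \<Rightarrow> 'v \<Rightarrow> 'v::ab_group_add) \<Rightarrow> 'v lfield \<Rightarrow> 'v lfield" where
  "field_D_z s a = (\<lambda>v. D_z s (a v))"

definition field_D_zeta :: "(complex \<Rightarrow> 'v \<Rightarrow> 'v::ab_group_add) \<Rightarrow> 'v lfield \<Rightarrow> 'v lfield" where
  "field_D_zeta s a = (\<lambda>v. D_zeta s (a v))"

definition comp12 :: "'v lfield \<Rightarrow> 'v lfield \<Rightarrow> 'v \<Rightarrow> 'v lseries2"
    \<comment> \<open>\<open>a(z\<^sub>1) b(z\<^sub>2) v\<close>\<close> where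
  "comp12 a b v = (\<lambda>c1 k1 c2 k2. a (b v c2 k2) c1 k1)"

definition comp21 :: "'v lfield \<Rightarrow> 'v lfield \<Rightarrow> 'v \<Rightarrow> 'v lseries2"
    \<comment> \<open>\<open>b(z\<^sub>2) a(z\<^sub>1) v\<close>\<close> where
  "comp21 a b v = (\<lambda>c1 k1 c2 k2. b (a v c1 k1) c2 k2)"

definition local_at :: "nat \<Rightarrow> 'v::ab_group_add lfield \<Rightarrow> 'v lfield \<Rightarrow> bool" where
  "local_at N a b \<longleftrightarrow> (\<forall>v. (mult_z12 ^^ N) (comp12 a b v) = (mult_z12 ^^ N) (comp21 a b v))"

definition local_fields :: "'v::ab_group_add lfield \<Rightarrow> 'v lfield \<Rightarrow> bool" where
  "local_fields a b \<longleftrightarrow> (\<exists>N. local_at N a b)"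

definition local_collection ::
    "(complex \<Rightarrow> 'v \<Rightarrow> 'v::ab_group_add) \<Rightarrow> 'v lfield set \<Rightarrow> bool" where
  "local_collection s U \<longleftrightarrow> U \<subseteq> LFie s \<and> (\<forall>a\<in>U. \<forall>b\<in>U. local_fields a b)"

definition nth_prod_at ::
    "(complex \<Rightarrow> 'v \<Rightarrow> 'v::ab_group_add) \<Rightarrow> nat \<Rightarrow> int \<Rightarrow> 'v lfield \<Rightarrow> 'v lfield \<Rightarrow> 'v lfield" where
  "nth_prod_at s N n a b =
     (if n \<le> int N - 1
      then (\<lambda>v. diag (divpow (series_scale (series_scale s)) (D_z (series_scale s))
                        (nat (int N - 1 - n)) ((mult_z12 ^^ N) (comp12 a b v))))
      else 0)"

text \<open>
  For local \<open>a\<close>, \<open>b\<close> in \<open>LFie s\<close> the value does not depend on the \<open>N\<close> chosen; for non-local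
  pairs \<open>nth_prod\<close> has no meaning.
\<close>

definition nth_prod ::
    "(complex \<Rightarrow> 'v \<Rightarrow> 'v::ab_group_add) \<Rightarrow> int \<Rightarrow> 'v lfield \<Rightarrow> 'v lfield \<Rightarrow> 'v lfield" where
  "nth_prod s n a b = nth_prod_at s (SOME N. local_at N a b) n a b"

text \<open>
  Products are only defined for local pairs, hence closedness only concerns those.  With this
  reading \<open>LFie s\<close> itself is closed, so a smallest closed subspace containing a given subset
  always exists.
\<close>

definition closed_field_subspace ::
    "(complex \<Rightarrow> 'v \<Rightarrow> 'v::ab_group_add) \<Rightarrow> 'v lfield set \<Rightarrow> bool" where
  "closed_field_subspace s U \<longleftrightarrow>
     U \<subseteq> LFie s \<and> module.subspace (field_scale s) U \<and>
     (\<forall>a\<in>U. field_D_zeta s a \<in> U) \<and>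
     (\<forall>a\<in>U. \<forall>b\<in>U. \<forall>n. local_fields a b \<longrightarrow> nth_prod s n a b \<in> U)"

definition field_closure ::
    "(complex \<Rightarrow> 'v \<Rightarrow> 'v::ab_group_add) \<Rightarrow> 'v lfield set \<Rightarrow> 'v lfield set" where
  "field_closure s U = closed_field_subspace s hull (U \<union> {id_field})"


section \<open>Vertex algebras\<close>

text \<open>
  The underlying space \<open>V\<close> is a subspace of an ambient vector space, and \<open>p n a b\<close> is \<open>a\<^sub>(\<^sub>n\<^sub>) b\<close>.
  Series in \<open>x\<close> are given by their coefficients, so \<open>va_Y p a b m\<close> is the coefficient of \<open>x\<^sup>m\<close>
  in \<open>Y(a,x)b\<close>.
\<close>

definition va_Y :: "(int \<Rightarrow> 'v \<Rightarrow> 'v \<Rightarrow> 'v) \<Rightarrow> 'v \<Rightarrow> 'v \<Rightarrow> int \<Rightarrow> 'v" where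
  "va_Y p a b = (\<lambda>m. p (- m - 1) a b)"

definition va_translation :: "(int \<Rightarrow> 'v \<Rightarrow> 'v \<Rightarrow> 'v) \<Rightarrow> 'v \<Rightarrow> 'v \<Rightarrow> 'v" where
  "va_translation p vac a = p (-2) a vac"

definition laurent :: "'v::zero set \<Rightarrow> (int \<Rightarrow> 'v) set" \<comment> \<open>\<open>V((x))\<close>\<close> where
  "laurent V = {f. range f \<subseteq> V \<and> (\<exists>M. \<forall>m<M. f m = 0)}"

definition deriv_x :: "(complex \<Rightarrow> 'v \<Rightarrow> 'v) \<Rightarrow> (int \<Rightarrow> 'v) \<Rightarrow> int \<Rightarrow> 'v" where
  "deriv_x s f = (\<lambda>m. s (of_int (m + 1)) (f (m + 1)))"

definition mult_xy :: "(int \<Rightarrow> int \<Rightarrow> 'v::ab_group_add) \<Rightarrow> int \<Rightarrow> int \<Rightarrow> 'v"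
    \<comment> \<open>multiplication by \<open>x - y\<close>\<close> where
  "mult_xy f = (\<lambda>i j. f (i - 1) j - f i (j - 1))"

definition va_local ::
    "'v::ab_group_add set \<Rightarrow> (int \<Rightarrow> 'v \<Rightarrow> 'v \<Rightarrow> 'v) \<Rightarrow> 'v \<Rightarrow> 'v \<Rightarrow> bool" where
  "va_local V p a b \<longleftrightarrow> (\<exists>N. \<forall>c\<in>V.
     (mult_xy ^^ N) (\<lambda>i j. va_Y p a (va_Y p b c j) i) =
     (mult_xy ^^ N) (\<lambda>i j. va_Y p b (va_Y p a c i) j))"

definition vertex_algebra ::
    "(complex \<Rightarrow> 'v \<Rightarrow> 'v::ab_group_add) \<Rightarrow> 'v set \<Rightarrow> 'v \<Rightarrow> (int \<Rightarrow> 'v \<Rightarrow> 'v \<Rightarrow> 'v) \<Rightarrow> bool" where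
  "vertex_algebra s V vac p \<longleftrightarrow>
     vector_space s \<and> module.subspace s V \<and> vac \<in> V \<and>
     \<comment> \<open>\<open>Y\<close> is a linear map from \<open>V\<close> to \<open>Hom(V, V((x)))\<close>\<close>
     (\<forall>a\<in>V. \<forall>b\<in>V. va_Y p a b \<in> laurent V) \<and>
     (\<forall>a\<in>V. \<forall>b\<in>V. \<forall>b'\<in>V. va_Y p a (b + b') = va_Y p a b + va_Y p a b') \<and>
     (\<forall>a\<in>V. \<forall>b\<in>V. \<forall>t. va_Y p a (s t b) = pscale s t (va_Y p a b)) \<and>
     (\<forall>a\<in>V. \<forall>a'\<in>V. \<forall>b\<in>V. va_Y p (a + a') b = va_Y p a b + va_Y p a' b) \<and>
     (\<forall>a\<in>V. \<forall>b\<in>V. \<forall>t. va_Y p (s t a) b = pscale s t (va_Y p a b)) \<and>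
     \<comment> \<open>vacuum\<close>
     (\<forall>b\<in>V. va_Y p vac b = (\<lambda>m. if m = 0 then b else 0)) \<and>
     (\<forall>a\<in>V. p (-1) a vac = a \<and> (\<forall>n\<ge>0. p n a vac = 0)) \<and>
     \<comment> \<open>translation covariance \<open>[T, Y(a,x)] = \<partial>\<^sub>x Y(a,x)\<close>\<close>
     (\<forall>a\<in>V. \<forall>b\<in>V.
        (\<lambda>m. va_translation p vac (va_Y p a b m)) - va_Y p a (va_translation p vac b) =
        deriv_x s (va_Y p a b)) \<and>
     \<comment> \<open>locality\<close>
     (\<forall>a\<in>V. \<forall>b\<in>V. va_local V p a b)"

end

theory Submission
  imports Defs
begin

text \<open>
  The products of two fields are the coefficients of an expansion along the diagonal. If \<open>F\<close> is a
  series in \<open>z\<^sub>1, \<zeta>\<^sub>1, z\<^sub>2, \<zeta>\<^sub>2\<close> such that \<open>z\<^sub>1\<^sub>2\<^sup>N F\<close> can be restricted to \<open>z\<^sub>1 = z\<^sub>2\<close>,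
  \<open>\<zeta>\<^sub>1 = \<zeta>\<^sub>2\<close>, then \<open>R\<^sub>n F = D\<^sub>1\<^sup>k(z\<^sub>1\<^sub>2\<^sup>N F) / k!\<close> on the diagonal, with \<open>k = N - 1 - n\<close>, is the
  coefficient of \<open>z\<^sub>1\<^sub>2\<^sup>-\<^sup>n\<^sup>-\<^sup>1\<close> in the Taylor expansion of \<open>F\<close>; this is \<open>pole_coeff\<close>, and
  \<open>(a\<^sub>(\<^sub>n\<^sub>)b)(z)v\<close> is \<open>R\<^sub>n\<close> of \<open>a(z\<^sub>1)b(z\<^sub>2)v\<close>. It is independent of \<open>N\<close> because
  \<open>D\<^sub>1z\<^sub>1\<^sub>2 = z\<^sub>1\<^sub>2D\<^sub>1 + 1\<close> and \<open>z\<^sub>1\<^sub>2\<close> vanishes on the diagonal. The logarithms enter only through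
  this relation and through \<open>(D\<^sub>1 + D\<^sub>2)F\<close> restricting to \<open>D\<^sub>z\<close> of the restriction of \<open>F\<close>
  (\<open>diag_D\<close>), so that \<open>R\<^sub>n\<close> obeys the rules of ordinary Laurent coefficients: multiplication by
  \<open>z\<^sub>1\<^sub>2\<close> raises \<open>n\<close> by one, \<open>R\<^sub>n D\<^sub>1 = -n R\<^sub>n\<^sub>-\<^sub>1\<close>, and \<open>R\<^sub>n\<close> intertwines \<open>D\<^sub>1 + D\<^sub>2\<close> with \<open>D\<^sub>z\<close>.
  Bilinearity, the vacuum axioms and translation covariance are immediate consequences.

  The two statements about locality concern three fields. Let \<open>K\<close> be a series in three variables
  and expand it at \<open>z\<^sub>2 = z\<^sub>3\<close>. Multiplication of the coefficients by \<open>z\<^sub>1 - z\<close> comes from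
  multiplication of \<open>K\<close> by \<open>z\<^sub>1\<^sub>3\<close>, and \<open>z\<^sub>1\<^sub>3 = z\<^sub>1\<^sub>2 + z\<^sub>2\<^sub>3\<close>; hence
  \<open>(z\<^sub>1 - z) R\<^sub>n K = R\<^sub>n (z\<^sub>1\<^sub>2 K) + R\<^sub>n\<^sub>+\<^sub>1 K\<close> (\<open>mult_z12_coeffwise_pole_coeff\<close>). Since
  \<open>R\<^sub>n K = 0\<close> for large \<open>n\<close>, an induction shows that a power of \<open>z\<^sub>1 - z\<close> kills \<open>R\<^sub>n K\<close> when a power
  of \<open>z\<^sub>1\<^sub>2\<close> kills \<open>K\<close>. For \<open>K\<close> the difference of \<open>c(z\<^sub>1)a(z\<^sub>2)b(z\<^sub>3)v\<close> and
  \<open>a(z\<^sub>2)b(z\<^sub>3)c(z\<^sub>1)v\<close>, multiplied by a power of \<open>z\<^sub>1\<^sub>3\<close>, this is Dong's lemma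
  (\<open>local_nth_prod\<close>): products of fields local to \<open>c\<close> are local to \<open>c\<close>. So the fields local to all
  members of a given set form a closed subspace (\<open>commutant_closed\<close>), and applying minimality of the
  closure twice, as one does for commuting operators and the algebra that they generate, shows that
  the closure is a local collection.

  For locality in the vertex algebra, \<open>a\<^sub>(\<^sub>i\<^sub>)(b\<^sub>(\<^sub>j\<^sub>)c)\<close> is a double coefficient of
  \<open>a(z\<^sub>1)b(z\<^sub>2)c(z\<^sub>3)v\<close>, first along \<open>z\<^sub>2 = z\<^sub>3\<close> and then along \<open>z\<^sub>1 = z\<^sub>3\<close>. The same relation
  between \<open>z\<^sub>1\<^sub>2\<close>, \<open>z\<^sub>1\<^sub>3\<close> and \<open>z\<^sub>2\<^sub>3\<close> turns multiplication by \<open>x - y\<close> into multiplication by \<open>z\<^sub>1\<^sub>2\<close>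
  under the coefficients. If \<open>n\<close> is the order of locality of \<open>a\<close> and \<open>b\<close>, then
  \<open>K = z\<^sub>1\<^sub>2\<^sup>n a(z\<^sub>1)b(z\<^sub>2)c(z\<^sub>3)v\<close> does not depend on the order of \<open>a\<close> and \<open>b\<close>, and after
  multiplication by powers of \<open>z\<^sub>1\<^sub>3\<close> and \<open>z\<^sub>2\<^sub>3\<close> it can be restricted to \<open>z\<^sub>1 = z\<^sub>2 = z\<^sub>3\<close> in a single
  step; so the order of the two expansions does not matter (\<open>double_coeff_swap\<close>). The powers of
  \<open>z\<^sub>1\<^sub>3\<close> and \<open>z\<^sub>2\<^sub>3\<close> may depend on \<open>c\<close>, but \<open>n\<close> does not, as the definition of locality requires.
\<close>

text \<open>
  As simplification rules these equations would replace sums of series by lambda terms, which hides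
  them from the additivity laws of the operators; they are therefore used on demand.
\<close>

lemmas pointwise = fun_eq_iff plus_fun_apply minus_apply zero_fun_apply uminus_apply

declare plus_fun_apply [simp del] minus_apply [simp del] zero_fun_apply [simp del]
  uminus_apply [simp del]

section \<open>Operators on series\<close>

text \<open>
  Operators in the second variable of a series in two variables, and in the two inner variables of a
  series in three variables, act coefficient by coefficient.
\<close>

definition coeffwise :: "('u \<Rightarrow> 'v) \<Rightarrow> 'u lseries \<Rightarrow> 'v lseries" where
  "coeffwise P F = (\<lambda>c k. P (F c k))"

definition swap :: "'v lseries2 \<Rightarrow> 'v lseries2" where
  "swap F = (\<lambda>c1 k1 c2 k2. F c2 k2 c1 k1)"

lemma mult_z12_apply:
  "mult_z12 f c1 k1 c2 k2 = f (c1 - 1) k1 c2 k2 - f c1 k1 (c2 - 1) k2"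
  by (simp add: mult_z12_def zshift_def pointwise)

lemma funpow_commute: "(\<And>x. f (g x) = g (f' x)) \<Longrightarrow> (f ^^ n) (g x) = g ((f' ^^ n) x)"
  by (induction n) simp_all

lemma mult_z12_add: "mult_z12 (f + g) = mult_z12 f + mult_z12 g"
  by (simp add: pointwise mult_z12_apply)

lemma mult_z12_diff: "mult_z12 (f - g) = mult_z12 f - mult_z12 g"
  by (simp add: pointwise mult_z12_apply)

lemma mult_z12_zero [simp]: "mult_z12 0 = 0"
  by (simp add: pointwise mult_z12_apply)

lemma mult_z12_pow_add: "(mult_z12 ^^ n) (f + g) = (mult_z12 ^^ n) f + (mult_z12 ^^ n) g"
  by (induction n) (simp_all add: mult_z12_add)

lemma mult_z12_pow_diff: "(mult_z12 ^^ n) (f - g) = (mult_z12 ^^ n) f - (mult_z12 ^^ n) g"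
  by (induction n) (simp_all add: mult_z12_diff)

lemma mult_z12_pow_zero [simp]: "(mult_z12 ^^ n) 0 = 0"
  by (induction n) simp_all

lemma mult_z12_swap: "mult_z12 (swap F) = - swap (mult_z12 F)"
  by (simp add: pointwise mult_z12_apply swap_def)

section \<open>Restriction to the diagonal\<close>

text \<open>
  Stronger than the finiteness of the sums in \<open>diag\<close>, because the exponents of \<open>\<zeta>\<^sub>1, \<zeta>\<^sub>2\<close> are
  not fixed; it also makes each coefficient of the restriction a polynomial in \<open>\<zeta>\<close>.
\<close>

definition restrictable :: "'v::zero lseries2 \<Rightarrow> bool" where
  "restrictable F \<longleftrightarrow> (\<forall>c. finite {(c1, k1, c2, k2). c1 + c2 = c \<and> F c1 k1 c2 k2 \<noteq> 0})"

lemma restrictable_shift: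
  assumes "restrictable F"
    and "\<And>c1 k1 c2 k2. G c1 k1 c2 k2 \<noteq> 0 \<Longrightarrow> F (c1 + d1) (k1 + j1) (c2 + d2) (k2 + j2) \<noteq> 0"
  shows "restrictable G"
  unfolding restrictable_def
proof
  fix c
  let ?h = "\<lambda>(c1, k1, c2, k2). (c1 + d1, k1 + j1, c2 + d2, k2 + j2)"
  let ?S = "{(c1, k1, c2, k2). c1 + c2 = c + d1 + d2 \<and> F c1 k1 c2 k2 \<noteq> 0}"
  have "finite ?S" using assms(1) by (simp add: restrictable_def)
  moreover have "inj ?h" by (auto simp: inj_on_def)
  ultimately have "finite (?h -` ?S)" by (rule finite_vimageI)
  then show "finite {(c1, k1, c2, k2). c1 + c2 = c \<and> G c1 k1 c2 k2 \<noteq> 0}"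
    by (rule rev_finite_subset) (auto dest: assms(2))
qed

lemma restrictable_union:
  assumes "restrictable F" "restrictable G"
    and "\<And>c1 k1 c2 k2. H c1 k1 c2 k2 \<noteq> 0 \<Longrightarrow> F c1 k1 c2 k2 \<noteq> 0 \<or> G c1 k1 c2 k2 \<noteq> 0"
  shows "restrictable H"
  unfolding restrictable_def
proof
  fix c
  have "finite ({(c1, k1, c2, k2). c1 + c2 = c \<and> F c1 k1 c2 k2 \<noteq> 0} \<union>
      {(c1, k1, c2, k2). c1 + c2 = c \<and> G c1 k1 c2 k2 \<noteq> 0})"
    using assms(1,2) by (simp add: restrictable_def)
  then show "finite {(c1, k1, c2, k2). c1 + c2 = c \<and> H c1 k1 c2 k2 \<noteq> 0}"
    by (rule rev_finite_subset) (use assms(3) in blast)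
qed

lemma restrictable_support:
  "restrictable F \<Longrightarrow> (\<And>c1 k1 c2 k2. H c1 k1 c2 k2 \<noteq> 0 \<Longrightarrow> F c1 k1 c2 k2 \<noteq> 0) \<Longrightarrow> restrictable H"
  by (rule restrictable_union[of F F]) auto

lemma restrictable_zero [simp]: "restrictable 0"
  by (simp add: restrictable_def pointwise case_prod_unfold)

lemma restrictable_add:
  fixes F G :: "'v::ab_group_add lseries2"
  shows "restrictable F \<Longrightarrow> restrictable G \<Longrightarrow> restrictable (F + G)"
  by (erule (1) restrictable_union) (auto simp: pointwise)

lemma restrictable_diff:
  fixes F G :: "'v::ab_group_add lseries2"
  shows "restrictable F \<Longrightarrow> restrictable G \<Longrightarrow> restrictable (F - G)"
  by (erule (1) restrictable_union) (auto simp: pointwise)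

lemma restrictable_zshift: "restrictable F \<Longrightarrow> restrictable (zshift p F)"
  by (erule restrictable_shift[where ?d1.0 = "-p" and ?d2.0 = 0 and ?j1.0 = 0 and ?j2.0 = 0])
    (simp add: zshift_def)

lemma restrictable_coeffwise_zshift: "restrictable F \<Longrightarrow> restrictable (coeffwise (zshift p) F)"
  by (erule restrictable_shift[where ?d1.0 = 0 and ?d2.0 = "-p" and ?j1.0 = 0 and ?j2.0 = 0])
    (simp add: zshift_def coeffwise_def)

lemma mult_z12_alt: "mult_z12 F = zshift 1 F - coeffwise (zshift 1) F"
  by (simp add: mult_z12_def coeffwise_def)

lemma restrictable_mult_z12: "restrictable F \<Longrightarrow> restrictable (mult_z12 F)"
  by (simp add: mult_z12_alt restrictable_diff restrictable_zshift restrictable_coeffwise_zshift)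

lemma restrictable_mult_z12_pow: "restrictable F \<Longrightarrow> restrictable ((mult_z12 ^^ n) F)"
  by (induction n) (simp_all add: restrictable_mult_z12)

lemma finite_diag_support:
  assumes "restrictable F"
  shows "finite {(c1, k1, c2, k2). c1 + c2 = c \<and> k1 + k2 = k \<and> F c1 k1 c2 k2 \<noteq> 0}"
proof -
  have "finite {(c1, k1, c2, k2). c1 + c2 = c \<and> F c1 k1 c2 k2 \<noteq> 0}"
    using assms by (simp add: restrictable_def)
  then show ?thesis by (rule rev_finite_subset) auto
qed

lemma diag_eq_sum:
  assumes "finite A"
    and "{(c1, k1, c2, k2). c1 + c2 = c \<and> k1 + k2 = k \<and> F c1 k1 c2 k2 \<noteq> 0} \<subseteq> A"
    and "A \<subseteq> {(c1, k1, c2, k2). c1 + c2 = c \<and> k1 + k2 = k}"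
  shows "diag F c k = (\<Sum>(c1, k1, c2, k2)\<in>A. F c1 k1 c2 k2)"
  unfolding diag_def by (rule sum.mono_neutral_left) (use assms in auto)

lemma diag_zero [simp]: "diag 0 = 0"
  by (simp add: diag_def pointwise)

lemma diag_add:
  assumes "restrictable F" "restrictable G"
  shows "diag (F + G) = diag F + diag G"
proof -
  have eq: "diag (F + G) c k = diag F c k + diag G c k" for c k
  proof -
  let ?A = "{(c1, k1, c2, k2). c1 + c2 = c \<and> k1 + k2 = k \<and> F c1 k1 c2 k2 \<noteq> 0} \<union>
    {(c1, k1, c2, k2). c1 + c2 = c \<and> k1 + k2 = k \<and> G c1 k1 c2 k2 \<noteq> 0}"
  have fin: "finite ?A" using assms by (simp add: finite_diag_support)
  have "diag (F + G) c k = (\<Sum>(c1, k1, c2, k2)\<in>?A. (F + G) c1 k1 c2 k2)"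
    by (rule diag_eq_sum[OF fin]) (auto simp: pointwise)
  also have "\<dots> = (\<Sum>(c1, k1, c2, k2)\<in>?A. F c1 k1 c2 k2) + (\<Sum>(c1, k1, c2, k2)\<in>?A. G c1 k1 c2 k2)"
    by (simp add: sum.distrib case_prod_unfold pointwise)
  also have "(\<Sum>(c1, k1, c2, k2)\<in>?A. F c1 k1 c2 k2) = diag F c k"
    by (rule diag_eq_sum[OF fin, symmetric]) auto
  also have "(\<Sum>(c1, k1, c2, k2)\<in>?A. G c1 k1 c2 k2) = diag G c k"
    by (rule diag_eq_sum[OF fin, symmetric]) auto
  finally show ?thesis .
  qed
  show ?thesis by (intro ext, subst plus_fun_apply, subst plus_fun_apply, rule eq)
qed

lemma diag_hom:
  fixes \<phi> :: "'u::ab_group_add \<Rightarrow> 'v::ab_group_add"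
  assumes "restrictable F" and \<phi>0: "\<phi> 0 = 0" and \<phi>: "\<And>x y. \<phi> (x + y) = \<phi> x + \<phi> y"
  shows "diag (coeffwise (coeffwise \<phi>) F) = coeffwise \<phi> (diag F)"
proof (intro ext)
  fix c k
  let ?A = "{(c1, k1, c2, k2). c1 + c2 = c \<and> k1 + k2 = k \<and> F c1 k1 c2 k2 \<noteq> 0}"
  have fin: "finite ?A" using assms by (simp add: finite_diag_support)
  have "diag (coeffwise (coeffwise \<phi>) F) c k = (\<Sum>(c1, k1, c2, k2)\<in>?A. \<phi> (F c1 k1 c2 k2))"
    by (subst diag_eq_sum[OF fin]) (auto simp: coeffwise_def \<phi>0)
  also have "\<dots> = \<phi> (\<Sum>(c1, k1, c2, k2)\<in>?A. F c1 k1 c2 k2)"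
    using sum_comp_morphism[of \<phi> "\<lambda>(c1, k1, c2, k2). F c1 k1 c2 k2" ?A] \<phi>0 \<phi>
    by (simp add: comp_def case_prod_unfold)
  finally show "diag (coeffwise (coeffwise \<phi>) F) c k = coeffwise \<phi> (diag F) c k"
    by (simp add: coeffwise_def diag_def)
qed

lemma diag_diff:
  assumes "restrictable F" "restrictable G"
  shows "diag (F - G) = diag F - diag G"
  using diag_add[of "F - G" G] assms by (simp add: restrictable_diff)

lemma diag_zshift: "diag (zshift p F) = zshift p (diag F)"
proof (intro ext)
  fix c k
  show "diag (zshift p F) c k = zshift p (diag F) c k"
    unfolding diag_def zshift_def
    by (rule sum.reindex_bij_witness[where
          i = "\<lambda>(c1, k1, c2, k2). (c1 + p, k1, c2, k2)" and
          j = "\<lambda>(c1, k1, c2, k2). (c1 - p, k1, c2, k2)"]) (auto simp: algebra_simps)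
qed

lemma diag_coeffwise_zshift: "diag (coeffwise (zshift p) F) = zshift p (diag F)"
proof (intro ext)
  fix c k
  show "diag (coeffwise (zshift p) F) c k = zshift p (diag F) c k"
    unfolding diag_def zshift_def coeffwise_def
    by (rule sum.reindex_bij_witness[where
          i = "\<lambda>(c1, k1, c2, k2). (c1, k1, c2 + p, k2)" and
          j = "\<lambda>(c1, k1, c2, k2). (c1, k1, c2 - p, k2)"]) (auto simp: algebra_simps)
qed

lemma diag_mult_z12: "restrictable F \<Longrightarrow> diag (mult_z12 F) = 0"
  by (simp add: mult_z12_alt diag_diff restrictable_zshift restrictable_coeffwise_zshift
      diag_zshift diag_coeffwise_zshift)

locale complex_space = vector_space s
  for s :: "complex \<Rightarrow> 'w::ab_group_add \<Rightarrow> 'w"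
begin

abbreviation "D1 \<equiv> D_z (series_scale s)"
abbreviation "D2 \<equiv> coeffwise (D_z s)"

lemma D_z_apply:
  "D_z t f c k = t (c + 1) (f (c + 1) k) + t (of_nat (k + 1)) (f (c + 1) (k + 1))"
  by (simp add: D_z_def partial_z_def partial_zeta_def zshift_def pointwise)

lemma D1_apply:
  "D1 F c1 k1 c2 k2 = s (c1 + 1) (F (c1 + 1) k1 c2 k2)
     + s (of_nat (k1 + 1)) (F (c1 + 1) (k1 + 1) c2 k2)"
  by (simp add: D_z_apply pscale_def pointwise)

lemma D2_apply:
  "D2 F c1 k1 c2 k2 = s (c2 + 1) (F c1 k1 (c2 + 1) k2)
     + s (of_nat (k2 + 1)) (F c1 k1 (c2 + 1) (k2 + 1))"
  by (simp add: D_z_apply coeffwise_def)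

lemma D1_support:
  "D1 F c1 k1 c2 k2 \<noteq> 0 \<Longrightarrow> F (c1 + 1) k1 c2 k2 \<noteq> 0 \<or> F (c1 + 1) (k1 + 1) c2 k2 \<noteq> 0"
  unfolding D1_apply by fastforce

lemma D2_support:
  "D2 F c1 k1 c2 k2 \<noteq> 0 \<Longrightarrow> F c1 k1 (c2 + 1) k2 \<noteq> 0 \<or> F c1 k1 (c2 + 1) (k2 + 1) \<noteq> 0"
  unfolding D2_apply by fastforce

lemma restrictable_D1: "restrictable F \<Longrightarrow> restrictable (D1 F)"
  by (rule restrictable_union[OF restrictable_shift restrictable_shift,
        of F "\<lambda>c1 k1 c2 k2. F (c1 + 1) k1 c2 k2" 1 0 0 0
           F "\<lambda>c1 k1 c2 k2. F (c1 + 1) (k1 + 1) c2 k2" 1 1 0 0])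
    (use D1_support in auto)

lemma restrictable_D2: "restrictable F \<Longrightarrow> restrictable (D2 F)"
  by (rule restrictable_union[OF restrictable_shift restrictable_shift,
        of F "\<lambda>c1 k1 c2 k2. F c1 k1 (c2 + 1) k2" 0 0 1 0
           F "\<lambda>c1 k1 c2 k2. F c1 k1 (c2 + 1) (k2 + 1)" 0 0 1 1])
    (use D2_support in auto)

lemma restrictable_scale: "restrictable F \<Longrightarrow> restrictable (series_scale (series_scale s) t F)"
  by (erule restrictable_support) (auto simp: pscale_def)

lemma restrictable_D1_pow: "restrictable F \<Longrightarrow> restrictable ((D1 ^^ n) F)"
  by (induction n) (simp_all add: restrictable_D1)

lemma diag_scale:
  assumes "restrictable F"
  shows "diag (series_scale (series_scale s) t F) = series_scale s t (diag F)"
  using diag_hom[OF assms, of "s t"] by (simp add: scale_right_distrib coeffwise_def pscale_def)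

text \<open>
  On the diagonal the Euler operators of the two variables add up: the exponents of \<open>z\<^sub>1, z\<^sub>2\<close> in
  the terms that contribute to \<open>z\<^sup>c\<close> add up to \<open>c\<close>, and those of \<open>\<zeta>\<^sub>1, \<zeta>\<^sub>2\<close> add up in the same
  way. This settles \<open>z\<partial>\<^sub>z\<close> and \<open>\<zeta>\<partial>\<^sub>\<zeta>\<close>, and \<open>D\<^sub>z\<close> differs from their sum only by shifts of exponents.
\<close>

lemma diag_D:
  assumes F: "restrictable F"
  shows "D_z s (diag F) = diag (D1 F + D2 F)"
proof -
  \<comment> \<open>\<open>P\<close>, \<open>Q\<close> are \<open>z\<^sub>i\<partial>F/\<partial>z\<^sub>i\<close>; \<open>P'\<close>, \<open>Q'\<close> are \<open>\<zeta>\<^sub>i\<partial>F/\<partial>\<zeta>\<^sub>i\<close>; dividing the latter by \<open>\<zeta>\<^sub>i\<close> gives \<open>P''\<close>, \<open>Q''\<close>.\<close>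
  define P where "P = (\<lambda>c1 (k1::nat) c2 (k2::nat). s c1 (F c1 k1 c2 k2))"
  define Q where "Q = (\<lambda>c1 (k1::nat) c2 (k2::nat). s c2 (F c1 k1 c2 k2))"
  define P' where "P' = (\<lambda>c1 k1 c2 (k2::nat). s (of_nat k1) (F c1 k1 c2 k2))"
  define Q' where "Q' = (\<lambda>c1 (k1::nat) c2 k2. s (of_nat k2) (F c1 k1 c2 k2))"
  define P'' where "P'' = (\<lambda>c1 k1 c2 (k2::nat). P' c1 (k1 + 1) c2 k2)"
  define Q'' where "Q'' = (\<lambda>c1 (k1::nat) c2 k2. Q' c1 k1 c2 (k2 + 1))"
  have r: "restrictable P" "restrictable Q" "restrictable P'" "restrictable Q'"
    by (auto intro!: restrictable_support[OF F] simp: P_def Q_def P'_def Q'_def)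
  have r'': "restrictable P''"
    by (rule restrictable_shift[OF r(3), of _ 0 1 0 0]) (simp add: P''_def)
  have r''': "restrictable Q''"
    by (rule restrictable_shift[OF r(4), of _ 0 0 0 1]) (simp add: Q''_def)
  have D: "D1 F = zshift (-1) (P + P'')" "D2 F = coeffwise (zshift (-1)) (Q + Q'')"
    by (simp_all add: pointwise D1_apply D2_apply[unfolded coeffwise_def] zshift_def P_def P''_def
        P'_def Q_def Q'_def Q''_def coeffwise_def)
  have PQ: "diag P c k + diag Q c k = s c (diag F c k)" for c k
  proof -
    have "diag P c k + diag Q c k = diag (P + Q) c k" by (simp add: diag_add r pointwise)
    also have "\<dots> = (\<Sum>(c1, k1, c2, k2)\<in>{(c1, k1, c2, k2). c1 + c2 = c \<and> k1 + k2 = k \<and> F c1 k1 c2 k2 \<noteq> 0}.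
        (P + Q) c1 k1 c2 k2)"
      by (rule diag_eq_sum[OF finite_diag_support[OF F]]) (auto simp: P_def Q_def pointwise)
    also have "\<dots> = (\<Sum>(c1, k1, c2, k2)\<in>{(c1, k1, c2, k2). c1 + c2 = c \<and> k1 + k2 = k \<and> F c1 k1 c2 k2 \<noteq> 0}.
        s c (F c1 k1 c2 k2))"
      by (rule sum.cong) (auto simp: P_def Q_def pointwise scale_left_distrib)
    also have "\<dots> = s c (diag F c k)"
      by (simp add: diag_def scale_sum_right case_prod_unfold)
    finally show ?thesis .
  qed
  have P'Q': "diag P' c k + diag Q' c k = s (of_nat k) (diag F c k)" for c k
  proof -
    have "diag P' c k + diag Q' c k = diag (P' + Q') c k" by (simp add: diag_add r pointwise)
    also have "\<dots> = (\<Sum>(c1, k1, c2, k2)\<in>{(c1, k1, c2, k2). c1 + c2 = c \<and> k1 + k2 = k \<and> F c1 k1 c2 k2 \<noteq> 0}.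
        (P' + Q') c1 k1 c2 k2)"
      by (rule diag_eq_sum[OF finite_diag_support[OF F]]) (auto simp: P'_def Q'_def pointwise)
    also have "\<dots> = (\<Sum>(c1, k1, c2, k2)\<in>{(c1, k1, c2, k2). c1 + c2 = c \<and> k1 + k2 = k \<and> F c1 k1 c2 k2 \<noteq> 0}.
        s (of_nat k) (F c1 k1 c2 k2))"
      by (rule sum.cong) (auto simp: P'_def Q'_def pointwise scale_left_distrib)
    also have "\<dots> = s (of_nat k) (diag F c k)"
      by (simp add: diag_def scale_sum_right case_prod_unfold)
    finally show ?thesis .
  qed
  have P'': "diag P'' c k = diag P' c (k + 1)" for c k
    unfolding diag_def P''_def
    by (rule sum.reindex_bij_witness[where
          i = "\<lambda>(c1, k1, c2, k2). (c1, k1 - 1, c2, k2)" and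
          j = "\<lambda>(c1, k1, c2, k2). (c1, k1 + 1, c2, k2)"])
      (auto simp: P'_def not_less_eq_eq gr0_conv_Suc simp del: of_nat_Suc split: nat_diff_split)
  have Q'': "diag Q'' c k = diag Q' c (k + 1)" for c k
    unfolding diag_def Q''_def
    by (rule sum.reindex_bij_witness[where
          i = "\<lambda>(c1, k1, c2, k2). (c1, k1, c2, k2 - 1)" and
          j = "\<lambda>(c1, k1, c2, k2). (c1, k1, c2, k2 + 1)"])
      (auto simp: Q'_def not_less_eq_eq gr0_conv_Suc simp del: of_nat_Suc split: nat_diff_split)
  have "diag (D1 F + D2 F) = zshift (-1) (diag P + diag P'') + zshift (-1) (diag Q + diag Q'')"
    unfolding D
    by (simp add: diag_add diag_zshift diag_coeffwise_zshift restrictable_add restrictable_zshift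
        restrictable_coeffwise_zshift r r'' r''')
  also have "\<dots> = D_z s (diag F)"
    by (simp add: pointwise D_z_apply zshift_def P'' Q'' flip: PQ P'Q' of_nat_Suc del: of_nat_Suc)
  finally show ?thesis ..
qed

lemma D1_add: "D1 (F + G) = D1 F + D1 G"
  by (simp add: pointwise D1_apply scale_right_distrib)

lemma D1_scale: "D1 (series_scale (series_scale s) t F) = series_scale (series_scale s) t (D1 F)"
  by (simp add: pointwise D1_apply pscale_def scale_right_distrib mult.commute)

lemma D1_mult_z12: "D1 (mult_z12 F) = mult_z12 (D1 F) + F"
  by (simp add: pointwise D1_apply mult_z12_apply scale_right_diff_distrib scale_left_distrib)

lemma D2_mult_z12: "D2 (mult_z12 F) = mult_z12 (D2 F) - F"
  by (simp add: pointwise D2_apply mult_z12_apply scale_right_diff_distrib scale_left_distrib)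

lemma D1_D2: "D1 (D2 F) = D2 (D1 F)"
  by (simp add: pointwise D1_apply D2_apply scale_right_distrib mult.commute)


section \<open>Expansion along the diagonal\<close>

abbreviation "D1_divpow \<equiv> divpow (series_scale (series_scale s)) D1"

definition finite_pole :: "'w lseries2 \<Rightarrow> bool" where
  "finite_pole F \<longleftrightarrow> (\<exists>N. restrictable ((mult_z12 ^^ N) F))"

text \<open>
  The formula that defines the products, with the exponent \<open>N\<close> still visible.
\<close>

definition pole_coeff_at :: "nat \<Rightarrow> int \<Rightarrow> 'w lseries2 \<Rightarrow> 'w lseries" where
  "pole_coeff_at N n F =
     (if n \<le> int N - 1 then diag (D1_divpow (nat (int N - 1 - n)) ((mult_z12 ^^ N) F)) else 0)"

text \<open>
  The coefficient of \<open>z\<^sub>1\<^sub>2\<^sup>-\<^sup>n\<^sup>-\<^sup>1\<close> in the expansion of \<open>F\<close> in powers of \<open>z\<^sub>1\<^sub>2\<close> along the diagonal.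
\<close>

definition pole_coeff :: "int \<Rightarrow> 'w lseries2 \<Rightarrow> 'w lseries" where
  "pole_coeff n F = pole_coeff_at (SOME N. restrictable ((mult_z12 ^^ N) F)) n F"

lemma D1_divpow_apply: "D1_divpow k F = series_scale (series_scale s) (1 / fact k) ((D1 ^^ k) F)"
  by (simp add: divpow_def)

lemma restrictable_D1_divpow: "restrictable F \<Longrightarrow> restrictable (D1_divpow k F)"
  by (simp add: D1_divpow_apply restrictable_scale restrictable_D1_pow)

lemma D1_pow_add: "(D1 ^^ k) (F + G) = (D1 ^^ k) F + (D1 ^^ k) G"
  by (induction k) (simp_all add: D1_add)

lemma D1_pow_scale:
  "(D1 ^^ k) (series_scale (series_scale s) t F) = series_scale (series_scale s) t ((D1 ^^ k) F)"
  by (induction k) (simp_all add: D1_scale)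

lemma D1_divpow_add: "D1_divpow k (F + G) = D1_divpow k F + D1_divpow k G"
  by (simp add: D1_divpow_apply D1_pow_add pscale_def scale_right_distrib pointwise)

lemma D1_divpow_scale:
  "D1_divpow k (series_scale (series_scale s) t F) = series_scale (series_scale s) t (D1_divpow k F)"
  by (simp add: D1_divpow_apply D1_pow_scale) (simp add: pscale_def mult.commute)

lemma D1_pow_mult_z12:
  "(D1 ^^ Suc k) (mult_z12 F)
    = mult_z12 ((D1 ^^ Suc k) F) + series_scale (series_scale s) (of_nat (Suc k)) ((D1 ^^ k) F)"
proof (induction k)
  case 0
  show ?case by (simp add: D1_mult_z12) (simp add: pointwise pscale_def)
next
  case (Suc k)
  have "(D1 ^^ Suc (Suc k)) (mult_z12 F) = D1 ((D1 ^^ Suc k) (mult_z12 F))" by simp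
  also have "\<dots> = mult_z12 ((D1 ^^ Suc (Suc k)) F)
      + ((D1 ^^ Suc k) F + series_scale (series_scale s) (of_nat (Suc k)) ((D1 ^^ Suc k) F))"
    unfolding Suc.IH by (simp add: D1_add D1_mult_z12 D1_scale add.assoc)
  also have "(D1 ^^ Suc k) F + series_scale (series_scale s) (of_nat (Suc k)) ((D1 ^^ Suc k) F)
      = series_scale (series_scale s) (of_nat (Suc (Suc k))) ((D1 ^^ Suc k) F)"
    by (simp add: pointwise pscale_def scale_left_distrib of_nat_Suc[of "Suc k"]
        del: of_nat_Suc)
  finally show ?case .
qed

lemma mult_z12_scale:
  "mult_z12 (series_scale (series_scale s) t F) = series_scale (series_scale s) t (mult_z12 F)"
  by (simp add: pointwise mult_z12_apply pscale_def scale_right_diff_distrib)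

lemma mult_z12_pow_scale: "(mult_z12 ^^ n) (series_scale (series_scale s) t F)
    = series_scale (series_scale s) t ((mult_z12 ^^ n) F)"
  by (induction n) (simp_all add: mult_z12_scale)

text \<open>
  The Leibniz rule for the factor \<open>z\<^sub>1\<^sub>2\<close>, of which all higher derivatives vanish.
\<close>

lemma D1_divpow_mult_z12:
  "D1_divpow (Suc k) (mult_z12 F) = mult_z12 (D1_divpow (Suc k) F) + D1_divpow k F"
proof -
  have eq: "1 / fact (Suc k) * of_nat (Suc k) = (1 / fact k :: complex)"
    by (simp add: divide_simps del: of_nat_Suc)
  have "D1_divpow (Suc k) (mult_z12 F) = mult_z12 (D1_divpow (Suc k) F)
      + series_scale (series_scale s) (1 / fact (Suc k) * of_nat (Suc k)) ((D1 ^^ k) F)"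
    unfolding D1_divpow_apply D1_pow_mult_z12 mult_z12_scale
    by (simp add: pointwise pscale_def scale_right_distrib)
  then show ?thesis unfolding eq by (simp add: D1_divpow_apply)
qed

text \<open>
  Restricting the Leibniz rule to the diagonal kills the term with the factor \<open>z\<^sub>1\<^sub>2\<close>. For
  \<open>n = N\<close> the larger exponent gives the restriction of \<open>z\<^sub>1\<^sub>2\<^sup>N\<^sup>+\<^sup>1 F\<close>, which vanishes as well.
\<close>

lemma pole_coeff_at_Suc:
  assumes "restrictable ((mult_z12 ^^ N) F)"
  shows "pole_coeff_at (Suc N) n F = pole_coeff_at N n F"
proof -
  let ?G = "(mult_z12 ^^ N) F"
  consider "n \<le> int N - 1" | "n = int N" | "n > int N" by linarith
  then show ?thesis
  proof cases
    case 1
    then have "nat (int (Suc N) - 1 - n) = Suc (nat (int N - 1 - n))" by simp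
    then have "pole_coeff_at (Suc N) n F = diag (D1_divpow (Suc (nat (int N - 1 - n))) (mult_z12 ?G))"
      using 1 by (simp add: pole_coeff_at_def)
    also have "\<dots> = pole_coeff_at N n F"
      unfolding D1_divpow_mult_z12 using 1 assms
      by (simp add: diag_add diag_mult_z12 restrictable_mult_z12 restrictable_D1_divpow
          pole_coeff_at_def)
    finally show ?thesis .
  next
    case 2
    have "D1_divpow 0 (mult_z12 ?G) = mult_z12 ?G" by (simp add: D1_divpow_apply pscale_def)
    then show ?thesis using 2 assms by (simp add: pole_coeff_at_def diag_mult_z12)
  next
    case 3
    then show ?thesis by (simp add: pole_coeff_at_def)
  qed
qed

lemma restrictable_mult_z12_pow_mono:
  assumes "restrictable ((mult_z12 ^^ N) F)" "N \<le> M"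
  shows "restrictable ((mult_z12 ^^ M) F)"
proof -
  have "restrictable ((mult_z12 ^^ (M - N)) ((mult_z12 ^^ N) F))"
    using assms(1) by (rule restrictable_mult_z12_pow)
  then show ?thesis using assms(2) by (simp flip: funpow_add[THEN fun_cong, unfolded comp_def])
qed

lemma pole_coeff_at_mono:
  assumes "N \<le> M" "restrictable ((mult_z12 ^^ N) F)"
  shows "pole_coeff_at M n F = pole_coeff_at N n F"
  using assms(1)
proof (induction M rule: dec_induct)
  case (step M)
  then show ?case
    using pole_coeff_at_Suc[OF restrictable_mult_z12_pow_mono[OF assms(2)]] by simp
qed simp

lemma pole_coeff_eq:
  assumes "restrictable ((mult_z12 ^^ N) F)"
  shows "pole_coeff n F = pole_coeff_at N n F"
proof -
  let ?M = "SOME N. restrictable ((mult_z12 ^^ N) F)"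
  have "restrictable ((mult_z12 ^^ ?M) F)" using assms by (rule someI)
  then show ?thesis
    using pole_coeff_at_mono[of N ?M F n] pole_coeff_at_mono[of ?M N F n] assms
    by (cases "N \<le> ?M") (simp_all add: pole_coeff_def)
qed

lemma finite_poleI: "restrictable ((mult_z12 ^^ N) F) \<Longrightarrow> finite_pole F"
  by (auto simp: finite_pole_def)

lemma finite_pole_common:
  assumes "finite_pole F" "finite_pole G"
  obtains N where "restrictable ((mult_z12 ^^ N) F)" "restrictable ((mult_z12 ^^ N) G)"
proof -
  obtain N M where *: "restrictable ((mult_z12 ^^ N) F)" "restrictable ((mult_z12 ^^ M) G)"
    using assms by (auto simp: finite_pole_def)
  show ?thesis
    by (rule that[of "max N M"]; rule restrictable_mult_z12_pow_mono[OF *(1)]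
        restrictable_mult_z12_pow_mono[OF *(2)]) auto
qed

lemma pole_coeff_add:
  assumes "finite_pole F" "finite_pole G"
  shows "finite_pole (F + G)" "pole_coeff n (F + G) = pole_coeff n F + pole_coeff n G"
proof -
  obtain N where N: "restrictable ((mult_z12 ^^ N) F)" "restrictable ((mult_z12 ^^ N) G)"
    using assms by (rule finite_pole_common)
  then have N': "restrictable ((mult_z12 ^^ N) (F + G))"
    by (simp add: mult_z12_pow_add restrictable_add)
  then show "finite_pole (F + G)" by (rule finite_poleI)
  show "pole_coeff n (F + G) = pole_coeff n F + pole_coeff n G"
    using N by (simp add: pole_coeff_eq[OF N'] pole_coeff_eq[OF N(1)] pole_coeff_eq[OF N(2)]
        pole_coeff_at_def mult_z12_pow_add D1_divpow_add diag_add restrictable_D1_divpow)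
qed

lemma pole_coeff_zero [simp]: "pole_coeff n 0 = 0"
proof -
  have "D1_divpow k 0 = 0" for k
    using D1_divpow_add[of k 0 0] by simp
  then show ?thesis
    by (simp add: pole_coeff_def pole_coeff_at_def)
qed

text \<open>
  \<open>P\<close> is compatible with the expansion along the diagonal and induces \<open>Q\<close> on its coefficients.
\<close>

definition descends ::
    "('w lseries2 \<Rightarrow> 'w lseries2) \<Rightarrow> ('w lseries \<Rightarrow> 'w lseries) \<Rightarrow> bool" where
  "descends P Q \<longleftrightarrow>
     (\<forall>G. P (mult_z12 G) = mult_z12 (P G)) \<and>
     (\<forall>G. P (D1 G) = D1 (P G)) \<and>
     (\<forall>t G. P (series_scale (series_scale s) t G) = series_scale (series_scale s) t (P G)) \<and>
     (\<forall>G. restrictable G \<longrightarrow> restrictable (P G) \<and> diag (P G) = Q (diag G)) \<and> Q 0 = 0"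

lemma pole_coeff_descends:
  assumes "descends P Q" and F: "finite_pole F"
  shows "finite_pole (P F)" "pole_coeff n (P F) = Q (pole_coeff n F)"
proof -
  have m: "\<And>G. P (mult_z12 G) = mult_z12 (P G)"
    and d: "\<And>G. P (D1 G) = D1 (P G)"
    and sc: "\<And>t G. P (series_scale (series_scale s) t G) = series_scale (series_scale s) t (P G)"
    and r: "\<And>G. restrictable G \<Longrightarrow> restrictable (P G)"
    and diag: "\<And>G. restrictable G \<Longrightarrow> diag (P G) = Q (diag G)"
    and 0: "Q 0 = 0"
    using assms(1) unfolding descends_def by blast+
  obtain N where N: "restrictable ((mult_z12 ^^ N) F)" using F by (auto simp: finite_pole_def)
  have m': "(mult_z12 ^^ N) (P F) = P ((mult_z12 ^^ N) F)" by (rule funpow_commute[where g = P]) (simp add: m)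
  have N': "restrictable ((mult_z12 ^^ N) (P F))" using r[OF N] by (simp add: m')
  then show "finite_pole (P F)" by (rule finite_poleI)
  have "(D1 ^^ k) (P G) = P ((D1 ^^ k) G)" for k G
    by (rule funpow_commute[where g = P]) (simp add: d)
  then have "D1_divpow k (P G) = P (D1_divpow k G)" for k G
    by (simp add: D1_divpow_apply sc)
  then show "pole_coeff n (P F) = Q (pole_coeff n F)"
    using N by (simp add: pole_coeff_eq[OF N'] pole_coeff_eq[OF N] pole_coeff_at_def m' 0 diag
        restrictable_D1_divpow)
qed

lemma descends_scale: "descends (series_scale (series_scale s) t) (series_scale s t)"
  unfolding descends_def
proof (intro conjI allI impI)
  show "series_scale (series_scale s) t (series_scale (series_scale s) u G)
      = series_scale (series_scale s) u (series_scale (series_scale s) t G)" for u G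
    by (simp add: pscale_def mult.commute)
  show "series_scale s t 0 = 0" by (simp add: pointwise pscale_def)
qed (simp_all add: mult_z12_scale D1_scale restrictable_scale diag_scale)

lemma descends_coeffwise_zshift: "descends (coeffwise (zshift p)) (zshift p)"
  unfolding descends_def
proof (intro conjI allI impI)
  fix G :: "'w lseries2"
  show "coeffwise (zshift p) (mult_z12 G) = mult_z12 (coeffwise (zshift p) G)"
    by (simp add: pointwise mult_z12_apply coeffwise_def zshift_def algebra_simps)
  show "coeffwise (zshift p) (D1 G) = D1 (coeffwise (zshift p) G)"
    by (simp add: pointwise D1_apply coeffwise_def zshift_def)
  show "zshift p 0 = 0" by (simp add: pointwise zshift_def)
qed (simp_all add: restrictable_coeffwise_zshift diag_coeffwise_zshift, simp add: coeffwise_def zshift_def pscale_def)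

lemma D_z_zero: "D_z s 0 = 0"
  by (simp add: pointwise D_z_apply)

lemma descends_D_z: "descends (\<lambda>G. D1 G + D2 G) (D_z s)"
  unfolding descends_def
proof (intro conjI allI impI)
  fix G
  show "D1 (mult_z12 G) + D2 (mult_z12 G) = mult_z12 (D1 G + D2 G)"
    by (simp add: D1_mult_z12 D2_mult_z12 mult_z12_add)
  show "D1 (D1 G) + D2 (D1 G) = D1 (D1 G + D2 G)"
    by (simp add: D1_add D1_D2)
  show "D1 (series_scale (series_scale s) t G) + D2 (series_scale (series_scale s) t G)
      = series_scale (series_scale s) t (D1 G + D2 G)" for t
    by (simp add: pointwise D1_apply D2_apply pscale_def scale_right_distrib mult.commute)
qed (simp_all add: restrictable_add restrictable_D1 restrictable_D2 diag_D D_z_zero)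

lemma descends_linear:
  assumes \<phi>: "Vector_Spaces.linear s s \<phi>"
  shows "descends (coeffwise (coeffwise \<phi>)) (coeffwise \<phi>)"
proof -
  interpret \<phi>: Vector_Spaces.linear s s \<phi> by fact
  show ?thesis
    unfolding descends_def
  proof (intro conjI allI impI)
    fix G
    show "coeffwise (coeffwise \<phi>) (mult_z12 G) = mult_z12 (coeffwise (coeffwise \<phi>) G)"
      by (simp add: pointwise mult_z12_apply coeffwise_def \<phi>.diff)
    show "coeffwise (coeffwise \<phi>) (D1 G) = D1 (coeffwise (coeffwise \<phi>) G)"
      by (simp add: pointwise D1_apply coeffwise_def \<phi>.add \<phi>.scale)
    show "coeffwise (coeffwise \<phi>) (series_scale (series_scale s) t G)
        = series_scale (series_scale s) t (coeffwise (coeffwise \<phi>) G)" for t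
      by (simp add: coeffwise_def pscale_def \<phi>.scale)
    show "coeffwise \<phi> 0 = 0" by (simp add: pointwise coeffwise_def \<phi>.zero)
    assume G: "restrictable G"
    show "restrictable (coeffwise (coeffwise \<phi>) G)"
      by (rule restrictable_support[OF G]) (auto simp: coeffwise_def \<phi>.zero)
    show "diag (coeffwise (coeffwise \<phi>) G) = coeffwise \<phi> (diag G)"
      by (rule diag_hom[OF G]) (simp_all add: \<phi>.zero \<phi>.add)
  qed
qed

lemma pole_coeff_minus:
  assumes "finite_pole F"
  shows "finite_pole (- F)" "pole_coeff n (- F) = - pole_coeff n F"
proof -
  have "- F = series_scale (series_scale s) (-1) F" by (simp add: pointwise pscale_def)
  moreover have "- pole_coeff n F = series_scale s (-1) (pole_coeff n F)"
    by (simp add: pointwise pscale_def)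
  ultimately show "finite_pole (- F)" "pole_coeff n (- F) = - pole_coeff n F"
    using pole_coeff_descends[OF descends_scale[of "-1"] assms] by simp_all
qed

lemma pole_coeff_diff:
  assumes "finite_pole F" "finite_pole G"
  shows "finite_pole (F - G)" "pole_coeff n (F - G) = pole_coeff n F - pole_coeff n G"
  using pole_coeff_add[OF assms(1) pole_coeff_minus(1)[OF assms(2)]]
    pole_coeff_minus(2)[OF assms(2)] by simp_all

text \<open>
  Multiplication by \<open>z\<^sub>1\<^sub>2\<close> shifts the expansion: \<open>N\<close> for \<open>z\<^sub>1\<^sub>2 F\<close> plays the part of \<open>N + 1\<close> for \<open>F\<close>.
\<close>

lemma pole_coeff_mult_z12:
  assumes "finite_pole F"
  shows "finite_pole (mult_z12 F)" "pole_coeff n (mult_z12 F) = pole_coeff (n + 1) F"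
proof -
  obtain N where N: "restrictable ((mult_z12 ^^ N) F)" using assms by (auto simp: finite_pole_def)
  then have N1: "restrictable ((mult_z12 ^^ Suc N) F)"
    by (rule restrictable_mult_z12_pow_mono) simp
  have eq: "(mult_z12 ^^ N) (mult_z12 F) = (mult_z12 ^^ Suc N) F" by (simp add: funpow_swap1)
  then have N2: "restrictable ((mult_z12 ^^ N) (mult_z12 F))" using N1 by simp
  then show "finite_pole (mult_z12 F)" by (rule finite_poleI)
  have "nat (int N - 1 - n) = nat (int (Suc N) - 1 - (n + 1))" by simp
  then show "pole_coeff n (mult_z12 F) = pole_coeff (n + 1) F"
    unfolding pole_coeff_eq[OF N2] pole_coeff_eq[OF N1] pole_coeff_at_def eq
    by (simp add: algebra_simps)
qed

text \<open>
  Differentiating \<open>z\<^sub>1\<^sub>2\<^sup>-\<^sup>n\<close> gives \<open>-n z\<^sub>1\<^sub>2\<^sup>-\<^sup>n\<^sup>-\<^sup>1\<close>. The factor arises as \<open>(k + 1) - (N + 1)\<close> with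
  \<open>k = N - n\<close>: the first term comes from \<open>D\<^sub>1 D\<^sub>1\<^sup>k / k! = (k + 1) D\<^sub>1\<^sup>k\<^sup>+\<^sup>1 / (k + 1)!\<close>, the second from moving \<open>D\<^sub>1\<close> past
  \<open>z\<^sub>1\<^sub>2\<^sup>N\<^sup>+\<^sup>1\<close>.
\<close>

lemma pole_coeff_D1:
  assumes "finite_pole F"
  shows "finite_pole (D1 F)" "pole_coeff n (D1 F) = series_scale s (- of_int n) (pole_coeff (n - 1) F)"
proof -
  obtain N where N: "restrictable ((mult_z12 ^^ N) F)" using assms by (auto simp: finite_pole_def)
  then have N1: "restrictable ((mult_z12 ^^ Suc N) F)"
    by (rule restrictable_mult_z12_pow_mono) simp
  have eq: "(mult_z12 ^^ Suc N) (D1 F) = D1 ((mult_z12 ^^ Suc N) F)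
      + series_scale (series_scale s) (- of_nat (Suc N)) ((mult_z12 ^^ N) F)" for N
  proof (induction N)
    case 0
    show ?case by (simp add: D1_mult_z12) (simp add: pointwise pscale_def)
  next
    case (Suc N)
    have "(mult_z12 ^^ Suc (Suc N)) (D1 F) = mult_z12 ((mult_z12 ^^ Suc N) (D1 F))" by simp
    also have "\<dots> = D1 ((mult_z12 ^^ Suc (Suc N)) F) - (mult_z12 ^^ Suc N) F
        + series_scale (series_scale s) (- of_nat (Suc N)) ((mult_z12 ^^ Suc N) F)"
      unfolding Suc.IH by (simp add: mult_z12_add mult_z12_scale D1_mult_z12)
    also have "\<dots> = D1 ((mult_z12 ^^ Suc (Suc N)) F)
        + series_scale (series_scale s) (- of_nat (Suc (Suc N))) ((mult_z12 ^^ Suc N) F)"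
      by (simp add: pointwise pscale_def scale_left_diff_distrib of_nat_Suc[of "Suc N"]
          del: of_nat_Suc funpow.simps)
    finally show ?case .
  qed
  have N2: "restrictable ((mult_z12 ^^ Suc N) (D1 F))"
    unfolding eq by (intro restrictable_add restrictable_D1 restrictable_scale N N1)
  then show "finite_pole (D1 F)" by (rule finite_poleI)
  show "pole_coeff n (D1 F) = series_scale s (- of_int n) (pole_coeff (n - 1) F)"
  proof (cases "n \<le> int N")
    case True
    define k where "k = nat (int N - n)"
    have k: "nat (int (Suc N) - 1 - n) = k" "nat (int (Suc N) - 1 - (n - 1)) = Suc k"
      "nat (int N - 1 - (n - 1)) = k" and n: "of_int n = of_nat N - (of_nat k :: complex)"
      using True by (simp_all add: k_def)
    let ?R = "pole_coeff (n - 1) F"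
    have R1: "?R = diag (D1_divpow (Suc k) ((mult_z12 ^^ Suc N) F))"
      unfolding pole_coeff_eq[OF N1] pole_coeff_at_def k using True by simp
    have R2: "?R = diag (D1_divpow k ((mult_z12 ^^ N) F))"
      unfolding pole_coeff_eq[OF N] pole_coeff_at_def k using True by simp
    have D: "D1_divpow k (D1 G) = series_scale (series_scale s) (of_nat (Suc k)) (D1_divpow (Suc k) G)"
      for G
    proof -
      have "of_nat (Suc k) * (1 / fact (Suc k)) = (1 / fact k :: complex)"
        by (simp add: divide_simps del: of_nat_Suc)
      then show ?thesis
        unfolding D1_divpow_apply by (simp add: pscale_def funpow_swap1 del: of_nat_Suc fact_Suc)
    qed
    have "pole_coeff n (D1 F) = diag (D1_divpow k ((mult_z12 ^^ Suc N) (D1 F)))"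
      unfolding pole_coeff_eq[OF N2] pole_coeff_at_def k using True by simp
    also have "\<dots> = series_scale s (of_nat (Suc k)) ?R + series_scale s (- of_nat (Suc N)) ?R"
      unfolding eq D1_divpow_add D1_divpow_scale D
      by (subst (2) R2, subst R1)
        (simp add: diag_add diag_scale restrictable_scale restrictable_D1_divpow N N1 del: of_nat_Suc
          funpow.simps)
    also have "\<dots> = series_scale s (- of_int n) ?R"
      by (simp add: n pointwise pscale_def flip: scale_left_distrib)
    finally show ?thesis .
  next
    case False
    then show ?thesis
      unfolding pole_coeff_eq[OF N2] pole_coeff_eq[OF N] pole_coeff_at_def
      by (simp add: pointwise pscale_def)
  qed
qed

end

section \<open>Logarithmic fields\<close>

text \<open>
  The exponents allowed in a sum of finitely many power series with leading exponents in \<open>A\<close>.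
\<close>

definition cone :: "complex set \<Rightarrow> complex set" where
  "cone A = {\<alpha> + of_nat i | \<alpha> i. \<alpha> \<in> A}"

lemma cone_shift: "c - of_nat i \<in> cone A \<Longrightarrow> c \<in> cone A"
proof -
  assume "c - of_nat i \<in> cone A"
  then obtain \<alpha> j where "\<alpha> \<in> A" "c - of_nat i = \<alpha> + of_nat j" by (auto simp: cone_def)
  then have "\<alpha> \<in> A" "c = \<alpha> + of_nat (j + i)" by (simp_all add: algebra_simps)
  then show ?thesis unfolding cone_def by blast
qed

lemma cone_translate: "c + d \<in> cone A \<Longrightarrow> c \<in> cone ((\<lambda>\<alpha>. \<alpha> - d) ` A)"
proof -
  assume "c + d \<in> cone A"
  then obtain \<alpha> j where "\<alpha> \<in> A" "c + d = \<alpha> + of_nat j" by (auto simp: cone_def)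
  then have "\<alpha> \<in> A" "c = (\<alpha> - d) + of_nat j" by (simp_all add: algebra_simps)
  then show ?thesis unfolding cone_def by blast
qed

lemma cone_mono: "A \<subseteq> B \<Longrightarrow> cone A \<subseteq> cone B"
  by (auto simp: cone_def)

lemma cone_sum:
  "c1 \<in> cone A \<Longrightarrow> c2 \<in> cone B \<Longrightarrow> c1 + c2 \<in> cone ((\<lambda>(\<alpha>, \<beta>). \<alpha> + \<beta>) ` (A \<times> B))"
proof -
  assume "c1 \<in> cone A" "c2 \<in> cone B"
  then obtain \<alpha> \<beta> i j where "\<alpha> \<in> A" "\<beta> \<in> B" "c1 = \<alpha> + of_nat i" "c2 = \<beta> + of_nat j"
    by (auto simp: cone_def)
  then have "(\<alpha>, \<beta>) \<in> A \<times> B" "c1 + c2 = (\<lambda>(\<alpha>, \<beta>). \<alpha> + \<beta>) (\<alpha>, \<beta>) + of_nat (i + j)"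
    by (simp_all add: algebra_simps)
  then show ?thesis unfolding cone_def by blast
qed

lemma finite_cone_sum:
  assumes "finite A" "finite B"
  shows "finite {(c1, c2). c1 \<in> cone A \<and> c2 \<in> cone B \<and> c1 + c2 = c}"
proof -
  have fin: "finite {(i, j). \<alpha> + of_nat i + (\<beta> + of_nat j) = c}" for \<alpha> \<beta>
  proof (cases "\<exists>i j. \<alpha> + of_nat i + (\<beta> + of_nat j) = c")
    case True
    then obtain i0 j0 :: nat where 0: "\<alpha> + of_nat i0 + (\<beta> + of_nat j0) = c" by blast
    have "i + j = i0 + j0" if "\<alpha> + of_nat i + (\<beta> + of_nat j) = c" for i j :: nat
    proof -
      have "of_nat (i + j) = c - \<alpha> - \<beta>" "of_nat (i0 + j0) = c - \<alpha> - \<beta>"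
        using that 0 by (simp_all add: algebra_simps)
      then have "(of_nat (i + j) :: complex) = of_nat (i0 + j0)" by simp
      then show ?thesis by (simp only: of_nat_eq_iff)
    qed
    then have "{(i, j). \<alpha> + of_nat i + (\<beta> + of_nat j) = c} \<subseteq> {..i0 + j0} \<times> {..i0 + j0}"
      by force
    then show ?thesis by (rule finite_subset) simp
  next
    case False
    then have "{(i, j). \<alpha> + of_nat i + (\<beta> + of_nat j) = c} = {}" by auto
    then show ?thesis by simp
  qed
  have "{(c1, c2). c1 \<in> cone A \<and> c2 \<in> cone B \<and> c1 + c2 = c}
      \<subseteq> (\<Union>(\<alpha>, \<beta>)\<in>A \<times> B. (\<lambda>(i, j). (\<alpha> + of_nat i, \<beta> + of_nat j)) `
           {(i, j). \<alpha> + of_nat i + (\<beta> + of_nat j) = c})"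
    unfolding cone_def by (auto simp: image_iff)
  moreover have "finite \<dots>"
    using assms fin by (intro finite_UN_I) auto
  ultimately show ?thesis by (rule finite_subset)
qed

lemma finite_cone_sum3:
  assumes "finite A" "finite B" "finite C"
  shows "finite {(c1, c2, c3). c1 \<in> cone A \<and> c2 \<in> cone B \<and> c3 \<in> cone C \<and> c1 + c2 + c3 = c}"
proof -
  let ?AB = "(\<lambda>(\<alpha>, \<beta>). \<alpha> + \<beta>) ` (A \<times> B)"
  have "{(c1, c2, c3). c1 \<in> cone A \<and> c2 \<in> cone B \<and> c3 \<in> cone C \<and> c1 + c2 + c3 = c}
      \<subseteq> (\<Union>(c', c3)\<in>{(c', c3). c' \<in> cone ?AB \<and> c3 \<in> cone C \<and> c' + c3 = c}.
           (\<lambda>(c1, c2). (c1, c2, c3)) ` {(c1, c2). c1 \<in> cone A \<and> c2 \<in> cone B \<and> c1 + c2 = c'})"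
    using cone_sum[of _ A _ B] by (auto simp: image_iff)
  moreover have "finite \<dots>"
    using assms by (intro finite_UN_I finite_cone_sum) (auto intro!: finite_cone_sum)
  ultimately show ?thesis by (rule finite_subset)
qed

lemma sum_fun_apply: "(\<Sum>i\<in>A. f i) x = (\<Sum>i\<in>A. f i x)"
  by (induction A rule: infinite_finite_induct) (simp_all add: pointwise)

context complex_space
begin

lemma linear_series_iff: "Vector_Spaces.linear s (series_scale s) a \<longleftrightarrow>
    (\<forall>u v. a (u + v) = a u + a v) \<and> (\<forall>t v. a (s t v) = series_scale s t (a v))"
  using vector_space_axioms vector_space_pscale[OF vector_space_pscale[OF vector_space_axioms]]
  by (auto simp: Vector_Spaces.linear_def module_hom_def module_hom_axioms_def module_iff_vector_space)

text \<open>
  An intrinsic description of \<open>LFie\<close>, in which no decomposition into components has to be chosen: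
  the support in \<open>z\<close> of each \<open>a v\<close> is bounded below in finitely many cosets of \<open>\<int>\<close>, and the last
  clause makes the set of cosets independent of \<open>v\<close>.
\<close>

definition log_field :: "'w lfield \<Rightarrow> bool" where
  "log_field a \<longleftrightarrow> Vector_Spaces.linear s (series_scale s) a \<and>
     (\<forall>v c. finite {k. a v c k \<noteq> 0}) \<and>
     (\<forall>v. \<exists>A. finite A \<and> (\<forall>c k. a v c k \<noteq> 0 \<longrightarrow> c \<in> cone A)) \<and>
     (\<exists>A. finite A \<and> (\<forall>v c k. a v c k \<noteq> 0 \<longrightarrow> (\<exists>\<alpha>\<in>A. c - \<alpha> \<in> \<int>)))"

lemma log_fieldD:
  assumes "log_field a"
  shows log_field_add: "a (u + v) = a u + a v"
    and log_field_scale: "a (s t v) = series_scale s t (a v)"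
    and log_field_finite: "finite {k. a v c k \<noteq> 0}"
  using assms by (simp_all add: log_field_def linear_series_iff)

lemma log_field_zero: "log_field a \<Longrightarrow> a 0 = 0"
  using log_field_add[of a 0 0] by simp

lemma log_field_coeff_linear:
  assumes "log_field a"
  shows "Vector_Spaces.linear s s (\<lambda>v. a v c k)"
  using vector_space_axioms
  by (auto simp: Vector_Spaces.linear_def module_hom_def module_hom_axioms_def
      module_iff_vector_space log_fieldD[OF assms] pscale_def pointwise)

lemma log_field_cone:
  assumes "log_field a"
  obtains A where "finite A" "\<And>c k. a v c k \<noteq> 0 \<Longrightarrow> c \<in> cone A"
  using assms unfolding log_field_def by metis

lemma log_field_0: "log_field 0"
  by (auto simp: log_field_def linear_series_iff pointwise pscale_def)

lemma log_field_plus: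
  assumes "log_field a" "log_field b"
  shows "log_field (a + b)"
  unfolding log_field_def
proof (intro conjI allI)
  show "Vector_Spaces.linear s (series_scale s) (a + b)"
    using log_field_add[OF assms(1)] log_field_add[OF assms(2)] log_field_scale[OF assms(1)]
      log_field_scale[OF assms(2)]
    by (simp add: linear_series_iff pointwise pscale_def scale_right_distrib)
  show "finite {k. (a + b) v c k \<noteq> 0}" for v c
  proof -
    have "{k. (a + b) v c k \<noteq> 0} \<subseteq> {k. a v c k \<noteq> 0} \<union> {k. b v c k \<noteq> 0}"
      by (auto simp: pointwise)
    then show ?thesis using log_field_finite[OF assms(1)] log_field_finite[OF assms(2)]
      by (meson finite_UnI finite_subset)
  qed
  show "\<exists>A. finite A \<and> (\<forall>c k. (a + b) v c k \<noteq> 0 \<longrightarrow> c \<in> cone A)" for v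
  proof -
    obtain A where A: "finite A" "\<And>c k. a v c k \<noteq> 0 \<Longrightarrow> c \<in> cone A"
      using assms(1) by (rule log_field_cone[where v = v]) blast
    obtain B where B: "finite B" "\<And>c k. b v c k \<noteq> 0 \<Longrightarrow> c \<in> cone B"
      using assms(2) by (rule log_field_cone[where v = v]) blast
    have "c \<in> cone (A \<union> B)" if "(a + b) v c k \<noteq> 0" for c k
    proof -
      have "a v c k \<noteq> 0 \<or> b v c k \<noteq> 0" using that by (auto simp: pointwise)
      then show ?thesis using A(2) B(2) cone_mono[of A "A \<union> B"] cone_mono[of B "A \<union> B"] by blast
    qed
    then show ?thesis using A(1) B(1) by blast
  qed
  show "\<exists>A. finite A \<and> (\<forall>v c k. (a + b) v c k \<noteq> 0 \<longrightarrow> (\<exists>\<alpha>\<in>A. c - \<alpha> \<in> \<int>))"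
  proof -
    obtain A where A: "finite A" "\<And>v c k. a v c k \<noteq> 0 \<Longrightarrow> \<exists>\<alpha>\<in>A. c - \<alpha> \<in> \<int>"
      using assms(1) unfolding log_field_def by metis
    obtain B where B: "finite B" "\<And>v c k. b v c k \<noteq> 0 \<Longrightarrow> \<exists>\<alpha>\<in>B. c - \<alpha> \<in> \<int>"
      using assms(2) unfolding log_field_def by metis
    have "\<exists>\<alpha>\<in>A \<union> B. c - \<alpha> \<in> \<int>" if "(a + b) v c k \<noteq> 0" for v c k
    proof -
      have "a v c k \<noteq> 0 \<or> b v c k \<noteq> 0" using that by (auto simp: pointwise)
      then show ?thesis using A(2) B(2) by blast
    qed
    then show ?thesis using A(1) B(1) by blast
  qed
qed

lemma log_field_pscale:
  assumes "log_field a"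
  shows "log_field (field_scale s t a)"
  unfolding log_field_def
proof (intro conjI allI)
  have sub: "a v c k \<noteq> 0" if "field_scale s t a v c k \<noteq> 0" for v c k
    using that by (auto simp: pscale_def)
  show "Vector_Spaces.linear s (series_scale s) (field_scale s t a)"
    using log_field_add[OF assms(1)] log_field_scale[OF assms(1)]
    by (simp add: linear_series_iff pointwise pscale_def scale_right_distrib mult.commute)
  show "finite {k. field_scale s t a v c k \<noteq> 0}" for v c
    by (rule finite_subset[OF _ log_field_finite[OF assms, of v c]]) (use sub in blast)
  show "\<exists>A. finite A \<and> (\<forall>c k. field_scale s t a v c k \<noteq> 0 \<longrightarrow> c \<in> cone A)" for v
    using assms sub unfolding log_field_def by meson
  show "\<exists>A. finite A \<and> (\<forall>v c k. field_scale s t a v c k \<noteq> 0 \<longrightarrow> (\<exists>\<alpha>\<in>A. c - \<alpha> \<in> \<int>))"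
    using assms sub unfolding log_field_def by meson
qed

lemma LFie_comp_log_field:
  assumes \<alpha>: "\<alpha> \<in> C_mod_Z" and a: "a \<in> LFie_comp s \<alpha>"
  shows "log_field a"
  unfolding log_field_def
proof (intro conjI allI)
  have log: "a v \<in> log_series \<alpha>" for v using a by (auto simp: LFie_comp_def)
  show "Vector_Spaces.linear s (series_scale s) a" using a by (simp add: LFie_comp_def)
  show "finite {k. a v c k \<noteq> 0}" for v c using log[of v] by (simp add: log_series_def)
  show "\<exists>A. finite A \<and> (\<forall>c k. a v c k \<noteq> 0 \<longrightarrow> c \<in> cone A)" for v
  proof -
    obtain m where "\<And>c k. a v c k \<noteq> 0 \<Longrightarrow> \<exists>i::nat. c = of_nat i - m"
      using log[of v] unfolding log_series_def by blast
    then have "\<forall>c k. a v c k \<noteq> 0 \<longrightarrow> c \<in> cone {-m}" by (force simp: cone_def)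
    then show ?thesis by blast
  qed
  obtain x where x: "\<alpha> = {(x, y). x - y \<in> \<int>} `` {x}"
    using \<alpha> by (auto simp: C_mod_Z_def quotient_def)
  have "c - (- x) \<in> \<int>" if "a v c k \<noteq> 0" for v c k
  proof -
    obtain m where m: "m \<in> \<alpha>" "\<And>c k. a v c k \<noteq> 0 \<Longrightarrow> \<exists>i::nat. c = of_nat i - m"
      using log[of v] unfolding log_series_def by blast
    obtain i :: nat where "c = of_nat i - m" using m(2) \<open>a v c k \<noteq> 0\<close> by blast
    moreover have "x - m \<in> \<int>" using m(1) x by simp
    ultimately have "c - (- x) = of_nat i + (x - m)" "x - m \<in> \<int>" by simp_all
    then show ?thesis by (metis Ints_add Ints_of_nat)
  qed
  then show "\<exists>A. finite A \<and> (\<forall>v c k. a v c k \<noteq> 0 \<longrightarrow> (\<exists>\<alpha>\<in>A. c - \<alpha> \<in> \<int>))"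
    by (intro exI[of _ "{- x}"]) auto
qed

text \<open>
  The lower bounds \<open>\<beta>\<close> that lie in one coset of \<open>\<int>\<close> can be replaced by the single bound \<open>\<alpha> - M\<close>.
\<close>

lemma finite_shift_above:
  assumes "finite B"
  shows "\<exists>M::nat. \<forall>\<beta>\<in>B. \<beta> - \<alpha> \<in> \<int> \<longrightarrow> (\<exists>j::nat. \<beta> + of_nat M = (\<alpha>::complex) + of_nat j)"
  using assms
proof (induction B)
  case (insert \<beta> B)
  then obtain M where M: "\<And>\<beta>. \<beta> \<in> B \<Longrightarrow> \<beta> - \<alpha> \<in> \<int> \<Longrightarrow> \<exists>j::nat. \<beta> + of_nat M = \<alpha> + of_nat j"
    by blast
  have M': "\<exists>j::nat. \<beta> + of_nat (M + l) = \<alpha> + of_nat j" if "\<beta> \<in> B" "\<beta> - \<alpha> \<in> \<int>" for \<beta> l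
    using M[OF that] by (metis add.assoc of_nat_add)
  show ?case
  proof (cases "\<beta> - \<alpha> \<in> \<int>")
    case True
    then obtain n where n: "\<beta> - \<alpha> = of_int n" by (auto elim: Ints_cases)
    have "\<beta> + of_nat (M + nat \<bar>n\<bar>) = \<alpha> + of_nat (nat (n + int M + \<bar>n\<bar>))"
    proof -
      have "of_nat (nat (n + int M + \<bar>n\<bar>)) = (of_int (n + int M + \<bar>n\<bar>) :: complex)"
        "of_nat (nat \<bar>n\<bar>) = (of_int \<bar>n\<bar> :: complex)"
        by (simp_all add: of_nat_nat)
      then show ?thesis using n by (simp add: algebra_simps)
    qed
    then show ?thesis using M'[where l = "nat \<bar>n\<bar>"] by blast
  next
    case False
    then show ?thesis using M by blast
  qed
qed simp

lemma equiv_C_mod_Z: "equiv UNIV {(x, y). x - y \<in> (\<int> :: complex set)}"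
proof (rule equivI)
  show "sym {(x, y). x - y \<in> (\<int> :: complex set)}"
  proof (rule symI)
    fix x y :: complex
    assume "(x, y) \<in> {(x, y). x - y \<in> \<int>}"
    then have "- (x - y) \<in> \<int>" by (simp only: mem_Collect_eq case_prod_conv Ints_minus)
    then show "(y, x) \<in> {(x, y). x - y \<in> \<int>}" by simp
  qed
  show "trans {(x, y). x - y \<in> (\<int> :: complex set)}"
  proof (rule transI)
    fix x y z :: complex
    assume "(x, y) \<in> {(x, y). x - y \<in> \<int>}" "(y, z) \<in> {(x, y). x - y \<in> \<int>}"
    then have "(x - y) + (y - z) \<in> \<int>" by (intro Ints_add) simp_all
    then show "(x, z) \<in> {(x, y). x - y \<in> \<int>}" by simp
  qed
qed (simp_all add: refl_on_def)

lemma LFie_log_field: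
  assumes "a \<in> LFie s"
  shows "log_field a"
proof -
  from assms
  obtain A f where A: "finite A" "A \<subseteq> C_mod_Z" "\<forall>\<alpha>\<in>A. f \<alpha> \<in> LFie_comp s \<alpha>"
    "a = (\<Sum>\<alpha>\<in>A. f \<alpha>)" by (auto simp: LFie_def)
  have "log_field (\<Sum>\<alpha>\<in>A. f \<alpha>)"
    using A(1-3) by (induction A) (auto intro: log_field_0 log_field_plus LFie_comp_log_field)
  then show "log_field a" using A(4) by simp
qed

text \<open>
  The component of \<open>a\<close> in a coset keeps the terms whose exponent of \<open>z\<close> lies in the negative of it.
\<close>

lemma log_field_LFie:
  assumes a: "log_field a"
  shows "a \<in> LFie s"
proof -
  let ?r = "{(x, y). x - y \<in> (\<int> :: complex set)}"
  have eqv: "equiv UNIV ?r" by (rule equiv_C_mod_Z)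
  obtain A where A: "finite A" "\<And>v c k. a v c k \<noteq> 0 \<Longrightarrow> \<exists>\<alpha>\<in>A. c - \<alpha> \<in> \<int>"
    using a unfolding log_field_def by metis
  define K where "K = (\<lambda>\<alpha>. ?r `` {-\<alpha>}) ` A"
  define f where "f \<kappa> v c k = (if -c \<in> \<kappa> then a v c k else 0)" for \<kappa> v c k
  have K: "finite K" "K \<subseteq> C_mod_Z" using A(1) by (auto simp: K_def C_mod_Z_def quotient_def)
  have comp: "f \<kappa> \<in> LFie_comp s \<kappa>" if \<kappa>K: "\<kappa> \<in> K" for \<kappa>
  proof -
    obtain \<alpha> where \<kappa>: "\<kappa> = ?r `` {-\<alpha>}" using \<kappa>K unfolding K_def by blast
    have in\<kappa>: "- c \<in> \<kappa> \<longleftrightarrow> c - \<alpha> \<in> \<int>" for c by (simp add: \<kappa>)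
    have lin: "Vector_Spaces.linear s (series_scale s) (f \<kappa>)"
      using log_field_add[OF a] log_field_scale[OF a]
      by (simp add: linear_series_iff f_def pointwise pscale_def)
    have "f \<kappa> v \<in> log_series \<kappa>" for v
    proof -
      obtain B where B: "finite B" "\<And>c k. a v c k \<noteq> 0 \<Longrightarrow> c \<in> cone B"
        using a by (rule log_field_cone[where v = v]) blast
      obtain M :: nat where
        M: "\<And>\<beta>. \<beta> \<in> B \<Longrightarrow> \<beta> - \<alpha> \<in> \<int> \<Longrightarrow> \<exists>j::nat. \<beta> + of_nat M = \<alpha> + of_nat j"
        using finite_shift_above[OF B(1)] by meson
      have "\<exists>i::nat. c = of_nat i - (of_nat M - \<alpha>)" if "f \<kappa> v c k \<noteq> 0" for c k
      proof -
        have c: "c - \<alpha> \<in> \<int>" "a v c k \<noteq> 0" using that in\<kappa> by (auto simp: f_def split: if_splits)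
        then obtain \<beta> i where \<beta>: "\<beta> \<in> B" "c = \<beta> + of_nat i" using B(2) by (force simp: cone_def)
        have "\<beta> - \<alpha> = (c - \<alpha>) - of_nat i" using \<beta>(2) by simp
        then have "\<beta> - \<alpha> \<in> \<int>" using c(1) by (metis Ints_diff Ints_of_nat)
        then obtain j where "\<beta> + of_nat M = \<alpha> + of_nat j" using M \<beta>(1) by blast
        then have "c = of_nat (i + j) - (of_nat M - \<alpha>)" using \<beta>(2) by (simp add: algebra_simps)
        then show ?thesis by blast
      qed
      moreover have "of_nat M - \<alpha> \<in> \<kappa>" using in\<kappa>[of "\<alpha> - of_nat M"] by simp
      moreover have "finite {k. f \<kappa> v c k \<noteq> 0}" for c
        by (rule finite_subset[OF _ log_field_finite[OF a, of v c]]) (auto simp: f_def)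
      ultimately show ?thesis unfolding log_series_def by blast
    qed
    then show ?thesis using lin by (auto simp: LFie_comp_def)
  qed
  have "a v c k = (\<Sum>\<kappa>\<in>K. f \<kappa> v c k)" for v c k
  proof -
    have "-c \<in> \<kappa> \<longleftrightarrow> \<kappa> = ?r `` {-c}" if \<kappa>K: "\<kappa> \<in> K" for \<kappa>
    proof -
      obtain \<alpha> where \<kappa>: "\<kappa> = ?r `` {-\<alpha>}" using \<kappa>K unfolding K_def by blast
      have "-c \<in> \<kappa> \<longleftrightarrow> (-\<alpha>, -c) \<in> ?r" by (simp add: \<kappa>)
      also have "\<dots> \<longleftrightarrow> ?r `` {-\<alpha>} = ?r `` {-c}"
        by (rule eq_equiv_class_iff[OF eqv, symmetric]) simp_all
      finally show ?thesis by (simp only: \<kappa>)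
    qed
    then have "(\<Sum>\<kappa>\<in>K. f \<kappa> v c k) = (\<Sum>\<kappa>\<in>K. if \<kappa> = ?r `` {-c} then a v c k else 0)"
      by (intro sum.cong) (auto simp: f_def)
    also have "\<dots> = (if ?r `` {-c} \<in> K then a v c k else 0)" using K(1) by simp
    also have "\<dots> = a v c k"
    proof (cases "a v c k = 0")
      case False
      then obtain \<alpha> where \<alpha>: "\<alpha> \<in> A" "c - \<alpha> \<in> \<int>" using A(2) by blast
      then have "(-\<alpha>, -c) \<in> ?r" by simp
      then have "?r `` {-\<alpha>} = ?r `` {-c}" using eqv by (rule equiv_class_eq[rotated])
      then show ?thesis using \<alpha>(1) by (auto simp: K_def)
    qed simp
    finally show ?thesis ..
  qed
  then have "a = (\<Sum>\<kappa>\<in>K. f \<kappa>)" by (simp add: fun_eq_iff sum_fun_apply)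
  then show "a \<in> LFie s" using K comp unfolding LFie_def by blast
qed

lemma LFie_iff: "a \<in> LFie s \<longleftrightarrow> log_field a"
  using LFie_log_field log_field_LFie by blast


section \<open>Products of logarithmic fields\<close>

lemma mult_z12_pow_support:
  "(mult_z12 ^^ N) F c1 k1 c2 k2 \<noteq> 0 \<Longrightarrow>
    \<exists>i\<le>N. \<exists>j\<le>N. F (c1 - of_nat i) k1 (c2 - of_nat j) k2 \<noteq> 0"
proof (induction N arbitrary: c1 c2)
  case 0
  then show ?case by (intro exI[of _ 0]) simp
next
  case (Suc N)
  have "(mult_z12 ^^ N) F (c1 - 1) k1 c2 k2 \<noteq> 0 \<or> (mult_z12 ^^ N) F c1 k1 (c2 - 1) k2 \<noteq> 0"
    using Suc.prems mult_z12_apply[of "(mult_z12 ^^ N) F" c1 k1 c2 k2] by auto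
  then show ?case
  proof
    assume "(mult_z12 ^^ N) F (c1 - 1) k1 c2 k2 \<noteq> 0"
    then obtain i j where "i \<le> N" "j \<le> N" "F (c1 - 1 - of_nat i) k1 (c2 - of_nat j) k2 \<noteq> 0"
      using Suc.IH by blast
    then show ?thesis
      by (intro exI[of _ "Suc i"] conjI exI[of _ j]) (simp_all add: algebra_simps)
  next
    assume "(mult_z12 ^^ N) F c1 k1 (c2 - 1) k2 \<noteq> 0"
    then obtain i j where "i \<le> N" "j \<le> N" "F (c1 - of_nat i) k1 (c2 - 1 - of_nat j) k2 \<noteq> 0"
      using Suc.IH by blast
    then show ?thesis
      by (intro exI[of _ i] conjI exI[of _ "Suc j"]) (simp_all add: algebra_simps)
  qed
qed

lemma D1_pow_support:
  "(D1 ^^ n) F c1 k1 c2 k2 \<noteq> 0 \<Longrightarrow> \<exists>k. F (c1 + of_nat n) k c2 k2 \<noteq> 0"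
proof (induction n arbitrary: c1 k1)
  case (Suc n)
  obtain k where "(D1 ^^ n) F (c1 + 1) k c2 k2 \<noteq> 0"
    using Suc.prems D1_support[of "(D1 ^^ n) F" c1 k1 c2 k2] by auto
  from Suc.IH[OF this] show ?case by (simp add: algebra_simps)
qed auto

lemma local_atD: "local_at N a b \<Longrightarrow> (mult_z12 ^^ N) (comp12 a b v) = (mult_z12 ^^ N) (comp21 a b v)"
  by (simp add: local_at_def)

lemma comp12_finite:
  assumes a: "log_field a" and b: "log_field b"
  shows "finite {(k1, k2). comp12 a b v c1 k1 c2 k2 \<noteq> 0}"
proof -
  have "{(k1, k2). comp12 a b v c1 k1 c2 k2 \<noteq> 0}
      \<subseteq> (\<lambda>(k2, k1). (k1, k2)) ` (SIGMA k2:{k2. b v c2 k2 \<noteq> 0}. {k1. a (b v c2 k2) c1 k1 \<noteq> 0})"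
    using log_field_zero[OF a] by (force simp: comp12_def pointwise image_iff)
  moreover have "finite \<dots>"
    using a b by (intro finite_imageI finite_SigmaI) (simp_all add: log_field_finite)
  ultimately show ?thesis by (rule finite_subset)
qed

text \<open>
  This is where locality bounds the exponents: in \<open>a(z\<^sub>1)b(z\<^sub>2)v\<close> those of \<open>z\<^sub>2\<close> are bounded below, in
  \<open>b(z\<^sub>2)a(z\<^sub>1)v\<close> those of \<open>z\<^sub>1\<close>, and multiplication by \<open>z\<^sub>1\<^sub>2\<^sup>N\<close> makes the two series equal.
\<close>

lemma comp12_support:
  assumes "log_field a" "log_field b" "local_at N a b"
  obtains A B where "finite A" "finite B"
    "\<And>c1 k1 c2 k2. (mult_z12 ^^ N) (comp12 a b v) c1 k1 c2 k2 \<noteq> 0 \<Longrightarrow> c1 \<in> cone A \<and> c2 \<in> cone B"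
proof -
  obtain A where A: "finite A" "\<And>c k. a v c k \<noteq> 0 \<Longrightarrow> c \<in> cone A"
    using assms(1) by (rule log_field_cone[where v = v]) blast
  obtain B where B: "finite B" "\<And>c k. b v c k \<noteq> 0 \<Longrightarrow> c \<in> cone B"
    using assms(2) by (rule log_field_cone[where v = v]) blast
  show ?thesis
  proof (rule that[OF A(1) B(1)])
    fix c1 k1 c2 k2
    assume F: "(mult_z12 ^^ N) (comp12 a b v) c1 k1 c2 k2 \<noteq> 0"
    obtain i j where "comp12 a b v (c1 - of_nat i) k1 (c2 - of_nat j) k2 \<noteq> 0"
      using mult_z12_pow_support[OF F] by blast
    then have "b v (c2 - of_nat j) k2 \<noteq> 0"
      using log_field_zero[OF assms(1)] by (auto simp: comp12_def pointwise)
    then have c2: "c2 \<in> cone B" using B(2) cone_shift by blast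
    have F': "(mult_z12 ^^ N) (comp21 a b v) c1 k1 c2 k2 \<noteq> 0"
      using F local_atD[OF assms(3)] by simp
    obtain i j where "comp21 a b v (c1 - of_nat i) k1 (c2 - of_nat j) k2 \<noteq> 0"
      using mult_z12_pow_support[OF F'] by blast
    then have "a v (c1 - of_nat i) k1 \<noteq> 0"
      using log_field_zero[OF assms(2)] by (auto simp: comp21_def pointwise)
    then have "c1 \<in> cone A" using A(2) cone_shift by blast
    then show "c1 \<in> cone A \<and> c2 \<in> cone B" using c2 by blast
  qed
qed

lemma restrictableI:
  assumes "finite A" "finite B"
    and cone: "\<And>c1 k1 c2 k2. F c1 k1 c2 k2 \<noteq> 0 \<Longrightarrow> c1 \<in> cone A \<and> c2 \<in> cone B"
    and fin: "\<And>c1 c2. finite {(k1, k2). F c1 k1 c2 k2 \<noteq> 0}"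
  shows "restrictable F"
  unfolding restrictable_def
proof
  fix c
  let ?C = "{(c1, c2). c1 \<in> cone A \<and> c2 \<in> cone B \<and> c1 + c2 = c}"
  have "{(c1, k1, c2, k2). c1 + c2 = c \<and> F c1 k1 c2 k2 \<noteq> 0}
      \<subseteq> (\<Union>(c1, c2)\<in>?C. (\<lambda>(k1, k2). (c1, k1, c2, k2)) ` {(k1, k2). F c1 k1 c2 k2 \<noteq> 0})"
    using cone by (auto simp: image_iff)
  moreover have "finite \<dots>"
    using fin by (intro finite_UN_I finite_cone_sum assms(1,2)) auto
  ultimately show "finite {(c1, k1, c2, k2). c1 + c2 = c \<and> F c1 k1 c2 k2 \<noteq> 0}"
    by (rule finite_subset)
qed

lemma mult_z12_pow_finite:
  assumes fin: "\<And>c1 c2. finite {(k1, k2). F c1 k1 c2 k2 \<noteq> 0}"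
  shows "finite {(k1, k2). (mult_z12 ^^ N) F c1 k1 c2 k2 \<noteq> 0}"
proof -
  have "{(k1, k2). (mult_z12 ^^ N) F c1 k1 c2 k2 \<noteq> 0}
      \<subseteq> (\<Union>(i, j)\<in>{..N} \<times> {..N}. {(k1, k2). F (c1 - of_nat i) k1 (c2 - of_nat j) k2 \<noteq> 0})"
    using mult_z12_pow_support[of N F c1 _ c2] by force
  moreover have "finite \<dots>" using fin by (intro finite_UN_I) auto
  ultimately show ?thesis by (rule finite_subset)
qed

lemma restrictable_comp12:
  assumes "log_field a" "log_field b" "local_at N a b"
  shows "restrictable ((mult_z12 ^^ N) (comp12 a b v))"
proof -
  obtain A B where "finite A" "finite B"
    "\<And>c1 k1 c2 k2. (mult_z12 ^^ N) (comp12 a b v) c1 k1 c2 k2 \<noteq> 0 \<Longrightarrow> c1 \<in> cone A \<and> c2 \<in> cone B"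
    using assms by (rule comp12_support[where v = v]) blast
  then show ?thesis
    by (rule restrictableI) (simp_all add: mult_z12_pow_finite comp12_finite assms(1,2))
qed

lemma finite_pole_comp12:
  "log_field a \<Longrightarrow> log_field b \<Longrightarrow> local_fields a b \<Longrightarrow> finite_pole (comp12 a b v)"
  unfolding local_fields_def by (blast intro: finite_poleI restrictable_comp12)

lemma nth_prod_eq:
  assumes "log_field a" "log_field b" "local_fields a b"
  shows "nth_prod s n a b = (\<lambda>v. pole_coeff n (comp12 a b v))"
proof -
  let ?N = "SOME N. local_at N a b"
  have "local_at ?N a b" using assms(3) unfolding local_fields_def by (rule someI_ex)
  then have r: "restrictable ((mult_z12 ^^ ?N) (comp12 a b v))" for v
    using assms(1,2) by (intro restrictable_comp12)
  show ?thesis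
    unfolding nth_prod_def nth_prod_at_def pole_coeff_eq[OF r] pole_coeff_at_def
    by (simp add: fun_eq_iff zero_fun_apply)
qed

lemma nth_prod_bounded:
  assumes "log_field a" "log_field b" "local_fields a b"
  obtains N where "\<And>n. n \<ge> int N \<Longrightarrow> nth_prod s n a b = 0"
proof -
  obtain N where N: "local_at N a b" using assms(3) unfolding local_fields_def by blast
  have "nth_prod s n a b = 0" if "n \<ge> int N" for n
    unfolding nth_prod_eq[OF assms] pole_coeff_eq[OF restrictable_comp12[OF assms(1,2) N]]
      pole_coeff_at_def
    using that by (simp add: fun_eq_iff zero_fun_apply)
  then show ?thesis by (rule that)
qed

lemma comp12_linear:
  assumes "log_field a" "log_field b"
  shows "comp12 a b (u + v) = comp12 a b u + comp12 a b v"
    and "comp12 a b (s t v) = series_scale (series_scale s) t (comp12 a b v)"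
  using log_fieldD[OF assms(1)] log_fieldD[OF assms(2)]
  by (simp_all add: comp12_def pointwise pscale_def)

lemma diag_support: "diag F c k \<noteq> 0 \<Longrightarrow> \<exists>c1 k1 c2 k2. c1 + c2 = c \<and> k1 + k2 = k \<and> F c1 k1 c2 k2 \<noteq> 0"
  unfolding diag_def by (erule contrapos_np) (auto intro!: sum.neutral)

lemma diag_finite:
  assumes "restrictable F"
  shows "finite {k. diag F c k \<noteq> 0}"
proof -
  have "{k. diag F c k \<noteq> 0}
      \<subseteq> (\<lambda>(c1, k1, c2, k2). k1 + k2) ` {(c1, k1, c2, k2). c1 + c2 = c \<and> F c1 k1 c2 k2 \<noteq> 0}"
    using diag_support[of F c] by (force simp: image_iff)
  moreover have "finite \<dots>" using assms by (simp add: restrictable_def)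
  ultimately show ?thesis by (rule finite_subset)
qed

text \<open>
  The exponents of \<open>z\<close> in the product are sums of exponents for \<open>a\<close> and for \<open>b\<close>, shifted by
  integers, so the cosets that occur are sums of cosets for \<open>a\<close> and for \<open>b\<close>.
\<close>

lemma log_field_nth_prod:
  assumes a: "log_field a" and b: "log_field b" and loc: "local_fields a b"
  shows "log_field (nth_prod s n a b)"
proof -
  obtain N where N: "local_at N a b" using loc unfolding local_fields_def by blast
  let ?F = "\<lambda>v. (mult_z12 ^^ N) (comp12 a b v)"
  have r: "restrictable (?F v)" for v by (rule restrictable_comp12[OF a b N])
  show ?thesis
  proof (cases "n \<le> int N - 1")
    case False
    then have "nth_prod s n a b = 0"
      unfolding nth_prod_eq[OF a b loc] pole_coeff_eq[OF r] pole_coeff_at_def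
      by (simp add: fun_eq_iff zero_fun_apply)
    then show ?thesis by (simp add: log_field_0)
  next
    case True
    define m where "m = nat (int N - 1 - n)"
    have eq: "nth_prod s n a b = (\<lambda>v. diag (D1_divpow m (?F v)))"
      unfolding nth_prod_eq[OF a b loc] pole_coeff_eq[OF r] pole_coeff_at_def m_def
      using True by simp
    have supp: "\<exists>c1 k1 c2 k2. c = c1 + c2 \<and> ?F v (c1 + of_nat m) k1 c2 k2 \<noteq> 0"
      if "nth_prod s n a b v c k \<noteq> 0" for v c k
    proof -
      have "diag (D1_divpow m (?F v)) c k \<noteq> 0" using that unfolding eq .
      then obtain c1 k1 c2 k2 where *: "c1 + c2 = c" "D1_divpow m (?F v) c1 k1 c2 k2 \<noteq> 0"
        using diag_support by blast
      have "(D1 ^^ m) (?F v) c1 k1 c2 k2 \<noteq> 0" using *(2) by (auto simp: D1_divpow_apply pscale_def)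
      then show ?thesis using D1_pow_support *(1) by blast
    qed
    show ?thesis
      unfolding log_field_def
    proof (intro conjI allI)
      have fp: "finite_pole (comp12 a b v)" for v by (rule finite_poleI[OF r])
      show "Vector_Spaces.linear s (series_scale s) (nth_prod s n a b)"
        unfolding linear_series_iff nth_prod_eq[OF a b loc]
        by (simp add: comp12_linear[OF a b] pole_coeff_add fp pole_coeff_descends[OF descends_scale])
      show "finite {k. nth_prod s n a b v c k \<noteq> 0}" for v c
        unfolding eq by (intro diag_finite restrictable_D1_divpow r)
      show "\<exists>A. finite A \<and> (\<forall>c k. nth_prod s n a b v c k \<noteq> 0 \<longrightarrow> c \<in> cone A)" for v
      proof -
        obtain A B where AB: "finite A" "finite B"
          "\<And>c1 k1 c2 k2. ?F v c1 k1 c2 k2 \<noteq> 0 \<Longrightarrow> c1 \<in> cone A \<and> c2 \<in> cone B"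
          using a b N by (rule comp12_support[where v = v]) blast
        let ?C = "(\<lambda>(\<alpha>, \<beta>). \<alpha> + \<beta>) ` ((\<lambda>\<alpha>. \<alpha> - of_nat m) ` A \<times> B)"
        have "c \<in> cone ?C" if "nth_prod s n a b v c k \<noteq> 0" for c k
        proof -
          obtain c1 k1 c2 k2 where c: "c = c1 + c2" "?F v (c1 + of_nat m) k1 c2 k2 \<noteq> 0"
            using supp[OF \<open>nth_prod s n a b v c k \<noteq> 0\<close>] by blast
          show ?thesis unfolding c(1) using AB(3)[OF c(2)] by (blast intro: cone_sum cone_translate)
        qed
        then show ?thesis using AB(1,2) by (intro exI[of _ ?C]) simp
      qed
      obtain A where A: "finite A" "\<And>v c k. a v c k \<noteq> 0 \<Longrightarrow> \<exists>\<alpha>\<in>A. c - \<alpha> \<in> \<int>"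
        using a unfolding log_field_def by metis
      obtain B where B: "finite B" "\<And>v c k. b v c k \<noteq> 0 \<Longrightarrow> \<exists>\<beta>\<in>B. c - \<beta> \<in> \<int>"
        using b unfolding log_field_def by metis
      have "\<exists>\<gamma>\<in>(\<lambda>(\<alpha>, \<beta>). \<alpha> + \<beta>) ` (A \<times> B). c - \<gamma> \<in> \<int>" if "nth_prod s n a b v c k \<noteq> 0" for v c k
      proof -
        obtain c1 k1 c2 k2 where c: "c = c1 + c2" "?F v (c1 + of_nat m) k1 c2 k2 \<noteq> 0"
          using supp[OF \<open>nth_prod s n a b v c k \<noteq> 0\<close>] by blast
        obtain i j where ij: "comp12 a b v (c1 + of_nat m - of_nat i) k1 (c2 - of_nat j) k2 \<noteq> 0"
          using mult_z12_pow_support[OF c(2)] by blast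
        then have "a (b v (c2 - of_nat j) k2) (c1 + of_nat m - of_nat i) k1 \<noteq> 0"
          by (simp add: comp12_def)
        moreover from this have "b v (c2 - of_nat j) k2 \<noteq> 0"
          using log_field_zero[OF a] by (auto simp: pointwise)
        ultimately obtain \<alpha> \<beta> where *: "\<alpha> \<in> A" "\<beta> \<in> B"
          "c1 + of_nat m - of_nat i - \<alpha> \<in> \<int>" "c2 - of_nat j - \<beta> \<in> \<int>"
          using A(2) B(2) by blast
        have "c - (\<alpha> + \<beta>) = (c1 + of_nat m - of_nat i - \<alpha>) + (c2 - of_nat j - \<beta>)
            + of_nat i + of_nat j - of_nat m" by (simp add: c(1))
        also have "\<dots> \<in> \<int>"
          by (rule Ints_diff[OF Ints_add[OF Ints_add[OF Ints_add[OF *(3,4)]]]]) (rule Ints_of_nat)+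
        finally have "c - (\<alpha> + \<beta>) \<in> \<int>" .
        then show ?thesis using *(1,2) by force
      qed
      then show "\<exists>C. finite C \<and> (\<forall>v c k. nth_prod s n a b v c k \<noteq> 0 \<longrightarrow> (\<exists>\<gamma>\<in>C. c - \<gamma> \<in> \<int>))"
        using A(1) B(1) by (intro exI[of _ "(\<lambda>(\<alpha>, \<beta>). \<alpha> + \<beta>) ` (A \<times> B)"]) simp
    qed
  qed
qed

lemma D_zeta_eq: "D_zeta s f = zshift 1 (D_z s f)"
  by (simp add: D_zeta_def D_z_def zshift_def pointwise)

lemma D_zeta_apply:
  "D_zeta s f c k = s c (f c k) + s (of_nat (k + 1)) (f c (k + 1))"
  by (simp add: D_zeta_eq zshift_def D_z_apply)

lemma log_field_D_zeta:
  assumes "log_field a"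
  shows "log_field (field_D_zeta s a)"
  unfolding log_field_def
proof (intro conjI allI)
  have sub: "a v c k \<noteq> 0 \<or> a v c (k + 1) \<noteq> 0" if "field_D_zeta s a v c k \<noteq> 0" for v c k
    using that by (auto simp: field_D_zeta_def D_zeta_apply)
  show "Vector_Spaces.linear s (series_scale s) (field_D_zeta s a)"
    using log_field_add[OF assms(1)] log_field_scale[OF assms(1)]
    by (simp add: linear_series_iff pointwise pscale_def scale_right_distrib mult.commute
        field_D_zeta_def D_zeta_apply)
  show "finite {k. field_D_zeta s a v c k \<noteq> 0}" for v c
  proof -
    have "{k. field_D_zeta s a v c k \<noteq> 0} \<subseteq> {k. a v c k \<noteq> 0} \<union> (\<lambda>k. k + 1) -` {k. a v c k \<noteq> 0}"
      using sub by blast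
    moreover have "finite \<dots>"
      using log_field_finite[OF assms] by (intro finite_UnI finite_vimageI) auto
    ultimately show ?thesis by (rule finite_subset)
  qed
  show "\<exists>A. finite A \<and> (\<forall>c k. field_D_zeta s a v c k \<noteq> 0 \<longrightarrow> c \<in> cone A)" for v
    using assms sub unfolding log_field_def by meson
  show "\<exists>A. finite A \<and> (\<forall>v c k. field_D_zeta s a v c k \<noteq> 0 \<longrightarrow> (\<exists>\<alpha>\<in>A. c - \<alpha> \<in> \<int>))"
    using assms sub unfolding log_field_def by meson
qed

lemma log_field_id: "log_field id_field"
  unfolding log_field_def
proof (intro conjI allI)
  show "Vector_Spaces.linear s (series_scale s) id_field"
    by (simp add: linear_series_iff id_field_def pointwise pscale_def)
  show "finite {k. id_field v c k \<noteq> 0}" for v :: 'w and c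
    by (rule finite_subset[of _ "{0}"]) (auto simp: id_field_def)
  have "0 \<in> cone {0}" unfolding cone_def by (force intro: exI[of _ 0])
  then show "\<exists>A. finite A \<and> (\<forall>c k. id_field v c k \<noteq> 0 \<longrightarrow> c \<in> cone A)" for v :: 'w
    by (intro exI[of _ "{0}"]) (auto simp: id_field_def)
  show "\<exists>A. finite A \<and> (\<forall>v c k. id_field (v :: 'w) c k \<noteq> 0 \<longrightarrow> (\<exists>\<alpha>\<in>A. c - \<alpha> \<in> \<int>))"
    by (intro exI[of _ "{0}"]) (auto simp: id_field_def)
qed


section \<open>Locality of products\<close>

lemma local_fieldsI: "local_at N a b \<Longrightarrow> local_fields a b"
  by (auto simp: local_fields_def)

lemma local_at_mono:
  assumes "local_at N a b" "N \<le> M"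
  shows "local_at M a b"
  using assms(2,1)
proof (induction M rule: dec_induct)
  case (step M)
  then show ?case by (simp add: local_at_def)
qed

lemma mult_z12_pow_swap_zero: "(mult_z12 ^^ N) F = 0 \<Longrightarrow> (mult_z12 ^^ N) (swap F) = 0"
proof (induction N arbitrary: F)
  case 0
  then show ?case by (simp add: swap_def pointwise)
next
  case (Suc N)
  have neg: "(mult_z12 ^^ N) (- G) = - (mult_z12 ^^ N) G" for G
    using mult_z12_pow_diff[of N 0 G] by simp
  have "(mult_z12 ^^ N) (mult_z12 F) = 0" using Suc.prems by (simp add: funpow_swap1)
  then have "(mult_z12 ^^ N) (swap (mult_z12 F)) = 0" by (rule Suc.IH)
  then have "(mult_z12 ^^ N) (mult_z12 (swap F)) = 0" by (simp add: mult_z12_swap neg)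
  then show ?case by (simp add: funpow_swap1)
qed

lemma mult_z12_pow_swap_eq:
  "(mult_z12 ^^ N) F = (mult_z12 ^^ N) G \<Longrightarrow> (mult_z12 ^^ N) (swap F) = (mult_z12 ^^ N) (swap G)"
proof -
  assume "(mult_z12 ^^ N) F = (mult_z12 ^^ N) G"
  then have "(mult_z12 ^^ N) (swap (F - G)) = 0"
    by (intro mult_z12_pow_swap_zero) (simp add: mult_z12_pow_diff)
  moreover have "swap (F - G) = swap F - swap G" by (simp add: swap_def pointwise)
  ultimately show ?thesis by (simp add: mult_z12_pow_diff)
qed

lemma local_at_sym:
  assumes "local_at N a b"
  shows "local_at N b a"
  unfolding local_at_def
proof
  fix v
  have "comp12 b a v = swap (comp21 a b v)" "comp21 b a v = swap (comp12 a b v)"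
    by (simp_all add: comp12_def comp21_def swap_def)
  then show "(mult_z12 ^^ N) (comp12 b a v) = (mult_z12 ^^ N) (comp21 b a v)"
    using mult_z12_pow_swap_eq[OF local_atD[OF assms, of v]] by simp
qed

lemma local_fields_sym: "local_fields a b \<Longrightarrow> local_fields b a"
  using local_at_sym unfolding local_fields_def by blast

definition mult_z13 :: "'w lseries2 lseries \<Rightarrow> 'w lseries2 lseries" where
  "mult_z13 F = zshift 1 F - coeffwise (coeffwise (zshift 1)) F"

abbreviation "coeffwise_pole_coeff n \<equiv> coeffwise (pole_coeff n)"

text \<open>
  On the left the remaining variables are \<open>z\<^sub>1\<close> and the common value \<open>z\<close> of \<open>z\<^sub>2\<close> and \<open>z\<^sub>3\<close>.
  Multiplication by \<open>z\<close> may be carried out as multiplication by \<open>z\<^sub>3\<close> before the expansion, which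
  gives the first equation. The second follows from \<open>z\<^sub>1\<^sub>3 = z\<^sub>1\<^sub>2 + z\<^sub>2\<^sub>3\<close>, because the factor \<open>z\<^sub>2\<^sub>3\<close> raises
  the index of the coefficient.
\<close>

lemma mult_z12_coeffwise_pole_coeff:
  assumes K: "\<And>c k. finite_pole (K c k)"
  shows "mult_z12 (coeffwise_pole_coeff n K) = coeffwise_pole_coeff n (mult_z13 K)"
    and "\<And>c k. finite_pole (mult_z13 K c k)"
    and "mult_z12 (coeffwise_pole_coeff n K)
      = coeffwise_pole_coeff n (mult_z12 K) + coeffwise_pole_coeff (n + 1) K"
    and "\<And>c k. finite_pole (mult_z12 K c k)"
proof -
  have K': "finite_pole (coeffwise (zshift 1) (K c k))" "finite_pole (zshift 1 (K c k))" for c k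
    using pole_coeff_descends(1)[OF descends_coeffwise_zshift K] pole_coeff_mult_z12(1)[OF K]
      pole_coeff_add(1)[of "mult_z12 (K c k)" "coeffwise (zshift 1) (K c k)"]
    by (simp_all add: mult_z12_alt)
  have mult13: "mult_z13 K c k = K (c - 1) k - coeffwise (zshift 1) (K c k)" for c k
    by (simp add: mult_z13_def pointwise zshift_def coeffwise_def)
  have mult12: "mult_z12 K c k = mult_z13 K c k - mult_z12 (K c k)" for c k
    by (simp add: mult_z12_alt mult13) (simp add: pointwise zshift_def coeffwise_def)
  show fin13: "\<And>c k. finite_pole (mult_z13 K c k)"
    unfolding mult13 by (intro pole_coeff_diff(1) K K')
  show "\<And>c k. finite_pole (mult_z12 K c k)"
    unfolding mult12 by (intro pole_coeff_diff(1) fin13 pole_coeff_mult_z12 K)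
  have "mult_z12 (coeffwise_pole_coeff n K) c k = coeffwise_pole_coeff n (mult_z13 K) c k" for c k
  proof -
    have "coeffwise_pole_coeff n (mult_z13 K) c k
        = pole_coeff n (K (c - 1) k) - zshift 1 (pole_coeff n (K c k))"
      unfolding coeffwise_def[of "pole_coeff n"] mult13
      by (simp add: pole_coeff_diff(2) K K' pole_coeff_descends(2)[OF descends_coeffwise_zshift])
    then show ?thesis by (simp add: pointwise mult_z12_apply) (simp add: coeffwise_def zshift_def)
  qed
  then show eq13: "mult_z12 (coeffwise_pole_coeff n K) = coeffwise_pole_coeff n (mult_z13 K)"
    by (intro ext) simp
  have "coeffwise_pole_coeff n (mult_z12 K) c k
      = coeffwise_pole_coeff n (mult_z13 K) c k - coeffwise_pole_coeff (n + 1) K c k" for c k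
    unfolding coeffwise_def[of "pole_coeff n"] coeffwise_def[of "pole_coeff (n + 1)"] mult12
    by (simp add: pole_coeff_diff(2) fin13 pole_coeff_mult_z12 K)
  then have "coeffwise_pole_coeff n (mult_z12 K) = coeffwise_pole_coeff n (mult_z13 K) - coeffwise_pole_coeff (n + 1) K"
    by (intro ext) (simp add: minus_apply)
  then show "mult_z12 (coeffwise_pole_coeff n K)
      = coeffwise_pole_coeff n (mult_z12 K) + coeffwise_pole_coeff (n + 1) K"
    by (simp add: eq13)
qed

lemma mult_z13_pow:
  assumes "\<And>c k. finite_pole (K c k)"
  shows "(mult_z12 ^^ q) (coeffwise_pole_coeff n K) = coeffwise_pole_coeff n ((mult_z13 ^^ q) K)"
    and "\<And>c k. finite_pole ((mult_z13 ^^ q) K c k)"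
proof (induction q)
  case (Suc q)
  case 1
  then show ?case by (simp add: Suc mult_z12_coeffwise_pole_coeff(1)[OF Suc(2)])
next
  case (Suc q)
  case 2
  then show ?case using mult_z12_coeffwise_pole_coeff(2)[OF Suc(2)] by simp
qed (use assms in simp_all)


lemma mult_z12_coeffwise2:
  assumes "\<And>x y. \<phi> (x - y) = \<phi> x - \<phi> y"
  shows "mult_z12 (coeffwise (coeffwise \<phi>) F) = coeffwise (coeffwise \<phi>) (mult_z12 F)"
  by (simp add: pointwise mult_z12_def coeffwise_def zshift_def assms)

lemma mult_z12_pow_coeffwise2:
  assumes "\<And>x y. \<phi> (x - y) = \<phi> x - \<phi> y"
  shows "(mult_z12 ^^ n) (coeffwise (coeffwise \<phi>) F) = coeffwise (coeffwise \<phi>) ((mult_z12 ^^ n) F)"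
  by (rule funpow_commute[where g = "coeffwise (coeffwise \<phi>)"]) (rule mult_z12_coeffwise2[OF assms])

lemma mult_z12_pow_zshift: "(mult_z12 ^^ n) (zshift p F) = zshift p ((mult_z12 ^^ n) F)"
  by (rule funpow_commute[where g = "zshift p"])
    (simp add: pointwise mult_z12_def zshift_def algebra_simps)

lemma mult_z12_pow_coeffwise_zshift:
  "(mult_z12 ^^ n) (coeffwise (zshift p) F) = coeffwise (zshift p) ((mult_z12 ^^ n) F)"
  by (rule funpow_commute[where g = "coeffwise (zshift p)"])
    (simp add: pointwise mult_z12_def zshift_def coeffwise_def algebra_simps)

lemma mult_z12_z13: "mult_z12 (mult_z13 K) = mult_z13 (mult_z12 K)"
  by (simp add: pointwise mult_z12_def mult_z13_def zshift_def coeffwise_def algebra_simps)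

lemma restrictable_mult_z12_z13:
  assumes "\<And>c k. restrictable ((mult_z12 ^^ N) (K c k))"
  shows "restrictable ((mult_z12 ^^ N) (mult_z12 K c k))"
    and "restrictable ((mult_z12 ^^ N) (mult_z13 K c k))"
proof -
  have "mult_z12 K c k = K (c - 1) k - zshift 1 (K c k)"
    by (simp add: pointwise mult_z12_def zshift_def)
  then show "restrictable ((mult_z12 ^^ N) (mult_z12 K c k))"
    by (simp add: mult_z12_pow_diff mult_z12_pow_zshift restrictable_diff restrictable_zshift assms)
  have "mult_z13 K c k = K (c - 1) k - coeffwise (zshift 1) (K c k)"
    by (simp add: pointwise mult_z13_def zshift_def coeffwise_def)
  then show "restrictable ((mult_z12 ^^ N) (mult_z13 K c k))"
    by (simp add: mult_z12_pow_diff mult_z12_pow_coeffwise_zshift restrictable_diff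
        restrictable_coeffwise_zshift assms)
qed

lemma restrictable_mult_z13_pow:
  assumes "\<And>c k. restrictable ((mult_z12 ^^ N) (K c k))"
  shows "restrictable ((mult_z12 ^^ N) ((mult_z13 ^^ q) K c k))"
proof (induction q arbitrary: c k)
  case (Suc q)
  then show ?case using restrictable_mult_z12_z13(2)[of N "(mult_z13 ^^ q) K"] by simp
qed (simp add: assms)

lemma pole_coeff_ge_zero:
  "restrictable ((mult_z12 ^^ N) F) \<Longrightarrow> n \<ge> int N \<Longrightarrow> pole_coeff n F = 0"
  by (simp add: pole_coeff_eq pole_coeff_at_def)

text \<open>
  Each factor \<open>z\<^sub>1 - z\<close> either lowers the power of \<open>z\<^sub>1\<^sub>2\<close> that is needed to kill \<open>K\<close> or raises the
  index \<open>n\<close>, and the coefficients with \<open>n \<ge> N\<close> vanish.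
\<close>

lemma coeffwise_pole_coeff_vanishes:
  assumes "\<And>c k. restrictable ((mult_z12 ^^ N) (K c k))" and "(mult_z12 ^^ p) K = 0"
  shows "(mult_z12 ^^ (p + nat (int N - n))) (coeffwise_pole_coeff n K) = 0"
  using assms
proof (induction "p + nat (int N - n)" arbitrary: p n K)
  case (0 p n K)
  then have "K = 0" by simp
  then have "coeffwise_pole_coeff n K = 0" by (intro ext) (simp add: coeffwise_def zero_fun_apply)
  then show ?case by simp
next
  case (Suc m p n K)
  show ?case
  proof (cases "n \<ge> int N")
    case True
    then have "coeffwise_pole_coeff n K = 0"
      using pole_coeff_ge_zero[OF Suc.prems(1)] by (intro ext) (simp add: coeffwise_def zero_fun_apply)
    then show ?thesis by simp
  next
    case n: False
    show ?thesis
    proof (cases p)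
      case 0
      then have "K = 0" using Suc.prems(2) by simp
      then have "coeffwise_pole_coeff n K = 0"
        by (intro ext) (simp add: coeffwise_def zero_fun_apply)
      then show ?thesis by simp
    next
      case (Suc p')
      have 1: "(mult_z12 ^^ m) (coeffwise_pole_coeff n (mult_z12 K)) = 0"
      proof -
        have m: "m = p' + nat (int N - n)" using Suc Suc.hyps(2) by simp
        show ?thesis
          unfolding m
          by (rule Suc.hyps(1)[OF m]) (use Suc.prems restrictable_mult_z12_z13(1) Suc in
              \<open>simp_all add: funpow_swap1\<close>)
      qed
      have 2: "(mult_z12 ^^ m) (coeffwise_pole_coeff (n + 1) K) = 0"
      proof -
        have m: "m = p + nat (int N - (n + 1))" using n Suc.hyps(2) by simp
        show ?thesis unfolding m by (rule Suc.hyps(1)[OF m]) (use Suc.prems in auto)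
      qed
      have "(mult_z12 ^^ Suc m) (coeffwise_pole_coeff n K)
          = (mult_z12 ^^ m) (mult_z12 (coeffwise_pole_coeff n K))" by (simp add: funpow_swap1)
      also have "\<dots> = 0"
        by (subst mult_z12_coeffwise_pole_coeff(3)[OF finite_poleI[OF Suc.prems(1)]])
          (simp add: mult_z12_pow_add 1 2)
      finally show ?thesis by (simp only: Suc.hyps(2))
    qed
  qed
qed

definition comp123 :: "'w lfield \<Rightarrow> 'w lfield \<Rightarrow> 'w lfield \<Rightarrow> 'w \<Rightarrow> 'w lseries2 lseries" where
  "comp123 a b c v = (\<lambda>c1 k1 c2 k2 c3 k3. a (b (c v c3 k3) c2 k2) c1 k1)"

lemma log_field_diff: "log_field a \<Longrightarrow> a (u - v) = a u - a v"
  using log_field_add[of a "u - v" v] by simp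

text \<open>
  Locality of \<open>a\<close> and \<open>b\<close>, applied to the vectors that are the coefficients of \<open>c(z\<^sub>3)v\<close>.
\<close>

lemma mult_z12_pow_comp123:
  assumes "local_at p a b"
  shows "(mult_z12 ^^ p) (comp123 a b c v) = (mult_z12 ^^ p) (swap (comp123 b a c v))"
proof -
  have ev: "(mult_z12 ^^ p) F c1 k1 c2 k2 c3 k3
      = (mult_z12 ^^ p) (coeffwise (coeffwise (\<lambda>f. f c3 k3)) F) c1 k1 c2 k2"
    for F :: "'w lseries2 lseries" and c1 k1 c2 k2 c3 k3
    by (subst mult_z12_pow_coeffwise2) (simp_all add: minus_apply coeffwise_def)
  have "coeffwise (coeffwise (\<lambda>f. f c3 k3)) (comp123 a b c v) = comp12 a b (c v c3 k3)"
    "coeffwise (coeffwise (\<lambda>f. f c3 k3)) (swap (comp123 b a c v)) = comp21 a b (c v c3 k3)" for c3 k3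
    by (simp_all add: coeffwise_def comp123_def comp12_def comp21_def swap_def)
  then show ?thesis
    by (intro ext) (simp only: ev local_atD[OF assms])
qed

lemma mult_z13_apply: "mult_z13 F c1 k1 c2 k2 c3 k3
    = mult_z12 (\<lambda>c1 k1 c3 k3. F c1 k1 c2 k2 c3 k3) c1 k1 c3 k3"
  by (simp add: mult_z13_def mult_z12_apply coeffwise_def zshift_def minus_apply)

lemma mult_z13_pow_apply: "(mult_z13 ^^ q) F c1 k1 c2 k2 c3 k3
    = (mult_z12 ^^ q) (\<lambda>c1 k1 c3 k3. F c1 k1 c2 k2 c3 k3) c1 k1 c3 k3"
proof (induction q arbitrary: F)
  case (Suc q)
  have "(mult_z13 ^^ Suc q) F c1 k1 c2 k2 c3 k3 = (mult_z13 ^^ q) (mult_z13 F) c1 k1 c2 k2 c3 k3"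
    by (simp add: funpow_swap1)
  also have "\<dots> = (mult_z12 ^^ q) (\<lambda>c1 k1 c3 k3. mult_z13 F c1 k1 c2 k2 c3 k3) c1 k1 c3 k3"
    by (rule Suc)
  also have "(\<lambda>c1 k1 c3 k3. mult_z13 F c1 k1 c2 k2 c3 k3)
      = mult_z12 (\<lambda>c1 k1 c3 k3. F c1 k1 c2 k2 c3 k3)"
    by (intro ext) (rule mult_z13_apply)
  finally show ?case by (simp add: funpow_swap1)
qed simp

text \<open>
  Locality of \<open>c\<close> and \<open>b\<close>, to which the coefficients of \<open>a(z\<^sub>2)\<close> are applied.
\<close>

lemma mult_z13_pow_comp:
  assumes a: "log_field a" and "local_at q c b"
  shows "(mult_z13 ^^ q) (\<lambda>c1 k1 c2 k2 c3 k3. a (c (b v c3 k3) c1 k1) c2 k2)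
    = (mult_z13 ^^ q) (\<lambda>c1 k1 c2 k2 c3 k3. a (b (c v c1 k1) c3 k3) c2 k2)"
proof (intro ext)
  fix c1 k1 c2 k2 c3 k3
  have 1: "(\<lambda>c1 k1 c3 k3. a (c (b v c3 k3) c1 k1) c2 k2)
      = coeffwise (coeffwise (\<lambda>u. a u c2 k2)) (comp12 c b v)"
    "(\<lambda>c1 k1 c3 k3. a (b (c v c1 k1) c3 k3) c2 k2)
      = coeffwise (coeffwise (\<lambda>u. a u c2 k2)) (comp21 c b v)"
    by (simp_all add: coeffwise_def comp12_def comp21_def)
  have 2: "(mult_z12 ^^ q) (coeffwise (coeffwise (\<lambda>u. a u c2 k2)) F)
      = coeffwise (coeffwise (\<lambda>u. a u c2 k2)) ((mult_z12 ^^ q) F)" for F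
    by (rule mult_z12_pow_coeffwise2) (simp add: log_field_diff[OF a] minus_apply)
  show "(mult_z13 ^^ q) (\<lambda>c1 k1 c2 k2 c3 k3. a (c (b v c3 k3) c1 k1) c2 k2) c1 k1 c2 k2 c3 k3
    = (mult_z13 ^^ q) (\<lambda>c1 k1 c2 k2 c3 k3. a (b (c v c1 k1) c3 k3) c2 k2) c1 k1 c2 k2 c3 k3"
    unfolding mult_z13_pow_apply 1 2 local_atD[OF assms(2)] ..
qed

lemma mult_z13_diff: "mult_z13 (F - G) = mult_z13 F - mult_z13 G"
  by (simp add: mult_z13_def pointwise zshift_def coeffwise_def)

lemma mult_z13_pow_diff: "(mult_z13 ^^ q) (F - G) = (mult_z13 ^^ q) F - (mult_z13 ^^ q) G"
  by (induction q) (simp_all add: mult_z13_diff)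

lemma mult_z12_z13_pow: "(mult_z12 ^^ p) ((mult_z13 ^^ q) K) = (mult_z13 ^^ q) ((mult_z12 ^^ p) K)"
  by (rule funpow_commute[where g = "mult_z13 ^^ q"],
      rule funpow_commute[where g = mult_z12, symmetric], rule mult_z12_z13[symmetric])

lemma coeffwise_pole_coeff_comp123:
  assumes "log_field a" "log_field b" "log_field c" "local_fields a b"
  shows "coeffwise_pole_coeff n (comp123 c a b v) = comp12 c (nth_prod s n a b) v"
proof -
  have "comp123 c a b v c1 k1 = coeffwise (coeffwise (\<lambda>u. c u c1 k1)) (comp12 a b v)" for c1 k1
    by (simp add: comp123_def comp12_def coeffwise_def)
  then show ?thesis
    unfolding coeffwise_def[of "pole_coeff n"]
    using pole_coeff_descends(2)[OF descends_linear[OF log_field_coeff_linear[OF assms(3)]]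
        finite_pole_comp12[OF assms(1,2,4)]]
    by (simp add: nth_prod_eq[OF assms(1,2,4)] comp12_def coeffwise_def)
qed

text \<open>
  Dong's lemma. Moving \<open>c(z\<^sub>1)\<close> to the right past \<open>a(z\<^sub>2)\<close> costs \<open>z\<^sub>1\<^sub>2\<^sup>p\<close> and past \<open>b(z\<^sub>3)\<close> costs
  \<open>z\<^sub>1\<^sub>3\<^sup>q\<close>. The second factor passes through the expansion along \<open>z\<^sub>2 = z\<^sub>3\<close>, and the vanishing lemma
  above takes care of the first.
\<close>

lemma local_nth_prod:
  assumes a: "log_field a" and b: "log_field b" and c: "log_field c"
    and ab: "local_fields a b" and ca: "local_fields c a" and cb: "local_fields c b"
  shows "local_fields c (nth_prod s n a b)"
proof -
  obtain N p q where N: "local_at N a b" and p: "local_at p c a" and q: "local_at q c b"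
    using ab ca cb unfolding local_fields_def by blast
  have "(mult_z12 ^^ (p + nat (int N - n) + q)) (comp12 c (nth_prod s n a b) v)
      = (mult_z12 ^^ (p + nat (int N - n) + q)) (comp21 c (nth_prod s n a b) v)" for v
  proof -
    define P where "P = comp123 c a b v"
    define Q where "Q = (\<lambda>c1 k1 c2 k2 c3 k3. a (b (c v c1 k1) c3 k3) c2 k2)"
    have rP: "restrictable ((mult_z12 ^^ N) (P c1 k1))" for c1 k1
    proof -
      have "P c1 k1 = coeffwise (coeffwise (\<lambda>u. c u c1 k1)) (comp12 a b v)"
        by (simp add: P_def comp123_def comp12_def coeffwise_def)
      then have "(mult_z12 ^^ N) (P c1 k1)
          = coeffwise (coeffwise (\<lambda>u. c u c1 k1)) ((mult_z12 ^^ N) (comp12 a b v))"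
        by (simp add: mult_z12_pow_coeffwise2 log_field_diff[OF c] minus_apply)
      moreover have "restrictable (coeffwise (coeffwise (\<lambda>u. c u c1 k1)) ((mult_z12 ^^ N) (comp12 a b v)))"
        by (rule restrictable_support[OF restrictable_comp12[OF a b N, of v]])
          (use log_field_zero[OF c] in \<open>auto simp: coeffwise_def zero_fun_apply\<close>)
      ultimately show ?thesis by simp
    qed
    have Qc: "Q c1 k1 = comp12 a b (c v c1 k1)" for c1 k1
      by (simp add: Q_def comp12_def)
    have rQ: "restrictable ((mult_z12 ^^ N) (Q c1 k1))" for c1 k1
      unfolding Qc by (rule restrictable_comp12[OF a b N])
    have rPQ: "restrictable ((mult_z12 ^^ N) ((P - Q) c1 k1))" for c1 k1
      by (simp add: minus_apply mult_z12_pow_diff restrictable_diff rP rQ)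
    have fP: "finite_pole (P c1 k1)" and fQ: "finite_pole (Q c1 k1)"
      and fPQ: "finite_pole ((P - Q) c1 k1)" for c1 k1
      by (rule finite_poleI, rule rP rQ rPQ)+
    have zero: "(mult_z12 ^^ p) ((mult_z13 ^^ q) (P - Q)) = 0"
    proof -
      \<comment> \<open>the intermediate order \<open>a(z\<^sub>2)c(z\<^sub>1)b(z\<^sub>3)v\<close>\<close>
      define P' where "P' = (\<lambda>c1 k1 c2 k2 c3 k3. a (c (b v c3 k3) c1 k1) c2 k2)"
      have P': "P' = swap (comp123 a c b v)" by (simp add: P'_def comp123_def swap_def)
      have "(mult_z12 ^^ p) ((mult_z13 ^^ q) (P - Q))
          = (mult_z13 ^^ q) ((mult_z12 ^^ p) P) - (mult_z12 ^^ p) ((mult_z13 ^^ q) Q)"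
        by (simp add: mult_z13_pow_diff mult_z12_pow_diff mult_z12_z13_pow)
      also have "(mult_z12 ^^ p) P = (mult_z12 ^^ p) P'"
        unfolding P_def P' by (rule mult_z12_pow_comp123[OF p])
      also have "(mult_z13 ^^ q) Q = (mult_z13 ^^ q) P'"
        unfolding P'_def Q_def by (rule mult_z13_pow_comp[OF a q, symmetric])
      finally show ?thesis by (simp add: mult_z12_z13_pow)
    qed
    have "(mult_z12 ^^ (p + nat (int N - n))) (coeffwise_pole_coeff n ((mult_z13 ^^ q) (P - Q))) = 0"
      by (rule coeffwise_pole_coeff_vanishes[OF restrictable_mult_z13_pow[OF rPQ] zero])
    then have "(mult_z12 ^^ (p + nat (int N - n) + q)) (coeffwise_pole_coeff n (P - Q)) = 0"
      by (simp add: funpow_add mult_z13_pow(1)[OF fPQ])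
    moreover have "coeffwise_pole_coeff n (P - Q) = coeffwise_pole_coeff n P - coeffwise_pole_coeff n Q"
      by (intro ext) (simp add: coeffwise_def minus_apply pole_coeff_diff(2)[OF fP fQ])
    moreover have "coeffwise_pole_coeff n P = comp12 c (nth_prod s n a b) v"
      unfolding P_def by (rule coeffwise_pole_coeff_comp123[OF a b c ab])
    moreover have "coeffwise_pole_coeff n Q = comp21 c (nth_prod s n a b) v"
      by (simp add: coeffwise_def Qc comp21_def nth_prod_eq[OF a b ab])
    ultimately show ?thesis by (simp add: mult_z12_pow_diff)
  qed
  then show ?thesis unfolding local_fields_def local_at_def by blast
qed


section \<open>Symmetric double expansions\<close>

definition mult_z23 :: "'w lseries2 lseries \<Rightarrow> 'w lseries2 lseries" where
  "mult_z23 = coeffwise mult_z12"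

text \<open>
  The coefficient of \<open>x\<^sup>-\<^sup>i\<^sup>-\<^sup>1 y\<^sup>-\<^sup>j\<^sup>-\<^sup>1\<close> in the expansion of \<open>K\<close> in powers of \<open>y = z\<^sub>2\<^sub>3\<close> and then of
  \<open>x = z\<^sub>1\<^sub>3\<close>.
\<close>

abbreviation "double_coeff i j K \<equiv> pole_coeff i (coeffwise_pole_coeff j K)"

definition double_expandable :: "'w lseries2 lseries \<Rightarrow> bool" where
  "double_expandable K \<longleftrightarrow>
     (\<forall>c k. finite_pole (K c k)) \<and> (\<forall>j. finite_pole (coeffwise_pole_coeff j K))"

text \<open>
  The operator \<open>x - y\<close> on the double expansion is \<open>z\<^sub>1\<^sub>3 - z\<^sub>2\<^sub>3 = z\<^sub>1\<^sub>2\<close>.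
\<close>

lemma double_coeff_mult_z12:
  assumes "double_expandable K"
  shows "double_expandable (mult_z12 K)"
    and "double_coeff i j (mult_z12 K) = double_coeff (i + 1) j K - double_coeff i (j + 1) K"
proof -
  have K: "\<And>c k. finite_pole (K c k)" "\<And>j. finite_pole (coeffwise_pole_coeff j K)"
    using assms by (simp_all add: double_expandable_def)
  have eq: "coeffwise_pole_coeff j (mult_z12 K)
      = mult_z12 (coeffwise_pole_coeff j K) - coeffwise_pole_coeff (j + 1) K" for j
    using mult_z12_coeffwise_pole_coeff(3)[OF K(1), of j] by simp
  show "double_expandable (mult_z12 K)"
    unfolding double_expandable_def eq
    by (intro conjI allI mult_z12_coeffwise_pole_coeff(4)[OF K(1)] pole_coeff_diff(1)
        pole_coeff_mult_z12(1) K(2))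
  show "double_coeff i j (mult_z12 K) = double_coeff (i + 1) j K - double_coeff i (j + 1) K"
    unfolding eq by (simp add: pole_coeff_diff(2) pole_coeff_mult_z12 K)
qed

lemma double_coeff_minus:
  assumes "double_expandable K"
  shows "double_expandable (- K)" "double_coeff i j (- K) = - double_coeff i j K"
proof -
  have K: "\<And>c k. finite_pole (K c k)" "\<And>j. finite_pole (coeffwise_pole_coeff j K)"
    using assms by (simp_all add: double_expandable_def)
  have eq: "coeffwise_pole_coeff j (- K) = - coeffwise_pole_coeff j K" for j
    by (intro ext) (simp add: coeffwise_def uminus_apply pole_coeff_minus(2)[OF K(1)])
  show "double_expandable (- K)"
    unfolding double_expandable_def eq
    by (intro conjI allI, subst uminus_apply, subst uminus_apply) (intro pole_coeff_minus(1) K)+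
  show "double_coeff i j (- K) = - double_coeff i j K"
    unfolding eq by (rule pole_coeff_minus(2)[OF K(2)])
qed

lemma mult_xy_double_coeff:
  assumes "double_expandable K"
  shows "(mult_xy ^^ n) (\<lambda>i j. double_coeff (- i - 1) (- j - 1) K v)
    = (\<lambda>i j. double_coeff (- i - 1) (- j - 1) ((mult_z12 ^^ n) K) v)"
  using assms
proof (induction n arbitrary: K)
  case (Suc n)
  have "mult_xy (\<lambda>i j. double_coeff (- i - 1) (- j - 1) K v)
      = (\<lambda>i j. double_coeff (- i - 1) (- j - 1) (mult_z12 K) v)"
    by (intro ext) (simp add: mult_xy_def double_coeff_mult_z12(2)[OF Suc.prems] minus_apply)
  then show ?case
    using Suc.IH[OF double_coeff_mult_z12(1)[OF Suc.prems]] by (simp add: funpow_swap1)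
qed simp

text \<open>
  The counterpart for the expansion in the opposite order. Exchanging the variables changes the sign
  of both \<open>x - y\<close> and \<open>z\<^sub>1\<^sub>2\<close>, and the two signs cancel.
\<close>

lemma mult_xy_double_coeff_swap:
  assumes "double_expandable (swap K)"
  shows "(mult_xy ^^ n) (\<lambda>i j. double_coeff (- j - 1) (- i - 1) (swap K) v)
    = (\<lambda>i j. double_coeff (- j - 1) (- i - 1) (swap ((mult_z12 ^^ n) K)) v)"
    and "double_expandable (swap ((mult_z12 ^^ n) K))"
  using assms
proof (induction n arbitrary: K)
  case (Suc n)
  {
    case 1
    have eq: "swap (mult_z12 K) = - mult_z12 (swap K)" by (simp add: mult_z12_swap)
    have ex: "double_expandable (swap (mult_z12 K))"
      unfolding eq by (intro double_coeff_minus double_coeff_mult_z12 1)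
    have "mult_xy (\<lambda>i j. double_coeff (- j - 1) (- i - 1) (swap K) v)
        = (\<lambda>i j. double_coeff (- j - 1) (- i - 1) (swap (mult_z12 K)) v)"
      unfolding eq
      by (intro ext) (simp add: mult_xy_def double_coeff_minus(2)[OF double_coeff_mult_z12(1)[OF 1]]
          double_coeff_mult_z12(2)[OF 1] minus_apply uminus_apply)
    then show ?case using Suc(1)[OF ex] by (simp add: funpow_swap1)
  next
    case 2
    have eq: "swap (mult_z12 K) = - mult_z12 (swap K)" by (simp add: mult_z12_swap)
    have ex: "double_expandable (swap (mult_z12 K))"
      unfolding eq by (intro double_coeff_minus double_coeff_mult_z12 2)
    then show ?case using Suc(2)[OF ex] by (simp add: funpow_swap1)
  }
qed simp_all

definition restrictable3 :: "'w lseries2 lseries \<Rightarrow> bool" where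
  "restrictable3 F \<longleftrightarrow>
     (\<forall>c. finite {(c1, k1, c2, k2, c3, k3). c1 + c2 + c3 = c \<and> F c1 k1 c2 k2 c3 k3 \<noteq> 0})"

lemma restrictable3_shift:
  assumes "restrictable3 F"
    and "\<And>c1 k1 c2 k2 c3 k3. G c1 k1 c2 k2 c3 k3 \<noteq> 0 \<Longrightarrow>
      F (c1 + d1) (k1 + j1) (c2 + d2) (k2 + j2) c3 k3 \<noteq> 0"
  shows "restrictable3 G"
  unfolding restrictable3_def
proof
  fix c
  let ?h = "\<lambda>(c1, k1, c2, k2, c3, k3). (c1 + d1, k1 + j1, c2 + d2, k2 + j2, c3, k3)"
  let ?S = "{(c1, k1, c2, k2, c3, k3). c1 + c2 + c3 = c + d1 + d2 \<and> F c1 k1 c2 k2 c3 k3 \<noteq> 0}"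
  have "finite ?S" using assms(1) by (simp add: restrictable3_def)
  moreover have "inj ?h" by (auto simp: inj_on_def)
  ultimately have "finite (?h -` ?S)" by (rule finite_vimageI)
  then show "finite {(c1, k1, c2, k2, c3, k3). c1 + c2 + c3 = c \<and> G c1 k1 c2 k2 c3 k3 \<noteq> 0}"
    by (rule rev_finite_subset) (auto dest: assms(2))
qed

lemma restrictable3_union:
  assumes "restrictable3 F" "restrictable3 G"
    and "\<And>c1 k1 c2 k2 c3 k3. H c1 k1 c2 k2 c3 k3 \<noteq> 0 \<Longrightarrow>
      F c1 k1 c2 k2 c3 k3 \<noteq> 0 \<or> G c1 k1 c2 k2 c3 k3 \<noteq> 0"
  shows "restrictable3 H"
  unfolding restrictable3_def
proof
  fix c
  have "finite ({(c1, k1, c2, k2, c3, k3). c1 + c2 + c3 = c \<and> F c1 k1 c2 k2 c3 k3 \<noteq> 0} \<union>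
      {(c1, k1, c2, k2, c3, k3). c1 + c2 + c3 = c \<and> G c1 k1 c2 k2 c3 k3 \<noteq> 0})"
    using assms(1,2) by (simp add: restrictable3_def)
  then show "finite {(c1, k1, c2, k2, c3, k3). c1 + c2 + c3 = c \<and> H c1 k1 c2 k2 c3 k3 \<noteq> 0}"
    by (rule rev_finite_subset) (use assms(3) in blast)
qed

lemma restrictable3_swap:
  assumes "restrictable3 F"
  shows "restrictable3 (swap F)"
  unfolding restrictable3_def
proof
  fix c
  let ?h = "\<lambda>(c1, k1, c2, k2, c3, k3). (c2 :: complex, k2 :: nat, c1 :: complex, k1 :: nat, c3, k3)"
  let ?S = "{(c1, k1, c2, k2, c3, k3). c1 + c2 + c3 = c \<and> F c1 k1 c2 k2 c3 k3 \<noteq> 0}"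
  have "finite ?S" using assms(1) by (simp add: restrictable3_def)
  then have "finite (?h ` ?S)" by (rule finite_imageI)
  then show "finite {(c1, k1, c2, k2, c3, k3). c1 + c2 + c3 = c \<and> swap F c1 k1 c2 k2 c3 k3 \<noteq> 0}"
    by (rule rev_finite_subset) (auto simp: swap_def image_iff add.commute)
qed

abbreviation "scale3 \<equiv> series_scale (series_scale (series_scale s))"
abbreviation "D1_of3 \<equiv> D_z (series_scale (series_scale s))"
abbreviation "D2_of3 \<equiv> coeffwise D1"

lemma D1_of3_apply:
  "D1_of3 F c1 k1 c2 k2 c3 k3 = s (c1 + 1) (F (c1 + 1) k1 c2 k2 c3 k3)
     + s (of_nat (k1 + 1)) (F (c1 + 1) (k1 + 1) c2 k2 c3 k3)"
  by (simp add: D_z_apply pscale_def pointwise)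

lemma D2_of3_apply:
  "D2_of3 F c1 k1 c2 k2 c3 k3 = s (c2 + 1) (F c1 k1 (c2 + 1) k2 c3 k3)
     + s (of_nat (k2 + 1)) (F c1 k1 (c2 + 1) (k2 + 1) c3 k3)"
  by (simp add: coeffwise_def D1_apply)

lemma restrictable3_D1:
  assumes F: "restrictable3 F"
  shows "restrictable3 (D1_of3 F)"
proof (rule restrictable3_union)
  show "restrictable3 (\<lambda>c1 k1 c2 k2 c3 k3. F (c1 + 1) k1 c2 k2 c3 k3)"
    by (rule restrictable3_shift[OF F, of _ 1 0 0 0]) simp
  show "restrictable3 (\<lambda>c1 k1 c2 k2 c3 k3. F (c1 + 1) (k1 + 1) c2 k2 c3 k3)"
    by (rule restrictable3_shift[OF F, of _ 1 1 0 0]) simp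
  show "F (c1 + 1) k1 c2 k2 c3 k3 \<noteq> 0 \<or> F (c1 + 1) (k1 + 1) c2 k2 c3 k3 \<noteq> 0"
    if "D1_of3 F c1 k1 c2 k2 c3 k3 \<noteq> 0" for c1 k1 c2 k2 c3 k3
    using that unfolding D1_of3_apply by fastforce
qed

lemma restrictable3_D2:
  assumes F: "restrictable3 F"
  shows "restrictable3 (D2_of3 F)"
proof (rule restrictable3_union)
  show "restrictable3 (\<lambda>c1 k1 c2 k2 c3 k3. F c1 k1 (c2 + 1) k2 c3 k3)"
    by (rule restrictable3_shift[OF F, of _ 0 0 1 0]) simp
  show "restrictable3 (\<lambda>c1 k1 c2 k2 c3 k3. F c1 k1 (c2 + 1) (k2 + 1) c3 k3)"
    by (rule restrictable3_shift[OF F, of _ 0 0 1 1]) simp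
  show "F c1 k1 (c2 + 1) k2 c3 k3 \<noteq> 0 \<or> F c1 k1 (c2 + 1) (k2 + 1) c3 k3 \<noteq> 0"
    if "D2_of3 F c1 k1 c2 k2 c3 k3 \<noteq> 0" for c1 k1 c2 k2 c3 k3
    using that unfolding D2_of3_apply by fastforce
qed

lemma restrictable3_scale: "restrictable3 F \<Longrightarrow> restrictable3 (scale3 t F)"
  by (rule restrictable3_union[of F F]) (auto simp: pscale_def)

lemma restrictable3_D1_pow: "restrictable3 F \<Longrightarrow> restrictable3 ((D1_of3 ^^ n) F)"
  by (induction n) (simp_all add: restrictable3_D1)

lemma restrictable3_D2_pow: "restrictable3 F \<Longrightarrow> restrictable3 ((D2_of3 ^^ n) F)"
  by (induction n) (simp_all add: restrictable3_D2)

lemma restrictable3_coeffwise: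
  assumes "restrictable3 F"
  shows "restrictable (F c k)"
  unfolding restrictable_def
proof
  fix d
  let ?S = "{(c1, k1, c2, k2, c3, k3). c1 + c2 + c3 = c + d \<and> F c1 k1 c2 k2 c3 k3 \<noteq> 0}"
  have "{(c2, k2, c3, k3). c2 + c3 = d \<and> F c k c2 k2 c3 k3 \<noteq> 0}
      \<subseteq> (\<lambda>(c1, k1, c2, k2, c3, k3). (c2, k2, c3, k3)) ` ?S"
    by (force simp: image_iff add.assoc)
  moreover have "finite ?S" using assms by (simp add: restrictable3_def)
  ultimately show "finite {(c2, k2, c3, k3). c2 + c3 = d \<and> F c k c2 k2 c3 k3 \<noteq> 0}"
    by (meson finite_imageI finite_subset)
qed

lemma restrictable_coeffwise_diag:
  assumes "restrictable3 F"
  shows "restrictable (coeffwise diag F)"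
  unfolding restrictable_def
proof
  fix c
  let ?S = "{(c1, k1, c2, k2, c3, k3). c1 + c2 + c3 = c \<and> F c1 k1 c2 k2 c3 k3 \<noteq> 0}"
  have "{(c1, k1, c2, k2). c1 + c2 = c \<and> coeffwise diag F c1 k1 c2 k2 \<noteq> 0}
      \<subseteq> (\<lambda>(c1, k1, c2, k2, c3, k3). (c1, k1, c2 + c3, k2 + k3)) ` ?S"
  proof clarify
    fix c1 k1 c2 k2
    assume "coeffwise diag F c1 k1 c2 k2 \<noteq> 0" "c = c1 + c2"
    then obtain c2' k2' c3 k3 where "c2' + c3 = c2" "k2' + k3 = k2" "F c1 k1 c2' k2' c3 k3 \<noteq> 0"
      using diag_support[of "F c1 k1" c2 k2] by (auto simp: coeffwise_def)
    then show "(c1, k1, c2, k2) \<in> (\<lambda>(c1, k1, c2, k2, c3, k3). (c1, k1, c2 + c3, k2 + k3)) `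
        {(c1', k1, c2', k2, c3, k3). c1' + c2' + c3 = c1 + c2 \<and> F c1' k1 c2' k2 c3 k3 \<noteq> 0}"
      by (intro image_eqI[where x = "(c1, k1, c2', k2', c3, k3)"]) (auto simp: add.assoc)
  qed
  moreover have "finite ?S" using assms by (simp add: restrictable3_def)
  ultimately show "finite {(c1, k1, c2, k2). c1 + c2 = c \<and> coeffwise diag F c1 k1 c2 k2 \<noteq> 0}"
    by (meson finite_imageI finite_subset)
qed

text \<open>
  Restricting to \<open>z\<^sub>2 = z\<^sub>3\<close> and then to \<open>z\<^sub>1 = z\<^sub>3\<close> groups the terms of the simultaneous restriction
  by their exponents in \<open>z\<^sub>1, \<zeta>\<^sub>1\<close>.
\<close>

lemma diag_coeffwise_diag:
  assumes F: "restrictable3 F"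
  shows "diag (coeffwise diag F) c k
    = (\<Sum>(c1, k1, c2, k2, c3, k3)\<in>{(c1, k1, c2, k2, c3, k3). c1 + c2 + c3 = c \<and> k1 + k2 + k3 = k
        \<and> F c1 k1 c2 k2 c3 k3 \<noteq> 0}. F c1 k1 c2 k2 c3 k3)"
proof -
  let ?S = "{(c1, k1, c2, k2, c3, k3). c1 + c2 + c3 = c \<and> k1 + k2 + k3 = k
        \<and> F c1 k1 c2 k2 c3 k3 \<noteq> 0}"
  let ?g = "\<lambda>(c1 :: complex, k1 :: nat, c2 :: complex, k2 :: nat, c3, k3). (c1, k1, c2 + c3, k2 + k3)"
  let ?f = "\<lambda>(c1, k1, c2, k2, c3, k3). F c1 k1 c2 k2 c3 k3"
  have "finite {(c1, k1, c2, k2, c3, k3). c1 + c2 + c3 = c \<and> F c1 k1 c2 k2 c3 k3 \<noteq> 0}"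
    using F by (simp add: restrictable3_def)
  then have fin: "finite ?S" by (rule rev_finite_subset) auto
  have "diag (coeffwise diag F) c k = (\<Sum>(c1, k1, c2, k2)\<in>?g ` ?S. coeffwise diag F c1 k1 c2 k2)"
  proof (rule diag_eq_sum)
    show "finite (?g ` ?S)" using fin by (rule finite_imageI)
    show "?g ` ?S \<subseteq> {(c1, k1, c2, k2). c1 + c2 = c \<and> k1 + k2 = k}"
      by (auto simp: add.assoc)
    show "{(c1, k1, c2, k2). c1 + c2 = c \<and> k1 + k2 = k \<and> coeffwise diag F c1 k1 c2 k2 \<noteq> 0} \<subseteq> ?g ` ?S"
    proof clarify
      fix c1 k1 c2 k2
      assume "coeffwise diag F c1 k1 c2 k2 \<noteq> 0"
      then obtain c2' k2' c3 k3 where "c2' + c3 = c2" "k2' + k3 = k2" "F c1 k1 c2' k2' c3 k3 \<noteq> 0"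
        using diag_support[of "F c1 k1" c2 k2] by (auto simp: coeffwise_def)
      then show "(c1, k1, c2, k2) \<in> ?g ` {(c1', k1', c2', k2', c3, k3). c1' + c2' + c3 = c1 + c2
          \<and> k1' + k2' + k3 = k1 + k2 \<and> F c1' k1' c2' k2' c3 k3 \<noteq> 0}"
        by (intro image_eqI[where x = "(c1, k1, c2', k2', c3, k3)"]) (auto simp: add.assoc)
    qed
  qed
  also have "\<dots> = (\<Sum>y\<in>?g ` ?S. \<Sum>x\<in>{x\<in>?S. ?g x = y}. ?f x)"
  proof (rule sum.cong[OF refl])
    fix y
    assume y: "y \<in> ?g ` ?S"
    obtain c1 k1 c' k' where y': "y = (c1, k1, c', k')" by (cases y)
    have ck: "c1 + c' = c" "k1 + k' = k" using y unfolding y' by (auto simp: add.assoc)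
    have "diag (F c1 k1) c' k' = (\<Sum>x\<in>{x\<in>?S. ?g x = y}. ?f x)"
      unfolding diag_def
      by (rule sum.reindex_bij_witness[where
            i = "\<lambda>(_, _, c2, k2, c3, k3). (c2, k2, c3, k3)" and
            j = "\<lambda>(c2, k2, c3, k3). (c1, k1, c2, k2, c3, k3)"])
        (use ck in \<open>auto simp: y' add.assoc\<close>)
    then show "(case y of (c1, k1, c2, k2) \<Rightarrow> coeffwise diag F c1 k1 c2 k2)
        = (\<Sum>x\<in>{x\<in>?S. ?g x = y}. ?f x)"
      by (simp add: y' coeffwise_def)
  qed
  also have "\<dots> = sum ?f ?S"
    by (rule sum.group[OF fin]) (use fin in auto)
  finally show ?thesis .
qed

lemma diag_coeffwise_diag_swap:
  assumes "restrictable3 F"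
  shows "diag (coeffwise diag (swap F)) = diag (coeffwise diag F)"
proof (intro ext)
  fix c k
  show "diag (coeffwise diag (swap F)) c k = diag (coeffwise diag F) c k"
    unfolding diag_coeffwise_diag[OF assms] diag_coeffwise_diag[OF restrictable3_swap[OF assms]]
    by (rule sum.reindex_bij_witness[where
          i = "\<lambda>(c1, k1, c2, k2, c3, k3). (c2, k2, c1, k1, c3, k3)" and
          j = "\<lambda>(c1, k1, c2, k2, c3, k3). (c2, k2, c1, k1, c3, k3)"])
      (auto simp: swap_def add.commute)
qed

lemma D1_pow_coeffwise_diag:
  assumes "restrictable3 H"
  shows "(D1 ^^ p) (coeffwise diag H) = coeffwise diag ((D1_of3 ^^ p) H)"
  using assms
proof (induction p arbitrary: H)
  case (Suc p)
  have r: "restrictable (H c k)" for c k using Suc.prems by (rule restrictable3_coeffwise)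
  have H: "D1_of3 H c1 k1 = series_scale (series_scale s) (c1 + 1) (H (c1 + 1) k1)
      + series_scale (series_scale s) (of_nat (k1 + 1)) (H (c1 + 1) (k1 + 1))" for c1 k1
    by (intro ext) (simp add: D1_of3_apply pscale_def plus_fun_apply)
  have "D1 (coeffwise diag H) c1 k1 c k = coeffwise diag (D1_of3 H) c1 k1 c k" for c1 k1 c k
  proof -
    have "coeffwise diag (D1_of3 H) c1 k1
        = series_scale s (c1 + 1) (diag (H (c1 + 1) k1))
          + series_scale s (of_nat (k1 + 1)) (diag (H (c1 + 1) (k1 + 1)))"
      unfolding coeffwise_def H by (simp only: diag_add diag_scale restrictable_scale r)
    then show ?thesis by (simp add: D1_apply pscale_def plus_fun_apply) (simp add: coeffwise_def)
  qed
  then have "D1 (coeffwise diag H) = coeffwise diag (D1_of3 H)" by (intro ext)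
  then show ?case
    using Suc.IH[OF restrictable3_D1[OF Suc.prems]] by (simp add: funpow_swap1)
qed simp

text \<open>
  Once powers of \<open>z\<^sub>1\<^sub>3\<close> and \<open>z\<^sub>2\<^sub>3\<close> have removed the poles, the double coefficient is a derivative
  restricted to \<open>z\<^sub>1 = z\<^sub>2 = z\<^sub>3\<close>, a formula in which the first two variables play symmetric parts.
\<close>

lemma double_coeff_eq:
  assumes K: "\<And>c k. finite_pole (K c k)"
    and F: "restrictable3 ((mult_z23 ^^ N) ((mult_z13 ^^ N) K))"
  shows "double_coeff i j K = (if i \<le> int N - 1 \<and> j \<le> int N - 1
    then diag (coeffwise diag (scale3 (1 / fact (nat (int N - 1 - i)) / fact (nat (int N - 1 - j)))
      ((D1_of3 ^^ nat (int N - 1 - i)) ((D2_of3 ^^ nat (int N - 1 - j))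
        ((mult_z23 ^^ N) ((mult_z13 ^^ N) K)))))) else 0)"
proof -
  define p where "p = nat (int N - 1 - i)"
  define q where "q = nat (int N - 1 - j)"
  define F where "F = (mult_z23 ^^ N) ((mult_z13 ^^ N) K)"
  have F3: "restrictable3 F" using F by (simp add: F_def)
  have coeffwise_pow: "(coeffwise P ^^ n) G = coeffwise (P ^^ n) G" for P :: "'w lseries2 \<Rightarrow> 'w lseries2" and n G
    by (induction n) (simp_all add: coeffwise_def)
  have Fck: "F c k = (mult_z12 ^^ N) ((mult_z13 ^^ N) K c k)" for c k
    unfolding F_def mult_z23_def coeffwise_pow by (simp add: coeffwise_def)
  have r: "restrictable ((mult_z12 ^^ N) ((mult_z13 ^^ N) K c k))" for c k
    using restrictable3_coeffwise[OF F3, of c k] by (simp add: Fck)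
  have M: "(mult_z12 ^^ N) (coeffwise_pole_coeff j K)
      = coeffwise (pole_coeff_at N j) ((mult_z13 ^^ N) K)"
    unfolding mult_z13_pow(1)[OF K] by (simp add: coeffwise_def pole_coeff_eq[OF r])
  show ?thesis
  proof (cases "j \<le> int N - 1")
    case False
    then have "coeffwise (pole_coeff_at N j) ((mult_z13 ^^ N) K) = 0"
      by (intro ext) (simp add: coeffwise_def pole_coeff_at_def zero_fun_apply)
    then have M0: "(mult_z12 ^^ N) (coeffwise_pole_coeff j K) = 0" using M by simp
    have "D1_divpow m 0 = 0" for m using D1_divpow_add[of m 0 0] by simp
    then show ?thesis
      using False pole_coeff_eq[of N "coeffwise_pole_coeff j K" i] by (simp add: M0 pole_coeff_at_def)
  next
    case True
    define H where "H = scale3 (1 / fact q) ((D2_of3 ^^ q) F)"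
    have H3: "restrictable3 H"
      unfolding H_def by (intro restrictable3_scale restrictable3_D2_pow F3)
    have "H c k = D1_divpow q (F c k)" for c k
      unfolding H_def coeffwise_pow by (simp add: coeffwise_def D1_divpow_apply pscale_def)
    then have MH: "(mult_z12 ^^ N) (coeffwise_pole_coeff j K) = coeffwise diag H"
      unfolding M using True by (simp add: coeffwise_def pole_coeff_at_def Fck q_def)
    have "restrictable ((mult_z12 ^^ N) (coeffwise_pole_coeff j K))"
      unfolding MH by (rule restrictable_coeffwise_diag[OF H3])
    then have "double_coeff i j K = pole_coeff_at N i (coeffwise_pole_coeff j K)" by (rule pole_coeff_eq)
    also have "\<dots> = (if i \<le> int N - 1 then diag (D1_divpow p (coeffwise diag H)) else 0)"
      by (simp add: pole_coeff_at_def MH p_def)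
    also have "D1_divpow p (coeffwise diag H)
        = coeffwise diag (scale3 (1 / fact p) ((D1_of3 ^^ p) H))"
    proof -
      have "diag (series_scale (series_scale s) t ((D1_of3 ^^ p) H c k))
          = series_scale s t (diag ((D1_of3 ^^ p) H c k))" for t c k
        by (rule diag_scale) (intro restrictable3_coeffwise restrictable3_D1_pow H3)
      then show ?thesis
        unfolding D1_divpow_apply D1_pow_coeffwise_diag[OF H3]
        by (simp add: coeffwise_def) (simp add: pscale_def)
    qed
    also have "scale3 (1 / fact p) ((D1_of3 ^^ p) H)
        = scale3 (1 / fact p / fact q) ((D1_of3 ^^ p) ((D2_of3 ^^ q) F))"
    proof -
      have "(D1_of3 ^^ p) (scale3 t G) = scale3 t ((D1_of3 ^^ p) G)" for t G
        by (rule funpow_commute[where g = "scale3 t"], intro ext)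
          (simp add: D1_of3_apply[of "scale3 t _"] pscale_def scale_right_distrib mult.commute D1_of3_apply)
      then show ?thesis unfolding H_def by (simp add: pscale_def)
    qed
    finally show ?thesis using True by (simp add: p_def q_def F_def)
  qed
qed

lemma double_coeff_swap:
  assumes K: "\<And>c k. finite_pole (K c k)" and K': "\<And>c k. finite_pole (swap K c k)"
    and F: "restrictable3 ((mult_z23 ^^ N) ((mult_z13 ^^ N) K))"
  shows "double_coeff j i (swap K) = double_coeff i j K"
proof -
  define F where "F = (mult_z23 ^^ N) ((mult_z13 ^^ N) K)"
  have F3: "restrictable3 F" using F by (simp add: F_def)
  have s13: "mult_z13 (swap G) = swap (mult_z23 G)" and s23: "mult_z23 (swap G) = swap (mult_z13 G)"
    for G :: "'w lseries2 lseries"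
    by (intro ext; simp add: swap_def mult_z13_def mult_z23_def coeffwise_def mult_z12_apply zshift_def
        minus_apply; fail)+
  have sD1: "D1_of3 (swap G) = swap (D2_of3 G)" and sD2: "D2_of3 (swap G) = swap (D1_of3 G)"
    for G :: "'w lseries2 lseries"
    by (intro ext; simp add: D1_of3_apply D2_of3_apply swap_def D1_apply coeffwise_def; fail)+
  have c13: "mult_z13 (mult_z23 G) = mult_z23 (mult_z13 G)" for G :: "'w lseries2 lseries"
    by (intro ext) (simp add: mult_z13_def mult_z23_def coeffwise_def mult_z12_apply zshift_def
        minus_apply algebra_simps)
  have cD: "D1_of3 (D2_of3 G) = D2_of3 (D1_of3 G)" for G :: "'w lseries2 lseries"
    by (intro ext) (simp add: D1_of3_apply D2_of3_apply scale_right_distrib mult.commute)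
  have "(mult_z23 ^^ N) ((mult_z13 ^^ N) (swap K)) = (mult_z23 ^^ N) (swap ((mult_z23 ^^ N) K))"
    by (subst funpow_commute[where g = swap and f' = mult_z23]) (simp_all add: s13)
  also have "\<dots> = swap ((mult_z13 ^^ N) ((mult_z23 ^^ N) K))"
    by (rule funpow_commute[where g = swap]) (rule s23)
  also have "(mult_z13 ^^ N) ((mult_z23 ^^ N) K) = F"
    unfolding F_def
    by (rule funpow_commute[where g = "mult_z23 ^^ N"],
        rule funpow_commute[where g = mult_z13, symmetric], rule c13[symmetric])
  finally have F': "(mult_z23 ^^ N) ((mult_z13 ^^ N) (swap K)) = swap F" .
  have D: "(D1_of3 ^^ q) ((D2_of3 ^^ p) (swap F)) = swap ((D1_of3 ^^ p) ((D2_of3 ^^ q) F))" for p q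
  proof -
    have "(D1_of3 ^^ q) ((D2_of3 ^^ p) (swap F)) = (D1_of3 ^^ q) (swap ((D1_of3 ^^ p) F))"
      by (subst funpow_commute[where g = swap and f' = D1_of3]) (simp_all add: sD2)
    also have "\<dots> = swap ((D2_of3 ^^ q) ((D1_of3 ^^ p) F))"
      by (rule funpow_commute[where g = swap]) (rule sD1)
    also have "(D2_of3 ^^ q) ((D1_of3 ^^ p) F) = (D1_of3 ^^ p) ((D2_of3 ^^ q) F)"
      by (rule funpow_commute[where g = "D1_of3 ^^ p"],
          rule funpow_commute[where g = D2_of3, symmetric], rule cD)
    finally show ?thesis .
  qed
  have sc: "scale3 t (swap G) = swap (scale3 t G)" for t G
    by (simp add: swap_def pscale_def)
  have F'3: "restrictable3 ((mult_z23 ^^ N) ((mult_z13 ^^ N) (swap K)))"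
    unfolding F' by (rule restrictable3_swap[OF F3])
  have sw: "diag (coeffwise diag (swap (scale3 t ((D1_of3 ^^ p) ((D2_of3 ^^ q) F)))))
      = diag (coeffwise diag (scale3 t ((D1_of3 ^^ p) ((D2_of3 ^^ q) F))))" for t p q
    by (intro diag_coeffwise_diag_swap restrictable3_scale restrictable3_D1_pow restrictable3_D2_pow F3)
  show ?thesis
    unfolding double_coeff_eq[OF K F] double_coeff_eq[OF K' F'3] F' D sc sw F_def[symmetric]
    by (simp add: mult.commute)
qed


section \<open>The commutant of a set of fields\<close>

text \<open>
  Fields local to all members of \<open>S\<close>. Locality replaces commutation, and Dong's lemma replaces the
  closure of a commutant under multiplication.
\<close>

definition commutant :: "'w lfield set \<Rightarrow> 'w lfield set" where
  "commutant S = {a. log_field a \<and> (\<forall>c\<in>S. local_fields c a)}"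

lemma local_fields_zero: "log_field c \<Longrightarrow> local_fields c 0"
  unfolding local_fields_def local_at_def
  by (intro exI[of _ 0]) (simp add: comp12_def comp21_def log_field_zero zero_fun_apply)

lemma local_fields_id: "log_field c \<Longrightarrow> local_fields c id_field"
  unfolding local_fields_def local_at_def
  by (intro exI[of _ 0])
    (simp add: comp12_def comp21_def id_field_def log_field_zero zero_fun_apply fun_eq_iff)

lemma local_fields_add:
  assumes c: "log_field c" and a: "local_fields c a" and b: "local_fields c b"
  shows "local_fields c (a + b)"
proof -
  obtain M N where "local_at M c a" "local_at N c b"
    using a b unfolding local_fields_def by blast
  then have "local_at (max M N) c a" "local_at (max M N) c b"
    by (simp_all add: local_at_mono)
  moreover have "comp12 c (a + b) v = comp12 c a v + comp12 c b v"
    "comp21 c (a + b) v = comp21 c a v + comp21 c b v" for v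
    by (simp_all add: comp12_def comp21_def pointwise log_field_add[OF c])
  ultimately show ?thesis
    unfolding local_fields_def local_at_def
    by (intro exI[of _ "max M N"]) (simp add: mult_z12_pow_add)
qed

lemma local_fields_scale:
  assumes c: "log_field c" and a: "local_fields c a"
  shows "local_fields c (field_scale s t a)"
proof -
  have "comp12 c (field_scale s t a) v = series_scale (series_scale s) t (comp12 c a v)"
    "comp21 c (field_scale s t a) v = series_scale (series_scale s) t (comp21 c a v)" for v
    by (simp_all add: comp12_def comp21_def pscale_def log_field_scale[OF c])
  moreover obtain N where "local_at N c a" using a unfolding local_fields_def by blast
  ultimately have "local_at N c (field_scale s t a)"
    unfolding local_at_def by (simp add: mult_z12_pow_scale)
  then show ?thesis unfolding local_fields_def by blast
qed

text \<open>
  Like every first-order differential operator, \<open>D\<^sub>\<zeta>\<close> in the second variable raises the power of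
  \<open>z\<^sub>1\<^sub>2\<close> that kills a series by at most one: its commutator with \<open>z\<^sub>1\<^sub>2\<close> is multiplication by \<open>-z\<^sub>2\<close>.
\<close>

lemma mult_z12_pow_D_zeta:
  "(mult_z12 ^^ N) H = 0 \<Longrightarrow> (mult_z12 ^^ Suc N) (coeffwise (D_zeta s) H) = 0"
proof (induction N arbitrary: H)
  case 0
  then have "H = 0" by simp
  then have "coeffwise (D_zeta s) H = 0" by (intro ext) (simp add: coeffwise_def D_zeta_apply zero_fun_apply)
  then show ?case by simp
next
  case (Suc N)
  have "(mult_z12 ^^ Suc N) (coeffwise (D_zeta s) (mult_z12 H)) = 0"
    using Suc.prems by (intro Suc.IH) (simp add: funpow_swap1)
  moreover have "coeffwise (D_zeta s) (mult_z12 H)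
      = mult_z12 (coeffwise (D_zeta s) H) - coeffwise (zshift 1) H"
    by (intro ext) (simp add: mult_z12_apply coeffwise_def D_zeta_apply zshift_def minus_apply
        scale_right_diff_distrib scale_left_diff_distrib)
  moreover have "(mult_z12 ^^ Suc N) (coeffwise (zshift 1) H) = coeffwise (zshift 1) ((mult_z12 ^^ Suc N) H)"
    by (rule mult_z12_pow_coeffwise_zshift)
  moreover have "coeffwise (zshift 1) (0 :: 'w lseries2) = 0"
    by (simp add: coeffwise_def zshift_def fun_eq_iff zero_fun_apply)
  ultimately have "(mult_z12 ^^ Suc N) (mult_z12 (coeffwise (D_zeta s) H)) = 0"
    using Suc.prems by (simp only: mult_z12_pow_diff diff_zero)
  then show ?case by (simp add: funpow_swap1)
qed

lemma local_fields_D_zeta: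
  assumes c: "log_field c" and a: "local_fields c a"
  shows "local_fields c (field_D_zeta s a)"
proof -
  obtain N where N: "local_at N c a" using a unfolding local_fields_def by blast
  have comp: "comp12 c (field_D_zeta s a) v = coeffwise (D_zeta s) (comp12 c a v)"
    "comp21 c (field_D_zeta s a) v = coeffwise (D_zeta s) (comp21 c a v)" for v
    by (intro ext, simp add: comp12_def comp21_def coeffwise_def field_D_zeta_def D_zeta_apply
        log_field_add[OF c] log_field_scale[OF c] pscale_def plus_fun_apply)+
  have diff: "coeffwise (D_zeta s) (F - G) = coeffwise (D_zeta s) F - coeffwise (D_zeta s) G" for F G
    by (intro ext) (simp add: coeffwise_def D_zeta_apply minus_apply scale_right_diff_distrib)
  have "(mult_z12 ^^ N) (comp12 c a v - comp21 c a v) = 0" for v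
    using local_atD[OF N, of v] by (simp add: mult_z12_pow_diff)
  from mult_z12_pow_D_zeta[OF this]
  have "local_at (Suc N) c (field_D_zeta s a)"
    unfolding local_at_def comp diff mult_z12_pow_diff by simp
  then show ?thesis unfolding local_fields_def by blast
qed

lemma vector_space_field_scale: "vector_space (field_scale s)"
  by (intro vector_space_pscale vector_space_axioms)

lemma commutant_closed:
  assumes S: "\<And>c. c \<in> S \<Longrightarrow> log_field c"
  shows "closed_field_subspace s (commutant S)"
  unfolding closed_field_subspace_def
proof (intro conjI ballI allI impI)
  interpret F: vector_space "field_scale s" by (rule vector_space_field_scale)
  show "commutant S \<subseteq> LFie s" by (auto simp: commutant_def LFie_iff)
  show "F.subspace (commutant S)"
    by (rule F.subspaceI)
      (simp_all add: commutant_def log_field_0 log_field_plus log_field_pscale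
        local_fields_zero[OF S] local_fields_add[OF S] local_fields_scale[OF S])
  fix a
  assume a: "a \<in> commutant S"
  show "field_D_zeta s a \<in> commutant S"
    using a log_field_D_zeta local_fields_D_zeta[OF S] by (simp add: commutant_def)
  fix b n
  assume b: "b \<in> commutant S" and ab: "local_fields a b"
  show "nth_prod s n a b \<in> commutant S"
    using a b ab log_field_nth_prod local_nth_prod[OF _ _ S] by (simp add: commutant_def)
qed

text \<open>
  The generators \<open>S\<close> lie in the commutant of \<open>S\<close>, which is closed and so contains the closure \<open>V\<close>.
  By symmetry of locality \<open>S\<close> lies in the commutant of \<open>V\<close>; this is closed too, so it contains \<open>V\<close>.
  The first inclusion also shows that \<open>V\<close> is an intersection of a nonempty family of closed
  subspaces, hence closed itself.
\<close>

lemma field_closure_local: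
  assumes "local_collection s \<W>"
  shows "closed_field_subspace s (field_closure s \<W>)"
    and "local_collection s (field_closure s \<W>)"
    and "id_field \<in> field_closure s \<W>"
proof -
  let ?S = "\<W> \<union> {id_field}"
  let ?V = "field_closure s \<W>"
  have \<W>: "log_field a" "local_fields a b" if "a \<in> \<W>" "b \<in> \<W>" for a b
    using assms that by (auto simp: local_collection_def LFie_iff)
  have S: "log_field a" if "a \<in> ?S" for a using that \<W> log_field_id by auto
  have loc: "local_fields a b" if "a \<in> ?S" "b \<in> ?S" for a b
  proof (cases "b = id_field")
    case True
    then show ?thesis using local_fields_id[OF S[OF that(1)]] by simp
  next
    case b: False
    show ?thesis
    proof (cases "a = id_field")
      case True
      then show ?thesis using local_fields_sym[OF local_fields_id[OF S[OF that(2)]]] by simp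
    next
      case False
      then show ?thesis using that b \<W> by blast
    qed
  qed
  have minimal: "?V \<subseteq> U" if "closed_field_subspace s U" "?S \<subseteq> U" for U
    unfolding field_closure_def by (rule hull_minimal) (use that in auto)
  have inc: "?S \<subseteq> ?V" unfolding field_closure_def by (rule hull_subset)
  then show "id_field \<in> ?V" by auto
  have SS: "?S \<subseteq> commutant ?S" unfolding commutant_def using S loc by (intro subsetI CollectI conjI ballI)
  have VS: "?V \<subseteq> commutant ?S" by (rule minimal[OF commutant_closed[OF S] SS])
  have V: "log_field a" if "a \<in> ?V" for a using VS that by (auto simp: commutant_def)
  have "?S \<subseteq> commutant ?V"
  proof
    fix a
    assume a: "a \<in> ?S"
    have "local_fields b a" if "b \<in> ?V" for b
      using VS that a by (intro local_fields_sym[of a b]) (auto simp: commutant_def)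
    then show "a \<in> commutant ?V" using S[OF a] by (simp add: commutant_def)
  qed
  moreover have "closed_field_subspace s (commutant ?V)" by (rule commutant_closed) (rule V)
  ultimately have "?V \<subseteq> commutant ?V" by (intro minimal)
  then show lc: "local_collection s ?V"
    unfolding local_collection_def commutant_def by (auto simp: LFie_iff)
  interpret F: vector_space "field_scale s" by (rule vector_space_field_scale)
  have V_eq: "?V = \<Inter> {U. closed_field_subspace s U \<and> ?S \<subseteq> U}"
    unfolding field_closure_def hull_def ..
  show "closed_field_subspace s ?V"
    unfolding closed_field_subspace_def
  proof (intro conjI ballI allI impI)
    show "?V \<subseteq> LFie s" using lc by (simp add: local_collection_def)
    show "F.subspace ?V"
      unfolding V_eq by (rule F.subspace_Inter) (simp add: closed_field_subspace_def)
    show "field_D_zeta s a \<in> ?V" if "a \<in> ?V" for a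
      using that unfolding V_eq by (simp add: closed_field_subspace_def)
    show "nth_prod s n a b \<in> ?V" if "a \<in> ?V" "b \<in> ?V" "local_fields a b" for a b n
      using that unfolding V_eq by (simp add: closed_field_subspace_def)
  qed
qed

section \<open>The vertex algebra\<close>

text \<open>
  Multiplication by a polynomial in \<open>z\<^sub>1, z\<^sub>2, z\<^sub>3\<close> moves the support by a bounded amount, so lower bounds and
  finiteness of the support are inherited along this relation.
\<close>

definition dominated :: "'w lseries2 lseries \<Rightarrow> 'w lseries2 lseries \<Rightarrow> bool" where
  "dominated F G \<longleftrightarrow> (\<exists>M. \<forall>c1 k1 c2 k2 c3 k3. F c1 k1 c2 k2 c3 k3 \<noteq> 0 \<longrightarrow>
     (\<exists>i1\<le>M. \<exists>i2\<le>M. \<exists>i3\<le>M.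
       G (c1 - of_nat i1) k1 (c2 - of_nat i2) k2 (c3 - of_nat i3) k3 \<noteq> 0))"

lemma dominated_refl: "dominated F F"
  unfolding dominated_def by (intro exI[of _ 0]) auto

lemma dominated_trans:
  assumes "dominated F G" "dominated G H"
  shows "dominated F H"
proof -
  obtain M where M: "\<And>c1 k1 c2 k2 c3 k3. F c1 k1 c2 k2 c3 k3 \<noteq> 0 \<Longrightarrow>
     \<exists>i1\<le>M. \<exists>i2\<le>M. \<exists>i3\<le>M. G (c1 - of_nat i1) k1 (c2 - of_nat i2) k2 (c3 - of_nat i3) k3 \<noteq> 0"
    using assms(1) unfolding dominated_def by blast
  obtain N where N: "\<And>c1 k1 c2 k2 c3 k3. G c1 k1 c2 k2 c3 k3 \<noteq> 0 \<Longrightarrow>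
     \<exists>i1\<le>N. \<exists>i2\<le>N. \<exists>i3\<le>N. H (c1 - of_nat i1) k1 (c2 - of_nat i2) k2 (c3 - of_nat i3) k3 \<noteq> 0"
    using assms(2) unfolding dominated_def by blast
  have "\<exists>i1\<le>M + N. \<exists>i2\<le>M + N. \<exists>i3\<le>M + N.
      H (c1 - of_nat i1) k1 (c2 - of_nat i2) k2 (c3 - of_nat i3) k3 \<noteq> 0"
    if F: "F c1 k1 c2 k2 c3 k3 \<noteq> 0" for c1 k1 c2 k2 c3 k3
  proof -
    obtain i1 i2 i3 where i: "i1 \<le> M" "i2 \<le> M" "i3 \<le> M"
      "G (c1 - of_nat i1) k1 (c2 - of_nat i2) k2 (c3 - of_nat i3) k3 \<noteq> 0"
      using M[OF F] by blast
    obtain j1 j2 j3 where j: "j1 \<le> N" "j2 \<le> N" "j3 \<le> N"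
      "H (c1 - of_nat i1 - of_nat j1) k1 (c2 - of_nat i2 - of_nat j2) k2
        (c3 - of_nat i3 - of_nat j3) k3 \<noteq> 0"
      using N[OF i(4)] by blast
    show ?thesis
      using i j
      by (intro exI[of _ "i1 + j1"] exI[of _ "i2 + j2"] exI[of _ "i3 + j3"] conjI)
        (simp_all add: diff_diff_eq)
  qed
  then show ?thesis unfolding dominated_def by blast
qed

lemma dominated_step:
  assumes "\<And>c1 k1 c2 k2 c3 k3. F c1 k1 c2 k2 c3 k3 \<noteq> 0 \<Longrightarrow>
    G (c1 - 1) k1 c2 k2 c3 k3 \<noteq> 0 \<or> G c1 k1 (c2 - 1) k2 c3 k3 \<noteq> 0
      \<or> G c1 k1 c2 k2 (c3 - 1) k3 \<noteq> 0"
  shows "dominated F G"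
  unfolding dominated_def
proof (rule exI[of _ 1], intro allI impI)
  fix c1 k1 c2 k2 c3 k3
  assume "F c1 k1 c2 k2 c3 k3 \<noteq> 0"
  then consider "G (c1 - of_nat 1) k1 (c2 - of_nat 0) k2 (c3 - of_nat 0) k3 \<noteq> 0"
    | "G (c1 - of_nat 0) k1 (c2 - of_nat 1) k2 (c3 - of_nat 0) k3 \<noteq> 0"
    | "G (c1 - of_nat 0) k1 (c2 - of_nat 0) k2 (c3 - of_nat 1) k3 \<noteq> 0"
    using assms by force
  then show "\<exists>i1\<le>1. \<exists>i2\<le>1. \<exists>i3\<le>1.
      G (c1 - of_nat i1) k1 (c2 - of_nat i2) k2 (c3 - of_nat i3) k3 \<noteq> 0"
  proof cases
    case 1
    then show ?thesis
      by (rule_tac x = 1 in exI, intro conjI, simp, rule_tac x = 0 in exI, intro conjI, simp,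
          rule_tac x = 0 in exI) simp
  next
    case 2
    then show ?thesis
      by (rule_tac x = 0 in exI, intro conjI, simp, rule_tac x = 1 in exI, intro conjI, simp,
          rule_tac x = 0 in exI) simp
  next
    case 3
    then show ?thesis
      by (rule_tac x = 0 in exI, intro conjI, simp, rule_tac x = 0 in exI, intro conjI, simp,
          rule_tac x = 1 in exI) simp
  qed
qed

lemma dominated_pow: "(\<And>F. dominated (f F) F) \<Longrightarrow> dominated ((f ^^ n) F) F"
proof (induction n)
  case (Suc n)
  show ?case using dominated_trans[OF Suc.prems Suc.IH[OF Suc.prems]] by simp
qed (simp add: dominated_refl)

lemma dominated_mult_z12: "dominated ((mult_z12 ^^ n) F) F"
  by (intro dominated_pow dominated_step) (auto simp: mult_z12_apply minus_apply)

lemma dominated_mult_z13: "dominated ((mult_z13 ^^ n) F) F"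
  by (intro dominated_pow dominated_step)
    (auto simp: mult_z13_def minus_apply zshift_def coeffwise_def)

lemma dominated_mult_z23: "dominated ((mult_z23 ^^ n) F) F"
  by (intro dominated_pow dominated_step)
    (auto simp: mult_z23_def minus_apply mult_z12_apply coeffwise_def)

lemma restrictable3I:
  assumes "finite A" "finite B" "finite C"
    and cone: "\<And>c1 k1 c2 k2 c3 k3. F c1 k1 c2 k2 c3 k3 \<noteq> 0 \<Longrightarrow>
      c1 \<in> cone A \<and> c2 \<in> cone B \<and> c3 \<in> cone C"
    and fin: "\<And>c1 c2 c3. finite {(k1, k2, k3). F c1 k1 c2 k2 c3 k3 \<noteq> 0}"
  shows "restrictable3 F"
  unfolding restrictable3_def
proof
  fix c
  let ?C = "{(c1, c2, c3). c1 \<in> cone A \<and> c2 \<in> cone B \<and> c3 \<in> cone C \<and> c1 + c2 + c3 = c}"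
  have "{(c1, k1, c2, k2, c3, k3). c1 + c2 + c3 = c \<and> F c1 k1 c2 k2 c3 k3 \<noteq> 0}
      \<subseteq> (\<Union>(c1, c2, c3)\<in>?C. (\<lambda>(k1, k2, k3). (c1, k1, c2, k2, c3, k3)) `
          {(k1, k2, k3). F c1 k1 c2 k2 c3 k3 \<noteq> 0})"
    using cone by (auto simp: image_iff)
  moreover have "finite \<dots>"
    using fin by (intro finite_UN_I finite_cone_sum3 assms(1-3)) auto
  ultimately show "finite {(c1, k1, c2, k2, c3, k3). c1 + c2 + c3 = c \<and> F c1 k1 c2 k2 c3 k3 \<noteq> 0}"
    by (rule finite_subset)
qed

lemma dominated_finite:
  assumes "dominated F G" and fin: "\<And>c1 c2 c3. finite {(k1, k2, k3). G c1 k1 c2 k2 c3 k3 \<noteq> 0}"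
  shows "finite {(k1, k2, k3). F c1 k1 c2 k2 c3 k3 \<noteq> 0}"
proof -
  obtain M where M: "\<And>c1 k1 c2 k2 c3 k3. F c1 k1 c2 k2 c3 k3 \<noteq> 0 \<Longrightarrow>
     \<exists>i1\<le>M. \<exists>i2\<le>M. \<exists>i3\<le>M. G (c1 - of_nat i1) k1 (c2 - of_nat i2) k2 (c3 - of_nat i3) k3 \<noteq> 0"
    using assms(1) unfolding dominated_def by blast
  have "{(k1, k2, k3). F c1 k1 c2 k2 c3 k3 \<noteq> 0}
      \<subseteq> (\<Union>(i1, i2, i3)\<in>{..M} \<times> {..M} \<times> {..M}.
        {(k1, k2, k3). G (c1 - of_nat i1) k1 (c2 - of_nat i2) k2 (c3 - of_nat i3) k3 \<noteq> 0})"
    using M[of c1 _ c2 _ c3] by force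
  moreover have "finite \<dots>" using fin by (intro finite_UN_I) auto
  ultimately show ?thesis by (rule finite_subset)
qed

lemma comp123_finite:
  assumes "log_field a" "log_field b" "log_field c"
  shows "finite {(k1, k2, k3). comp123 a b c v c1 k1 c2 k2 c3 k3 \<noteq> 0}"
proof -
  have "{(k1, k2, k3). comp123 a b c v c1 k1 c2 k2 c3 k3 \<noteq> 0}
      \<subseteq> (\<lambda>(k3, k1, k2). (k1, k2, k3)) ` (SIGMA k3:{k3. c v c3 k3 \<noteq> 0}.
          {(k1, k2). comp12 a b (c v c3 k3) c1 k1 c2 k2 \<noteq> 0})"
    using log_field_zero[OF assms(1)] log_field_zero[OF assms(2)]
    by (force simp: comp123_def comp12_def image_iff zero_fun_apply)
  moreover have "finite \<dots>"
    using assms by (intro finite_imageI finite_SigmaI comp12_finite) (simp_all add: log_field_finite)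
  ultimately show ?thesis by (rule finite_subset)
qed

text \<open>
  Locality allows each of the three fields to be moved to the rightmost place, next to \<open>v\<close>, where the
  exponents of its variable are bounded below. Only the orders \<open>abc\<close>, \<open>acb\<close> and \<open>bca\<close> are
  needed for this.
\<close>

lemma restrictable3_comp123:
  assumes a: "log_field a" and b: "log_field b" and c: "log_field c"
    and ab: "local_at n a b" and ac: "local_at N a c" and bc: "local_at N b c"
  shows "restrictable3 ((mult_z23 ^^ N) ((mult_z13 ^^ N) ((mult_z12 ^^ n) (comp123 a b c v))))"
    (is "restrictable3 ?F")
proof -
  obtain A where A: "finite A" "\<And>c k. a v c k \<noteq> 0 \<Longrightarrow> c \<in> cone A"
    using a by (rule log_field_cone[where v = v]) blast
  obtain B where B: "finite B" "\<And>c k. b v c k \<noteq> 0 \<Longrightarrow> c \<in> cone B"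
    using b by (rule log_field_cone[where v = v]) blast
  obtain C where C: "finite C" "\<And>d k. c v d k \<noteq> 0 \<Longrightarrow> d \<in> cone C"
    using c by (rule log_field_cone[where v = v]) blast
  have dom3: "dominated ((mult_z23 ^^ N) ((mult_z13 ^^ N) ((mult_z12 ^^ n) G))) G" for G
    by (rule dominated_trans[OF dominated_mult_z23
          dominated_trans[OF dominated_mult_z13 dominated_mult_z12]])
  define bca where "bca = (\<lambda>c1 k1 c2 k2 c3 k3. b (c (a v c1 k1) c3 k3) c2 k2)"
  define acb where "acb = (\<lambda>c1 k1 c2 k2 c3 k3. a (c (b v c2 k2) c3 k3) c1 k1)"
  have c13: "mult_z13 (mult_z23 G) = mult_z23 (mult_z13 G)"
    and c12: "mult_z12 (mult_z23 G) = mult_z23 (mult_z12 G)" for G :: "'w lseries2 lseries"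
    by (intro ext; simp add: mult_z13_def mult_z23_def coeffwise_def mult_z12_apply zshift_def
        minus_apply algebra_simps; fail)+
  have F1: "?F = (mult_z23 ^^ N) ((mult_z13 ^^ N) ((mult_z12 ^^ n) bca))"
  proof -
    have "swap (comp123 b a c v) = (\<lambda>c1 k1 c2 k2 c3 k3. b (a (c v c3 k3) c1 k1) c2 k2)"
      by (simp add: swap_def comp123_def)
    then have "(mult_z13 ^^ N) (swap (comp123 b a c v)) = (mult_z13 ^^ N) bca"
      unfolding bca_def using mult_z13_pow_comp[OF b ac] by simp
    then show ?thesis
      unfolding mult_z12_pow_comp123[OF ab] by (simp add: mult_z12_z13_pow[symmetric])
  qed
  have F2: "?F = (mult_z23 ^^ N) ((mult_z13 ^^ N) ((mult_z12 ^^ n) acb))"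
  proof -
    have "(mult_z23 ^^ N) (comp123 a b c v) = (mult_z23 ^^ N) acb"
    proof (intro ext)
      fix c1 k1 c2 k2 c3 k3
      have pow: "(mult_z23 ^^ N) G c1 k1 = (mult_z12 ^^ N) (G c1 k1)" for G
        by (induction N) (simp_all add: mult_z23_def coeffwise_def)
      have "comp123 a b c v c1 k1 = coeffwise (coeffwise (\<lambda>u. a u c1 k1)) (comp12 b c v)"
        "acb c1 k1 = coeffwise (coeffwise (\<lambda>u. a u c1 k1)) (comp21 b c v)"
        by (simp_all add: comp123_def acb_def comp12_def comp21_def coeffwise_def)
      then have "(mult_z12 ^^ N) (comp123 a b c v c1 k1) = (mult_z12 ^^ N) (acb c1 k1)"
        by (simp add: mult_z12_pow_coeffwise2 log_field_diff[OF a] minus_apply local_atD[OF bc])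
      then show "(mult_z23 ^^ N) (comp123 a b c v) c1 k1 c2 k2 c3 k3
          = (mult_z23 ^^ N) acb c1 k1 c2 k2 c3 k3" by (simp only: pow)
    qed
    moreover have "(mult_z23 ^^ N) ((mult_z13 ^^ N) ((mult_z12 ^^ n) G))
        = (mult_z13 ^^ N) ((mult_z12 ^^ n) ((mult_z23 ^^ N) G))" for G
    proof -
      have "(mult_z13 ^^ N) ((mult_z23 ^^ N) G) = (mult_z23 ^^ N) ((mult_z13 ^^ N) G)" for G
        by (rule funpow_commute[where g = "mult_z23 ^^ N"],
          rule funpow_commute[where g = mult_z13, symmetric], rule c13[symmetric])
      moreover have "(mult_z12 ^^ n) ((mult_z23 ^^ N) G) = (mult_z23 ^^ N) ((mult_z12 ^^ n) G)" for G
        by (rule funpow_commute[where g = "mult_z23 ^^ N"],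
          rule funpow_commute[where g = mult_z12, symmetric], rule c12[symmetric])
      ultimately show ?thesis by simp
    qed
    ultimately show ?thesis by simp
  qed
  show ?thesis
  proof (rule restrictable3I[OF A(1) B(1) C(1)])
    show "finite {(k1, k2, k3). ?F c1 k1 c2 k2 c3 k3 \<noteq> 0}" for c1 c2 c3
      by (rule dominated_finite[OF dom3 comp123_finite[OF a b c]])
    fix c1 k1 c2 k2 c3 k3
    assume F: "?F c1 k1 c2 k2 c3 k3 \<noteq> 0"
    obtain d1 k d2 l i3 where "comp123 a b c v d1 k d2 l (c3 - of_nat i3) k3 \<noteq> 0"
      using dom3[of "comp123 a b c v"] F unfolding dominated_def by blast
    then have "c v (c3 - of_nat i3) k3 \<noteq> 0"
      using log_field_zero[OF a] log_field_zero[OF b] by (auto simp: comp123_def zero_fun_apply)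
    then have 3: "c3 \<in> cone C" using C(2) cone_shift by blast
    obtain i1 d2 l d3 m where "bca (c1 - of_nat i1) k1 d2 l d3 m \<noteq> 0"
      using dom3[of bca] F unfolding F1 dominated_def by blast
    then have "a v (c1 - of_nat i1) k1 \<noteq> 0"
      using log_field_zero[OF b] log_field_zero[OF c] by (auto simp: bca_def zero_fun_apply)
    then have 1: "c1 \<in> cone A" using A(2) cone_shift by blast
    obtain d1 k i2 d3 m where "acb d1 k (c2 - of_nat i2) k2 d3 m \<noteq> 0"
      using dom3[of acb] F unfolding F2 dominated_def by blast
    then have "b v (c2 - of_nat i2) k2 \<noteq> 0"
      using log_field_zero[OF a] log_field_zero[OF c] by (auto simp: acb_def zero_fun_apply)
    then have 2: "c2 \<in> cone B" using B(2) cone_shift by blast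
    show "c1 \<in> cone A \<and> c2 \<in> cone B \<and> c3 \<in> cone C" using 1 2 3 by blast
  qed
qed

text \<open>
  By Dong's lemma \<open>a\<close> is local to \<open>b\<^sub>(\<^sub>j\<^sub>)c\<close>, which makes the second expansion possible for every \<open>j\<close>.
\<close>

lemma double_expandable_comp123:
  assumes a: "log_field a" and b: "log_field b" and c: "log_field c"
    and ab: "local_fields a b" and ac: "local_fields a c" and bc: "local_fields b c"
  shows "double_expandable (comp123 a b c v)"
    and "double_coeff i j (comp123 a b c v) = nth_prod s i a (nth_prod s j b c) v"
proof -
  have ip: "coeffwise_pole_coeff j (comp123 a b c v) = comp12 a (nth_prod s j b c) v" for j
    by (rule coeffwise_pole_coeff_comp123[OF b c a bc])
  have l: "log_field (nth_prod s j b c)" for j by (rule log_field_nth_prod[OF b c bc])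
  have loc: "local_fields a (nth_prod s j b c)" for j by (rule local_nth_prod[OF b c a bc ab ac])
  have fin: "finite_pole (comp123 a b c v c1 k1)" for c1 k1
  proof -
    have "comp123 a b c v c1 k1 = coeffwise (coeffwise (\<lambda>u. a u c1 k1)) (comp12 b c v)"
      by (simp add: comp123_def comp12_def coeffwise_def)
    then show ?thesis
      using pole_coeff_descends(1)[OF descends_linear[OF log_field_coeff_linear[OF a]]
          finite_pole_comp12[OF b c bc]] by simp
  qed
  show "double_expandable (comp123 a b c v)"
    unfolding double_expandable_def ip using fin finite_pole_comp12[OF a l loc] by blast
  show "double_coeff i j (comp123 a b c v) = nth_prod s i a (nth_prod s j b c) v"
    unfolding ip nth_prod_eq[OF a l loc] ..
qed

text \<open>
  The exponent \<open>n\<close> depends on \<open>a\<close> and \<open>b\<close> only. After multiplication by \<open>z\<^sub>1\<^sub>2\<^sup>n\<close> the two orders of \<open>a\<close> and \<open>b\<close>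
  give one series, whose double coefficients do not depend on the order of expansion.
\<close>

lemma nth_prod_va_local:
  assumes a: "log_field a" and b: "log_field b" and ab: "local_at n a b"
    and c: "log_field c" and ac: "local_fields a c" and bc: "local_fields b c"
  shows "(mult_xy ^^ n) (\<lambda>i j. nth_prod s (- i - 1) a (nth_prod s (- j - 1) b c))
    = (mult_xy ^^ n) (\<lambda>i j. nth_prod s (- j - 1) b (nth_prod s (- i - 1) a c))"
proof -
  have ab': "local_fields a b" using ab by (auto simp: local_fields_def)
  obtain M M' where "local_at M a c" "local_at M' b c" using ac bc unfolding local_fields_def by blast
  then obtain N where N: "local_at N a c" "local_at N b c"
    using local_at_mono[of M a c "max M M'"] local_at_mono[of M' b c "max M M'"] by auto
  have ev: "(mult_xy ^^ m) f i j v d = (mult_xy ^^ m) (\<lambda>i j. f i j v d) i j"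
    for m i j v d and f :: "int \<Rightarrow> int \<Rightarrow> 'w lfield"
    by (induction m arbitrary: i j) (simp_all add: mult_xy_def minus_apply)
  have sw: "swap (swap G) = G" for G :: "'w lseries2 lseries" by (simp add: swap_def)
  have "(mult_xy ^^ n) (\<lambda>i j. nth_prod s (- i - 1) a (nth_prod s (- j - 1) b c)) i j v d
    = (mult_xy ^^ n) (\<lambda>i j. nth_prod s (- j - 1) b (nth_prod s (- i - 1) a c)) i j v d"
    for i j v d
  proof -
    note ex = double_expandable_comp123[OF a b c ab' ac bc, where v = v]
    note ex' = double_expandable_comp123[OF b a c local_fields_sym[OF ab'] bc ac, where v = v]
    let ?K = "(mult_z12 ^^ n) (comp123 a b c v)"
    have K: "?K = (mult_z12 ^^ n) (swap (comp123 b a c v))" by (rule mult_z12_pow_comp123[OF ab])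
    have exK: "double_expandable ((mult_z12 ^^ m) (comp123 a b c v))" for m
      by (induction m) (simp_all add: ex(1) double_coeff_mult_z12(1))
    have exs: "double_expandable (swap (swap (comp123 b a c v)))" by (simp add: sw ex'(1))
    have exK': "double_expandable (swap ?K)"
      unfolding K by (rule mult_xy_double_coeff_swap(2)[OF exs])
    have sym: "double_coeff j i (swap ?K) = double_coeff i j ?K" for i j
      by (rule double_coeff_swap[OF _ _ restrictable3_comp123[OF a b c ab N]])
        (use exK[of n] exK' in \<open>simp_all add: double_expandable_def\<close>)
    have "(mult_xy ^^ n) (\<lambda>i j. nth_prod s (- i - 1) a (nth_prod s (- j - 1) b c)) i j v d
        = (mult_xy ^^ n) (\<lambda>i j. double_coeff (- i - 1) (- j - 1) (comp123 a b c v) d) i j"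
      unfolding ev ex(2) ..
    also have "\<dots> = double_coeff (- i - 1) (- j - 1) ?K d"
      unfolding mult_xy_double_coeff[OF ex(1)] ..
    also have "\<dots> = double_coeff (- j - 1) (- i - 1) (swap ?K) d" by (simp only: sym)
    also have "\<dots> = (mult_xy ^^ n)
        (\<lambda>i j. double_coeff (- j - 1) (- i - 1) (swap (swap (comp123 b a c v))) d) i j"
      unfolding K mult_xy_double_coeff_swap(1)[OF exs] ..
    also have "\<dots> = (mult_xy ^^ n)
        (\<lambda>i j. nth_prod s (- j - 1) b (nth_prod s (- i - 1) a c)) i j v d"
      unfolding ev sw ex'(2) ..
    finally show ?thesis .
  qed
  then show ?thesis by (intro ext) (simp only:)
qed


lemma local_at_id: "log_field a \<Longrightarrow> local_at 0 a id_field"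
  unfolding local_at_def
  by (simp add: comp12_def comp21_def id_field_def log_field_zero zero_fun_apply fun_eq_iff)

lemma D1_pow_comp12_id:
  assumes "log_field b"
  shows "(D1 ^^ Suc n) (comp12 id_field b v) = 0"
proof (induction n)
  case 0
  have "c + 1 \<noteq> (0 :: complex) \<or> s (c + 1) x = 0" for c x by auto
  then show ?case
    by (intro ext) (auto simp: D1_apply comp12_def id_field_def zero_fun_apply)
next
  case (Suc n)
  have "D1 0 = 0" by (intro ext) (simp add: D1_apply zero_fun_apply)
  then show ?case using Suc by simp
qed

lemma diag_comp12_id: "diag (comp12 id_field b v) = b v"
proof (intro ext)
  fix c k
  have "diag (comp12 id_field b v) c k
      = (\<Sum>(c1, k1, c2, k2)\<in>{(0, 0, c, k)}. comp12 id_field b v c1 k1 c2 k2)"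
    by (rule diag_eq_sum) (auto simp: comp12_def id_field_def)
  then show "diag (comp12 id_field b v) c k = b v c k" by (simp add: comp12_def id_field_def)
qed

lemma diag_comp12_right_id: "log_field a \<Longrightarrow> diag (comp12 a id_field v) = a v"
proof (intro ext)
  fix c k
  assume a: "log_field a"
  have "diag (comp12 a id_field v) c k
      = (\<Sum>(c1, k1, c2, k2)\<in>{(c, k, 0, 0)}. comp12 a id_field v c1 k1 c2 k2)"
    by (rule diag_eq_sum) (auto simp: comp12_def id_field_def log_field_zero[OF a] zero_fun_apply
        split: if_splits)
  then show "diag (comp12 a id_field v) c k = a v c k" by (simp add: comp12_def id_field_def)
qed

lemma nth_prod_id_left:
  assumes b: "log_field b"
  shows "nth_prod s n id_field b = (if n = -1 then b else 0)"
proof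
  fix v
  have loc: "local_at 0 id_field b" using local_at_sym[OF local_at_id[OF b]] .
  have "nth_prod s n id_field b v = pole_coeff_at 0 n (comp12 id_field b v)"
    unfolding nth_prod_eq[OF log_field_id b local_fieldsI[OF loc]]
      pole_coeff_eq[OF restrictable_comp12[OF log_field_id b loc]] ..
  also have "\<dots> = (if n = -1 then b else 0) v"
  proof -
    have sc1: "series_scale (series_scale s) 1 F = F" for F by (simp add: pscale_def)
    have sc0: "series_scale (series_scale s) t 0 = 0" for t
      by (intro ext) (simp add: pscale_def zero_fun_apply)
    consider "n = -1" | "n \<ge> 0" | m where "n = - int (Suc m) - 1"
    proof -
      have "n = - int (Suc (nat (- n - 2))) - 1" if "n < 0" "n \<noteq> -1" using that by simp
      then show ?thesis using that by (meson not_less)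
    qed
    then show ?thesis
    proof cases
      case 1
      then show ?thesis by (simp add: pole_coeff_at_def D1_divpow_apply sc1 diag_comp12_id)
    next
      case 2
      then show ?thesis by (simp add: pole_coeff_at_def zero_fun_apply)
    next
      case 3
      then have "nat (int 0 - 1 - n) = Suc m" by simp
      then show ?thesis
        using 3 D1_pow_comp12_id[OF b, of m v]
        by (simp add: pole_coeff_at_def D1_divpow_apply sc0 zero_fun_apply del: funpow.simps)
    qed
  qed
  finally show "nth_prod s n id_field b v = (if n = -1 then b else 0) v" .
qed

lemma nth_prod_id_right:
  assumes a: "log_field a"
  shows "n \<ge> 0 \<Longrightarrow> nth_prod s n a id_field = 0"
    and "nth_prod s (-1) a id_field = a"
    and "nth_prod s (-2) a id_field = field_D_z s a"
proof -
  have loc: "local_at 0 a id_field" by (rule local_at_id[OF a])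
  have r: "restrictable (comp12 a id_field v)" for v
    using restrictable_comp12[OF a log_field_id loc, of v] by simp
  have eq: "nth_prod s n a id_field = (\<lambda>v. pole_coeff_at 0 n (comp12 a id_field v))" for n
    unfolding nth_prod_eq[OF a log_field_id local_fieldsI[OF loc]]
      pole_coeff_eq[OF restrictable_comp12[OF a log_field_id loc]] ..
  have sc1: "series_scale (series_scale s) 1 F = F" for F by (simp add: pscale_def)
  show "nth_prod s n a id_field = 0" if "n \<ge> 0"
    unfolding eq using that by (simp add: pole_coeff_at_def fun_eq_iff zero_fun_apply)
  show "nth_prod s (-1) a id_field = a"
    unfolding eq by (simp add: pole_coeff_at_def D1_divpow_apply sc1 diag_comp12_right_id[OF a])
  have "D2 (comp12 a id_field v) = 0" for v
    by (intro ext) (auto simp: D2_apply comp12_def id_field_def log_field_zero[OF a] zero_fun_apply)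
  then have "diag (D1 (comp12 a id_field v)) = D_z s (a v)" for v
    using diag_D[OF r, of v] by (simp add: diag_comp12_right_id[OF a])
  then show "nth_prod s (-2) a id_field = field_D_z s a"
    unfolding eq by (simp add: pole_coeff_at_def D1_divpow_apply sc1 field_D_z_def)
qed

lemma nth_prod_bilinear:
  assumes a: "log_field a" and a': "log_field a'" and b: "log_field b" and b': "log_field b'"
    and loc: "local_fields a b" "local_fields a b'" "local_fields a' b"
  shows "nth_prod s n a (b + b') = nth_prod s n a b + nth_prod s n a b'"
    and "nth_prod s n a (field_scale s t b) = field_scale s t (nth_prod s n a b)"
    and "nth_prod s n (a + a') b = nth_prod s n a b + nth_prod s n a' b"
    and "nth_prod s n (field_scale s t a) b = field_scale s t (nth_prod s n a b)"
proof -
  note fp = finite_pole_comp12[OF a b loc(1)] finite_pole_comp12[OF a b' loc(2)]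
    finite_pole_comp12[OF a' b loc(3)]
  have eq: "comp12 a (b + b') v = comp12 a b v + comp12 a b' v" for v
    by (simp add: comp12_def pointwise log_field_add[OF a])
  show "nth_prod s n a (b + b') = nth_prod s n a b + nth_prod s n a b'"
    unfolding nth_prod_eq[OF a log_field_plus[OF b b'] local_fields_add[OF a loc(1,2)]]
      nth_prod_eq[OF a b loc(1)] nth_prod_eq[OF a b' loc(2)]
    by (rule ext, subst plus_fun_apply, subst eq, rule pole_coeff_add(2)) (rule fp)+
  have "comp12 a (field_scale s t b) v = series_scale (series_scale s) t (comp12 a b v)" for v
    by (simp add: comp12_def pscale_def log_field_scale[OF a])
  then show "nth_prod s n a (field_scale s t b) = field_scale s t (nth_prod s n a b)"
    unfolding nth_prod_eq[OF a log_field_pscale[OF b] local_fields_scale[OF a loc(1)]]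
      nth_prod_eq[OF a b loc(1)]
    by (simp add: pole_coeff_descends(2)[OF descends_scale] fp) (simp add: pscale_def)
  have eq: "comp12 (a + a') b v = comp12 a b v + comp12 a' b v" for v
    by (simp add: comp12_def pointwise)
  show "nth_prod s n (a + a') b = nth_prod s n a b + nth_prod s n a' b"
    unfolding nth_prod_eq[OF log_field_plus[OF a a'] b local_fields_sym[OF
        local_fields_add[OF b local_fields_sym[OF loc(1)] local_fields_sym[OF loc(3)]]]]
      nth_prod_eq[OF a b loc(1)] nth_prod_eq[OF a' b loc(3)]
    by (rule ext, subst plus_fun_apply, subst eq, rule pole_coeff_add(2)) (rule fp)+
  have "comp12 (field_scale s t a) b v = series_scale (series_scale s) t (comp12 a b v)" for v
    by (simp add: comp12_def pscale_def)
  then show "nth_prod s n (field_scale s t a) b = field_scale s t (nth_prod s n a b)"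
    unfolding nth_prod_eq[OF log_field_pscale[OF a] b local_fields_sym[OF
        local_fields_scale[OF b local_fields_sym[OF loc(1)]]]]
      nth_prod_eq[OF a b loc(1)]
    by (simp add: pole_coeff_descends(2)[OF descends_scale] fp) (simp add: pscale_def)
qed

text \<open>
  \<open>D\<^sub>z\<close> of the product is \<open>R\<^sub>n\<close> of \<open>(D\<^sub>1 + D\<^sub>2)(a(z\<^sub>1)b(z\<^sub>2)v)\<close>; the \<open>D\<^sub>2\<close>-part is the product with \<open>D\<^sub>zb\<close>, and
  \<open>R\<^sub>n D\<^sub>1 = -n R\<^sub>n\<^sub>-\<^sub>1\<close>.
\<close>

lemma nth_prod_D_z:
  assumes a: "log_field a" and b: "log_field b" and loc: "local_fields a b"
    and Db: "log_field (field_D_z s b)" "local_fields a (field_D_z s b)"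
  shows "field_D_z s (nth_prod s n a b) - nth_prod s n a (field_D_z s b)
    = field_scale s (- of_int n) (nth_prod s (n - 1) a b)"
proof
  fix v
  note fp = finite_pole_comp12[OF a b loc, of v]
  have D2: "comp12 a (field_D_z s b) v = D2 (comp12 a b v)"
    by (intro ext) (simp add: comp12_def D2_apply field_D_z_def D_z_apply log_field_add[OF a]
        log_field_scale[OF a] plus_fun_apply pscale_def)
  have "D_z s (pole_coeff n (comp12 a b v))
      = pole_coeff n (D1 (comp12 a b v) + D2 (comp12 a b v))"
    by (rule pole_coeff_descends(2)[OF descends_D_z fp, symmetric])
  also have "\<dots> = pole_coeff n (D1 (comp12 a b v)) + pole_coeff n (D2 (comp12 a b v))"
    using finite_pole_comp12[OF a Db, of v] by (intro pole_coeff_add(2) pole_coeff_D1(1) fp) (simp add: D2)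
  also have "pole_coeff n (D1 (comp12 a b v))
      = series_scale s (- of_int n) (pole_coeff (n - 1) (comp12 a b v))"
    by (rule pole_coeff_D1(2)[OF fp])
  finally show "(field_D_z s (nth_prod s n a b) - nth_prod s n a (field_D_z s b)) v
      = field_scale s (- of_int n) (nth_prod s (n - 1) a b) v"
    unfolding minus_apply[of _ _ v] nth_prod_eq[OF a b loc] nth_prod_eq[OF a Db] D2
    by (simp add: field_D_z_def pscale_def[of "series_scale s"])
qed

lemma vertex_algebra_closed_collection:
  assumes closed: "closed_field_subspace s V" and loc: "local_collection s V"
    and id: "id_field \<in> V"
  shows "vertex_algebra (field_scale s) V id_field (nth_prod s)"
proof -
  have V: "log_field a" if "a \<in> V" for a
    using that loc by (auto simp: local_collection_def LFie_iff)
  have l: "local_fields a b" if "a \<in> V" "b \<in> V" for a b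
    using that loc by (auto simp: local_collection_def)
  have prod: "nth_prod s n a b \<in> V" if "a \<in> V" "b \<in> V" for a b n
    using that closed l by (simp add: closed_field_subspace_def)
  have T: "va_translation (nth_prod s) id_field a = field_D_z s a" if "a \<in> V" for a
    unfolding va_translation_def by (rule nth_prod_id_right(3)[OF V[OF that]])
  have DV: "field_D_z s a \<in> V" if "a \<in> V" for a
    using prod[OF that id, of "-2"] nth_prod_id_right(3)[OF V[OF that]] by simp
  note bil = nth_prod_bilinear[OF V V V V l l l]
  show ?thesis
    unfolding vertex_algebra_def
  proof (intro conjI ballI allI impI)
    show "vector_space (field_scale s)" by (rule vector_space_field_scale)
    show "module.subspace (field_scale s) V" using closed by (simp add: closed_field_subspace_def)
    show "id_field \<in> V" by (rule id)
  next
    fix a b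
    assume a: "a \<in> V" and b: "b \<in> V"
    obtain N where N: "\<And>n. n \<ge> int N \<Longrightarrow> nth_prod s n a b = 0"
      using nth_prod_bounded[OF V[OF a] V[OF b] l[OF a b]] by blast
    \<comment> \<open>\<open>m < -N\<close> means \<open>n = -m - 1 \<ge> N\<close>\<close>
    have "\<forall>m < - int N. va_Y (nth_prod s) a b m = 0"
      unfolding va_Y_def by (intro allI impI N) simp
    then show "va_Y (nth_prod s) a b \<in> laurent V"
      using prod[OF a b] by (auto simp: laurent_def va_Y_def)
    show "va_Y (nth_prod s) a (field_scale s t b) = pscale (field_scale s) t (va_Y (nth_prod s) a b)"
      for t
      unfolding va_Y_def bil(2)[OF a a b b a b a b a b] by (simp only: pscale_def)
    show "va_Y (nth_prod s) (field_scale s t a) b = pscale (field_scale s) t (va_Y (nth_prod s) a b)"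
      for t
      unfolding va_Y_def bil(4)[OF a a b b a b a b a b] by (simp only: pscale_def)
    show "(\<lambda>m. va_translation (nth_prod s) id_field (va_Y (nth_prod s) a b m))
        - va_Y (nth_prod s) a (va_translation (nth_prod s) id_field b)
        = deriv_x (field_scale s) (va_Y (nth_prod s) a b)"
    proof
      fix m
      have "va_translation (nth_prod s) id_field (va_Y (nth_prod s) a b m)
          - va_Y (nth_prod s) a (va_translation (nth_prod s) id_field b) m
        = field_D_z s (nth_prod s (- m - 1) a b) - nth_prod s (- m - 1) a (field_D_z s b)"
        unfolding T[OF b] by (simp only: va_Y_def T[OF prod[OF a b]])
      also have "\<dots> = field_scale s (- of_int (- m - 1)) (nth_prod s (- m - 1 - 1) a b)"
        by (rule nth_prod_D_z[OF V[OF a] V[OF b] l[OF a b] V[OF DV[OF b]] l[OF a DV[OF b]]])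
      also have "- of_int (- m - 1) = (of_int (m + 1) :: complex)" by simp
      also have "- m - 1 - 1 = - (m + 1) - 1" by simp
      finally show "((\<lambda>m. va_translation (nth_prod s) id_field (va_Y (nth_prod s) a b m))
          - va_Y (nth_prod s) a (va_translation (nth_prod s) id_field b)) m
        = deriv_x (field_scale s) (va_Y (nth_prod s) a b) m"
        unfolding minus_apply[of _ _ m] deriv_x_def va_Y_def .
    qed
    obtain n where n: "local_at n a b" using l[OF a b] unfolding local_fields_def by blast
    show "va_local V (nth_prod s) a b"
      unfolding va_local_def va_Y_def
      by (intro exI[of _ n] ballI nth_prod_va_local V l a b n)
  next
    fix a b b'
    assume a: "a \<in> V" and b: "b \<in> V" and b': "b' \<in> V"
    show "va_Y (nth_prod s) a (b + b') = va_Y (nth_prod s) a b + va_Y (nth_prod s) a b'"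
      by (rule ext, subst plus_fun_apply) (simp only: va_Y_def bil(1)[OF a a b b' a b a b' a b])
  next
    fix a a' b
    assume a: "a \<in> V" and a': "a' \<in> V" and b: "b \<in> V"
    show "va_Y (nth_prod s) (a + a') b = va_Y (nth_prod s) a b + va_Y (nth_prod s) a' b"
      by (rule ext, subst plus_fun_apply) (simp only: va_Y_def bil(3)[OF a a' b b a b a b a' b])
  next
    fix b
    assume b: "b \<in> V"
    show "va_Y (nth_prod s) id_field b = (\<lambda>m. if m = 0 then b else 0)"
      by (rule ext) (simp add: va_Y_def nth_prod_id_left[OF V[OF b]])
  next
    fix a
    assume a: "a \<in> V"
    show "nth_prod s (- 1) a id_field = a" by (rule nth_prod_id_right(2)[OF V[OF a]])
    show "nth_prod s n a id_field = 0" if "0 \<le> n" for n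
      by (rule nth_prod_id_right(1)[OF V[OF a] that])
  qed
qed

end

theorem theorem3p7:
  fixes scale :: "complex \<Rightarrow> 'w::ab_group_add \<Rightarrow> 'w"
    and \<W> :: "'w lfield set"
  assumes "vector_space scale"
    and "local_collection scale \<W>"
  shows "closed_field_subspace scale (field_closure scale \<W>)
    \<and> local_collection scale (field_closure scale \<W>)
    \<and> vertex_algebra (field_scale scale) (field_closure scale \<W>) id_field (nth_prod scale)
    \<and> (\<forall>a \<in> field_closure scale \<W>.
          va_translation (nth_prod scale) id_field a = field_D_z scale a)"
proof -
  interpret complex_space scale
    using assms(1) by (simp add: complex_space_def)
  note V = field_closure_local[OF assms(2)]
  have "va_translation (nth_prod scale) id_field a = field_D_z scale a"
    if "a \<in> field_closure scale \<W>" for a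
    unfolding va_translation_def
    using that V(2) by (intro nth_prod_id_right(3)) (auto simp: local_collection_def LFie_iff)
  then show ?thesis
    using V vertex_algebra_closed_collection[OF V] by blast
qed

end
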